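(* Let $\theta=(\{\theta_s\}_{s\in S},\{X_s\}_{s\in S})$ be an action of an inverse semigroup $S$ on a locally compact, Hausdorff, zero-dimensional space $X$, and let $\mathcal O$ be an $S\ltimes X$-sheaf of fields. If $\Gamma_c((S\ltimes X)^{(0)},\mathcal O)$ is maximal commutative (in $\Gamma_c(S\ltimes X,\mathcal O)$), then $\Gamma_c(S\ltimes X,\mathcal O)$ is semiprimitive.
   Context: "Compact" includes Hausdorff. Zero-dimensional: having a basis of compact open sets. An action $\theta$ of an inverse semigroup $S$ on $X$ is a semigroup homomorphism $s\mapsto\theta_s$ to the inverse semigroup of homeomorphisms between open subsets of $X$, where $\theta_s:X_{s^*}\to X_s$, and such that $\bigcup_{s\in S}X_s=X$. Groupoid of germs $S\ltimes X$: unit space $X$; arrows are classes $[s,x]$ of pairs $(s,x)\in S\times X$ with $x\in X_{s^*}$, where $(s,x)\sim(t,y)$ iff $x=y$ and there is $u\le s,t$ with $x\in X_{u^*}$; $\boldsymbol d([s,x])=x$, $\boldsymbol r([s,x])=\theta_s(x)$, $[s,\theta_t(x)][t,x]=[st,x]$, $[s,x]^{-1}=[s^*,\theta_s(x)]$; basic open sets $(s,U)=\{[s,x]:x\in U\}$ for $U\subseteq X_{s^*}$ open. It is an ample groupoid: a topological groupoid with locally compact Hausdorff unit space having a basis of compact open sets and with $\boldsymbol r$ a local homeomorphism. For an ample groupoid $\mathscr G$: a bisection is a subset on which $\boldsymbol d$ and $\boldsymbol r$ are injective. A $\mathscr G$-sheaf $(E,p,\alpha)$ is a space $E$, a local homeomorphism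 $p:E\to\mathscr G^{(0)}$ and a continuous map $\alpha:\mathscr G\times_{\boldsymbol d,p}E\to E$, $(\gamma,e)\mapsto\alpha_\gamma(e)$, with $\alpha_{p(e)}(e)=e$, $p(\alpha_\gamma(e))=\boldsymbol r(\gamma)$, and $\alpha_\beta(\alpha_\gamma(e))=\alpha_{\beta\gamma}(e)$ whenever defined. A $\mathscr G$-sheaf of rings $\mathcal O=(E,p,\alpha)$ is a $\mathscr G$-sheaf with a unital ring structure on each stalk $\mathcal O_x=p^{-1}(x)$ such that fiberwise addition and multiplication $E\times_{p,p}E\to E$ and the unit section $x\mapsto1_x$ are continuous, and each $\alpha_\gamma:\mathcal O_{\boldsymbol d(\gamma)}\to\mathcal O_{\boldsymbol r(\gamma)}$ is a (unital) ring homomorphism; it is a sheaf of fields if all stalks are fields. $\Gamma_c(\mathscr G,\mathcal O)$ is the additive group generated by all maps $f:\mathscr G\to E$ with $p\circ f=\boldsymbol r$ for which there is a compact open bisection $U$ with $f|_U$ continuous and $f=0$ off $U$; it is a ring under pointwise addition and convolution $(f*g)(\gamma)=\sum_{\beta\rho=\gamma}f(\beta)\alpha_\beta(g(\rho))$. $\Gamma_c(\mathscr G^{(0)},\mathcal O)$ is the ring of compactly supported continuous sections $\mathscr G^{(0)}\to E$ of $p$ with pointwise operations, viewed as a subring of $\Gamma_c(\mathscr G,\mathcal O)$ by extending by zero. A ring is semiprimitive if its Jacobson radical is zero; equivalently, if it has a faithful semisimple module. *)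

theory Defs
  imports "HOL-Analysis.Abstract_Topological_Spaces" "HOL-Algebra.Product_Groups" "HOL-Algebra.Module"
begin

section \<open>Topological preliminaries\<close>

definition zero_dimensional_space :: "'a topology \<Rightarrow> bool" where
  "zero_dimensional_space X \<longleftrightarrow>
     (\<forall>U x. openin X U \<and> x \<in> U \<longrightarrow> (\<exists>K. openin X K \<and> compactin X K \<and> x \<in> K \<and> K \<subseteq> U))"

definition local_homeomorphism :: "'a topology \<Rightarrow> 'b topology \<Rightarrow> ('a \<Rightarrow> 'b) \<Rightarrow> bool" where
  "local_homeomorphism E X p \<longleftrightarrow>
     (\<forall>e \<in> topspace E. \<exists>U. openin E U \<and> e \<in> U \<and> openin X (p ` U) \<and>
        homeomorphic_map (subtopology E U) (subtopology X (p ` U)) p)"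

section \<open>Inverse semigroups and their actions\<close>

class inverse_semigroup = semigroup_mult +
  assumes ex1_star: "\<exists>!t. s * t * s = s \<and> t * s * t = t"

definition star :: "'s::inverse_semigroup \<Rightarrow> 's" where
  "star s = (THE t. s * t * s = s \<and> t * s * t = t)"

definition idem :: "'s::inverse_semigroup \<Rightarrow> bool" where
  "idem e \<longleftrightarrow> e * e = e"

definition nat_le :: "'s::inverse_semigroup \<Rightarrow> 's \<Rightarrow> bool" where
  "nat_le s t \<longleftrightarrow> (\<exists>e. idem e \<and> s = t * e)"

text \<open>
  The values of \<^term>\<open>\<theta> s\<close> are only relevant on its domain \<^term>\<open>D (star s)\<close>; the set
  \<^term>\<open>D s\<close> is its range. The last two assumptions say that \<^term>\<open>\<theta> (s * t)\<close> and
  the composite of the partial maps \<^term>\<open>\<theta> s\<close> and \<^term>\<open>\<theta> t\<close> have the same domain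
  and agree there.
\<close>

locale inverse_semigroup_action =
  fixes X :: "'x topology"
    and D :: "'s::inverse_semigroup \<Rightarrow> 'x set"
    and \<theta> :: "'s \<Rightarrow> 'x \<Rightarrow> 'x"
  assumes open_D: "openin X (D s)"
    and Union_D: "(\<Union>s. D s) = topspace X"
    and homeo: "homeomorphic_map (subtopology X (D (star s))) (subtopology X (D s)) (\<theta> s)"
    and dom_mult: "D (star (s * t)) = {x \<in> D (star t). \<theta> t x \<in> D (star s)}"
    and act_mult: "x \<in> D (star (s * t)) \<Longrightarrow> \<theta> (s * t) x = \<theta> s (\<theta> t x)"

section \<open>Groupoids and the groupoid of germs\<close>

text \<open>
  The unit space is a separate space \<^term>\<open>Obj G\<close>; \<^term>\<open>ident G\<close> sends its points to
  the identity arrows. The product \<^term>\<open>gmult G \<beta> \<gamma>\<close> is meaningful when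
  \<^prop>\<open>src G \<beta> = trg G \<gamma>\<close>.
\<close>

record ('g, 'x) top_groupoid =
  Arr :: "'g topology"
  Obj :: "'x topology"
  src :: "'g \<Rightarrow> 'x"
  trg :: "'g \<Rightarrow> 'x"
  gmult :: "'g \<Rightarrow> 'g \<Rightarrow> 'g"
  ident :: "'x \<Rightarrow> 'g"
  ginv :: "'g \<Rightarrow> 'g"

definition bisection :: "('g, 'x) top_groupoid \<Rightarrow> 'g set \<Rightarrow> bool" where
  "bisection G U \<longleftrightarrow> U \<subseteq> topspace (Arr G) \<and> inj_on (src G) U \<and> inj_on (trg G) U"

definition composable :: "('g, 'x) top_groupoid \<Rightarrow> ('g \<times> 'g) set" where
  "composable G = {(\<beta>, \<gamma>). \<beta> \<in> topspace (Arr G) \<and> \<gamma> \<in> topspace (Arr G) \<and> src G \<beta> = trg G \<gamma>}"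

definition germ_rel :: "('s::inverse_semigroup \<Rightarrow> 'x set) \<Rightarrow> (('s \<times> 'x) \<times> ('s \<times> 'x)) set" where
  "germ_rel D = {((s, x), (t, y)). x \<in> D (star s) \<and> y \<in> D (star t) \<and> x = y \<and>
     (\<exists>u. nat_le u s \<and> nat_le u t \<and> x \<in> D (star u))}"

definition germ :: "('s::inverse_semigroup \<Rightarrow> 'x set) \<Rightarrow> 's \<Rightarrow> 'x \<Rightarrow> ('s \<times> 'x) set" where
  "germ D s x = germ_rel D `` {(s, x)}"

text \<open>
  The structure maps are defined on classes by taking the single value obtained from all choices of
  representatives.
\<close>

definition germ_groupoid ::
  "'x topology \<Rightarrow> ('s::inverse_semigroup \<Rightarrow> 'x set) \<Rightarrow> ('s \<Rightarrow> 'x \<Rightarrow> 'x) \<Rightarrow>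
     (('s \<times> 'x) set, 'x) top_groupoid" where
  "germ_groupoid X D \<theta> =
     \<lparr>Arr = topology_generated_by {germ D s ` U | s U. openin X U \<and> U \<subseteq> D (star s)},
      Obj = X,
      src = (\<lambda>\<gamma>. the_elem {x | s x. (s, x) \<in> \<gamma>}),
      trg = (\<lambda>\<gamma>. the_elem {\<theta> s x | s x. (s, x) \<in> \<gamma>}),
      gmult = (\<lambda>\<beta> \<gamma>. the_elem {germ D (s * t) x | s t x. (s, \<theta> t x) \<in> \<beta> \<and> (t, x) \<in> \<gamma>}),
      ident = (\<lambda>x. the_elem {germ D e x | e. idem e \<and> x \<in> D e}),
      ginv = (\<lambda>\<gamma>. the_elem {germ D (star s) (\<theta> s x) | s x. (s, x) \<in> \<gamma>})\<rparr>"

section \<open>Sheaves of rings over a groupoid\<close>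

record ('g, 'x, 'e) ring_sheaf =
  Tot :: "'e topology"
  proj :: "'e \<Rightarrow> 'x"
  act :: "'g \<Rightarrow> 'e \<Rightarrow> 'e"
  stalk :: "'x \<Rightarrow> 'e ring"

locale groupoid_sheaf =
  fixes G :: "('g, 'x) top_groupoid"
    and \<O> :: "('g, 'x, 'e) ring_sheaf"
  assumes proj_local_homeo: "local_homeomorphism (Tot \<O>) (Obj G) (proj \<O>)"
    and act_continuous:
      "continuous_map
         (subtopology (prod_topology (Arr G) (Tot \<O>)) {(\<gamma>, e). src G \<gamma> = proj \<O> e})
         (Tot \<O>) (\<lambda>(\<gamma>, e). act \<O> \<gamma> e)"
    and act_ident: "e \<in> topspace (Tot \<O>) \<Longrightarrow> act \<O> (ident G (proj \<O> e)) e = e"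
    and proj_act:
      "\<lbrakk>\<gamma> \<in> topspace (Arr G); e \<in> topspace (Tot \<O>); src G \<gamma> = proj \<O> e\<rbrakk>
         \<Longrightarrow> proj \<O> (act \<O> \<gamma> e) = trg G \<gamma>"
    and act_act:
      "\<lbrakk>(\<beta>, \<gamma>) \<in> composable G; e \<in> topspace (Tot \<O>); src G \<gamma> = proj \<O> e\<rbrakk>
         \<Longrightarrow> act \<O> \<beta> (act \<O> \<gamma> e) = act \<O> (gmult G \<beta> \<gamma>) e"

locale sheaf_of_rings = groupoid_sheaf +
  assumes stalk_ring: "x \<in> topspace (Obj G) \<Longrightarrow> ring (stalk \<O> x)"
    and stalk_carrier:
      "x \<in> topspace (Obj G) \<Longrightarrow> carrier (stalk \<O> x) = {e \<in> topspace (Tot \<O>). proj \<O> e = x}"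
    and add_continuous:
      "continuous_map
         (subtopology (prod_topology (Tot \<O>) (Tot \<O>)) {(a, b). proj \<O> a = proj \<O> b})
         (Tot \<O>) (\<lambda>(a, b). a \<oplus>\<^bsub>stalk \<O> (proj \<O> a)\<^esub> b)"
    and mult_continuous:
      "continuous_map
         (subtopology (prod_topology (Tot \<O>) (Tot \<O>)) {(a, b). proj \<O> a = proj \<O> b})
         (Tot \<O>) (\<lambda>(a, b). a \<otimes>\<^bsub>stalk \<O> (proj \<O> a)\<^esub> b)"
    and one_continuous: "continuous_map (Obj G) (Tot \<O>) (\<lambda>x. \<one>\<^bsub>stalk \<O> x\<^esub>)"
    and act_ring_hom:
      "\<gamma> \<in> topspace (Arr G) \<Longrightarrow>
         act \<O> \<gamma> \<in> ring_hom (stalk \<O> (src G \<gamma>)) (stalk \<O> (trg G \<gamma>))"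

locale sheaf_of_fields = sheaf_of_rings +
  assumes stalk_field: "x \<in> topspace (Obj G) \<Longrightarrow> field (stalk \<O> x)"

section \<open>The ring of sections with convolution\<close>

text \<open>
  The group of all maps \<^term>\<open>f\<close> from arrows to the total space with \<^term>\<open>f \<gamma>\<close> in the
  stalk over \<^term>\<open>trg G \<gamma>\<close>, under pointwise addition. Maps are extensional: they take the
  value \<^const>\<open>undefined\<close> outside the set of arrows, so that equality of sections is equality in HOL.
\<close>

definition section_group ::
  "('g, 'x) top_groupoid \<Rightarrow> ('g, 'x, 'e) ring_sheaf \<Rightarrow> ('g \<Rightarrow> 'e) monoid" where
  "section_group G \<O> = product_group (topspace (Arr G)) (\<lambda>\<gamma>. add_monoid (stalk \<O> (trg G \<gamma>)))"

definition elementary_sections ::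
  "('g, 'x) top_groupoid \<Rightarrow> ('g, 'x, 'e) ring_sheaf \<Rightarrow> ('g \<Rightarrow> 'e) set" where
  "elementary_sections G \<O> =
     {f \<in> carrier (section_group G \<O>).
        \<exists>U. bisection G U \<and> openin (Arr G) U \<and> compactin (Arr G) U \<and>
          continuous_map (subtopology (Arr G) U) (Tot \<O>) f \<and>
          (\<forall>\<gamma> \<in> topspace (Arr G) - U. f \<gamma> = \<zero>\<^bsub>stalk \<O> (trg G \<gamma>)\<^esub>)}"

text \<open>
  The sum is taken over the nonzero terms, because \<^const>\<open>finsum\<close> returns zero on every
  infinite index set. For sections in the additive group generated by
  \<^const>\<open>elementary_sections\<close> there are only finitely many nonzero terms.
\<close>

definition convolution ::
  "('g, 'x) top_groupoid \<Rightarrow> ('g, 'x, 'e) ring_sheaf \<Rightarrow> ('g \<Rightarrow> 'e) \<Rightarrow> ('g \<Rightarrow> 'e) \<Rightarrow> 'g \<Rightarrow> 'e" where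
  "convolution G \<O> f g =
     (\<lambda>\<gamma> \<in> topspace (Arr G).
        let R = stalk \<O> (trg G \<gamma>); h = (\<lambda>(\<beta>, \<rho>). f \<beta> \<otimes>\<^bsub>R\<^esub> act \<O> \<beta> (g \<rho>))
        in finsum R h {(\<beta>, \<rho>) \<in> composable G. gmult G \<beta> \<rho> = \<gamma> \<and> h (\<beta>, \<rho>) \<noteq> \<zero>\<^bsub>R\<^esub>})"

definition extend_by_zero ::
  "('g, 'x) top_groupoid \<Rightarrow> ('g, 'x, 'e) ring_sheaf \<Rightarrow> ('x \<Rightarrow> 'e) \<Rightarrow> 'g \<Rightarrow> 'e" where
  "extend_by_zero G \<O> f =
     (\<lambda>\<gamma> \<in> topspace (Arr G).
        if \<gamma> = ident G (src G \<gamma>) then f (src G \<gamma>) else \<zero>\<^bsub>stalk \<O> (trg G \<gamma>)\<^esub>)"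

text \<open>
  In general this ring has no identity. The field \<^const>\<open>one\<close> of the record is the unit
  section, which belongs to the carrier exactly when the unit space is compact; none of the
  ring-theoretic notions below refers to it.
\<close>

definition section_ring ::
  "('g, 'x) top_groupoid \<Rightarrow> ('g, 'x, 'e) ring_sheaf \<Rightarrow> ('g \<Rightarrow> 'e) ring" where
  "section_ring G \<O> =
     \<lparr>carrier = generate (section_group G \<O>) (elementary_sections G \<O>),
      monoid.mult = convolution G \<O>,
      one = extend_by_zero G \<O> (\<lambda>x. \<one>\<^bsub>stalk \<O> x\<^esub>),
      zero = \<one>\<^bsub>section_group G \<O>\<^esub>,
      add = monoid.mult (section_group G \<O>)\<rparr>"

definition unit_space_sections ::
  "('g, 'x) top_groupoid \<Rightarrow> ('g, 'x, 'e) ring_sheaf \<Rightarrow> ('x \<Rightarrow> 'e) set" where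
  "unit_space_sections G \<O> =
     {f \<in> (\<Pi>\<^sub>E x \<in> topspace (Obj G). carrier (stalk \<O> x)).
        continuous_map (Obj G) (Tot \<O>) f \<and>
        compactin (Obj G) (Obj G closure_of {x \<in> topspace (Obj G). f x \<noteq> \<zero>\<^bsub>stalk \<O> x\<^esub>})}"

definition diagonal_subring ::
  "('g, 'x) top_groupoid \<Rightarrow> ('g, 'x, 'e) ring_sheaf \<Rightarrow> ('g \<Rightarrow> 'e) set" where
  "diagonal_subring G \<O> = extend_by_zero G \<O> ` unit_space_sections G \<O>"

section \<open>Rings without identity\<close>

definition commutative_subring :: "('r, 'c) ring_scheme \<Rightarrow> 'r set \<Rightarrow> bool" where
  "commutative_subring R C \<longleftrightarrow>
     subgroup C (add_monoid R) \<and>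
     (\<forall>a \<in> C. \<forall>b \<in> C. a \<otimes>\<^bsub>R\<^esub> b \<in> C \<and> a \<otimes>\<^bsub>R\<^esub> b = b \<otimes>\<^bsub>R\<^esub> a)"

definition maximal_commutative :: "('r, 'c) ring_scheme \<Rightarrow> 'r set \<Rightarrow> bool" where
  "maximal_commutative R C \<longleftrightarrow>
     commutative_subring R C \<and> (\<forall>C'. commutative_subring R C' \<and> C \<subseteq> C' \<longrightarrow> C' = C)"

locale left_module =
  fixes R :: "('r, 'c) ring_scheme"
    and M :: "('r, 'm, 'd) module_scheme"
  assumes abelian: "abelian_group M"
    and smult_closed: "\<lbrakk>a \<in> carrier R; m \<in> carrier M\<rbrakk> \<Longrightarrow> a \<odot>\<^bsub>M\<^esub> m \<in> carrier M"
    and smult_l_distr: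
      "\<lbrakk>a \<in> carrier R; b \<in> carrier R; m \<in> carrier M\<rbrakk>
         \<Longrightarrow> (a \<oplus>\<^bsub>R\<^esub> b) \<odot>\<^bsub>M\<^esub> m = a \<odot>\<^bsub>M\<^esub> m \<oplus>\<^bsub>M\<^esub> b \<odot>\<^bsub>M\<^esub> m"
    and smult_r_distr:
      "\<lbrakk>a \<in> carrier R; m \<in> carrier M; n \<in> carrier M\<rbrakk>
         \<Longrightarrow> a \<odot>\<^bsub>M\<^esub> (m \<oplus>\<^bsub>M\<^esub> n) = a \<odot>\<^bsub>M\<^esub> m \<oplus>\<^bsub>M\<^esub> a \<odot>\<^bsub>M\<^esub> n"
    and smult_assoc:
      "\<lbrakk>a \<in> carrier R; b \<in> carrier R; m \<in> carrier M\<rbrakk>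
         \<Longrightarrow> (a \<otimes>\<^bsub>R\<^esub> b) \<odot>\<^bsub>M\<^esub> m = a \<odot>\<^bsub>M\<^esub> (b \<odot>\<^bsub>M\<^esub> m)"

definition submodule_of ::
  "'m set \<Rightarrow> ('r, 'c) ring_scheme \<Rightarrow> ('r, 'm, 'd) module_scheme \<Rightarrow> bool" where
  "submodule_of N R M \<longleftrightarrow>
     subgroup N (add_monoid M) \<and> (\<forall>a \<in> carrier R. \<forall>n \<in> N. a \<odot>\<^bsub>M\<^esub> n \<in> N)"

text \<open>
  Over a ring without identity, simplicity includes that the scalar multiplication is not
  identically zero.
\<close>

definition simple_module :: "('r, 'c) ring_scheme \<Rightarrow> ('r, 'm, 'd) module_scheme \<Rightarrow> bool" where
  "simple_module R M \<longleftrightarrow>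
     left_module R M \<and>
     (\<exists>a \<in> carrier R. \<exists>m \<in> carrier M. a \<odot>\<^bsub>M\<^esub> m \<noteq> \<zero>\<^bsub>M\<^esub>) \<and>
     (\<forall>N. submodule_of N R M \<longrightarrow> N = {\<zero>\<^bsub>M\<^esub>} \<or> N = carrier M)"

text \<open>
  The Jacobson radical is the intersection of the annihilators of all simple left modules. Every
  simple module is isomorphic to a quotient of \<^term>\<open>R\<close> by a left ideal, whose elements are
  cosets, so modules on the type \<^typ>\<open>'r set\<close> suffice; the lemma after the definition
  confirms that the radical annihilates simple modules on every type.
\<close>

definition jacobson_radical :: "('r, 'c) ring_scheme \<Rightarrow> 'r set" where
  "jacobson_radical R =
     {a \<in> carrier R. \<forall>M :: ('r, 'r set) module.
        simple_module R M \<longrightarrow> (\<forall>m \<in> carrier M. a \<odot>\<^bsub>M\<^esub> m = \<zero>\<^bsub>M\<^esub>)}"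

lemma jacobson_radical_annihilates:
  fixes R :: "('r, 'c) ring_scheme" and M :: "('r, 'm) module"
  assumes R: "abelian_group R"
    and R_mult: "\<And>r s. \<lbrakk>r \<in> carrier R; s \<in> carrier R\<rbrakk> \<Longrightarrow> r \<otimes>\<^bsub>R\<^esub> s \<in> carrier R"
    and a: "a \<in> jacobson_radical R"
    and M: "simple_module R M"
    and m: "m \<in> carrier M"
  shows "a \<odot>\<^bsub>M\<^esub> m = \<zero>\<^bsub>M\<^esub>"
proof -
  interpret R: abelian_group R by (rule R)
  interpret left_module R M using M by (simp add: simple_module_def)
  interpret M: abelian_group M by (rule abelian)
  have zero_smult: "\<zero>\<^bsub>R\<^esub> \<odot>\<^bsub>M\<^esub> x = \<zero>\<^bsub>M\<^esub>" if "x \<in> carrier M" for x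
    using smult_l_distr[of "\<zero>\<^bsub>R\<^esub>" "\<zero>\<^bsub>R\<^esub>" x] that smult_closed[of "\<zero>\<^bsub>R\<^esub>" x]
    by (metis M.add.l_cancel_one R.add.one_closed R.add.r_one)
  have minus_smult: "(\<ominus>\<^bsub>R\<^esub> r) \<odot>\<^bsub>M\<^esub> x = \<ominus>\<^bsub>M\<^esub> (r \<odot>\<^bsub>M\<^esub> x)" if "r \<in> carrier R" "x \<in> carrier M" for r x
    using smult_l_distr[of "\<ominus>\<^bsub>R\<^esub> r" r x] zero_smult[of x] that
    by (metis M.minus_equality R.a_inv_closed R.l_neg smult_closed)
  obtain b n where bn: "b \<in> carrier R" "n \<in> carrier M" "b \<odot>\<^bsub>M\<^esub> n \<noteq> \<zero>\<^bsub>M\<^esub>"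
    using M by (auto simp: simple_module_def)
  have "submodule_of ((\<lambda>r. r \<odot>\<^bsub>M\<^esub> n) ` carrier R) R M"
    unfolding submodule_of_def
  proof (intro conjI ballI)
    show "subgroup ((\<lambda>r. r \<odot>\<^bsub>M\<^esub> n) ` carrier R) (add_monoid M)"
    proof (rule M.add.subgroupI)
      fix x assume "x \<in> (\<lambda>r. r \<odot>\<^bsub>M\<^esub> n) ` carrier R"
      then obtain r where "r \<in> carrier R" "x = r \<odot>\<^bsub>M\<^esub> n" by blast
      then show "\<ominus>\<^bsub>M\<^esub> x \<in> (\<lambda>r. r \<odot>\<^bsub>M\<^esub> n) ` carrier R"
        using bn minus_smult by (intro image_eqI[of _ _ "\<ominus>\<^bsub>R\<^esub> r"]) auto
    next
      fix x y assume "x \<in> (\<lambda>r. r \<odot>\<^bsub>M\<^esub> n) ` carrier R" "y \<in> (\<lambda>r. r \<odot>\<^bsub>M\<^esub> n) ` carrier R"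
      then obtain r s where "r \<in> carrier R" "x = r \<odot>\<^bsub>M\<^esub> n" "s \<in> carrier R" "y = s \<odot>\<^bsub>M\<^esub> n" by blast
      then show "x \<oplus>\<^bsub>M\<^esub> y \<in> (\<lambda>r. r \<odot>\<^bsub>M\<^esub> n) ` carrier R"
        using bn smult_l_distr by (intro image_eqI[of _ _ "r \<oplus>\<^bsub>R\<^esub> s"]) auto
    qed (use bn smult_closed in auto)
  next
    fix r x assume r: "r \<in> carrier R" and "x \<in> (\<lambda>r. r \<odot>\<^bsub>M\<^esub> n) ` carrier R"
    then obtain s where "s \<in> carrier R" "x = s \<odot>\<^bsub>M\<^esub> n" by blast
    then show "r \<odot>\<^bsub>M\<^esub> x \<in> (\<lambda>r. r \<odot>\<^bsub>M\<^esub> n) ` carrier R"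
      using r bn smult_assoc R_mult by (intro image_eqI[of _ _ "r \<otimes>\<^bsub>R\<^esub> s"]) auto
  qed
  then have gen: "(\<lambda>r. r \<odot>\<^bsub>M\<^esub> n) ` carrier R = carrier M"
    using M bn unfolding simple_module_def by blast
  define i where "i x = {r \<in> carrier R. r \<odot>\<^bsub>M\<^esub> n = x}" for x
  have inj: "inj_on i (carrier M)"
  proof (rule inj_onI)
    fix x y assume "x \<in> carrier M" "y \<in> carrier M" "i x = i y"
    moreover from this obtain r where "r \<in> carrier R" "x = r \<odot>\<^bsub>M\<^esub> n" using gen by blast
    ultimately have "r \<in> i y" by (auto simp: i_def)
    then show "x = y" using \<open>x = r \<odot>\<^bsub>M\<^esub> n\<close> by (simp add: i_def)
  qed
  define k where "k = inv_into (carrier M) i"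
  have k_i [simp]: "k (i x) = x" if "x \<in> carrier M" for x
    using inj that by (simp add: k_def)
  define M' :: "('r, 'r set) module" where
    "M' = \<lparr>carrier = i ` carrier M, monoid.mult = undefined, one = undefined, zero = i \<zero>\<^bsub>M\<^esub>,
           add = (\<lambda>A B. i (k A \<oplus>\<^bsub>M\<^esub> k B)), smult = (\<lambda>r A. i (r \<odot>\<^bsub>M\<^esub> k A))\<rparr>"
  have M'_simps [simp]: "carrier M' = i ` carrier M" "\<zero>\<^bsub>M'\<^esub> = i \<zero>\<^bsub>M\<^esub>"
    "A \<oplus>\<^bsub>M'\<^esub> B = i (k A \<oplus>\<^bsub>M\<^esub> k B)" "r \<odot>\<^bsub>M'\<^esub> A = i (r \<odot>\<^bsub>M\<^esub> k A)" for A B r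
    by (simp_all add: M'_def)
  have ab': "abelian_group M'"
  proof (rule abelian_groupI)
    fix x assume "x \<in> carrier M'"
    then obtain y where "y \<in> carrier M" "x = i y" by auto
    then show "\<exists>y \<in> carrier M'. y \<oplus>\<^bsub>M'\<^esub> x = \<zero>\<^bsub>M'\<^esub>"
      by (intro bexI[of _ "i (\<ominus>\<^bsub>M\<^esub> y)"]) (auto simp: M.l_neg)
  qed (clarsimp simp: M.a_ac)+
  have lm': "left_module R M'"
    by (rule left_module.intro)
      (clarsimp simp: ab' smult_closed smult_l_distr smult_r_distr smult_assoc R_mult)+
  have "simple_module R M'"
    unfolding simple_module_def
  proof (intro conjI allI impI)
    show "\<exists>a \<in> carrier R. \<exists>m \<in> carrier M'. a \<odot>\<^bsub>M'\<^esub> m \<noteq> \<zero>\<^bsub>M'\<^esub>"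
      using bn inj smult_closed[OF bn(1,2)] by (auto simp: inj_on_def intro!: bexI[of _ b] bexI[of _ n])
  next
    fix N' assume N': "submodule_of N' R M'"
    then have sub: "subgroup N' (add_monoid M')" by (simp add: submodule_of_def)
    interpret M': abelian_group M' by (rule ab')
    have N'_sub: "N' \<subseteq> i ` carrier M" using subgroup.subset[OF sub] by simp
    have N'_eq: "N' = i ` k ` N'"
      using N'_sub by (force simp: image_image subset_iff)
    have kN': "k x \<in> carrier M \<and> i (k x) = x" if "x \<in> N'" for x
      using that N'_sub by auto
    have "submodule_of (k ` N') R M"
      unfolding submodule_of_def
    proof (intro conjI ballI)
      have smem: "i (r \<odot>\<^bsub>M\<^esub> k x) \<in> N'" if "r \<in> carrier R" "x \<in> N'" for r x
        using N' that by (auto simp: submodule_of_def)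
      show "subgroup (k ` N') (add_monoid M)"
      proof (rule M.add.subgroupI)
        show "k ` N' \<subseteq> carrier M" using kN' by auto
        show "k ` N' \<noteq> {}" using subgroup.one_closed[OF sub] by auto
      next
        fix x assume "x \<in> k ` N'"
        then obtain y where y: "y \<in> N'" "x = k y" by auto
        have "\<ominus>\<^bsub>M'\<^esub> y = i (\<ominus>\<^bsub>M\<^esub> x)"
          by (rule M'.minus_equality) (use y kN' N'_sub in \<open>auto simp: M.l_neg\<close>)
        moreover have "\<ominus>\<^bsub>M'\<^esub> y \<in> N'"
          using subgroup.m_inv_closed[OF sub y(1)] by (simp add: a_inv_def)
        ultimately have "i (\<ominus>\<^bsub>M\<^esub> x) \<in> N'" by simp
        then show "\<ominus>\<^bsub>M\<^esub> x \<in> k ` N'"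
          using y kN' by (intro image_eqI[of _ _ "i (\<ominus>\<^bsub>M\<^esub> x)"]) auto
      next
        fix x y assume "x \<in> k ` N'" "y \<in> k ` N'"
        then obtain x' y' where xy: "x' \<in> N'" "y' \<in> N'" "x = k x'" "y = k y'" by auto
        have "i (x \<oplus>\<^bsub>M\<^esub> y) \<in> N'"
          using subgroup.m_closed[OF sub xy(1,2)] xy by simp
        then show "x \<oplus>\<^bsub>M\<^esub> y \<in> k ` N'"
          using xy kN' by (intro image_eqI[of _ _ "i (x \<oplus>\<^bsub>M\<^esub> y)"]) auto
      qed
      fix r x assume r: "r \<in> carrier R" and "x \<in> k ` N'"
      then obtain x' where x': "x' \<in> N'" "x = k x'" by auto
      then show "r \<odot>\<^bsub>M\<^esub> x \<in> k ` N'"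
        using smem[OF r x'(1)] kN' r smult_closed
        by (intro image_eqI[of _ _ "i (r \<odot>\<^bsub>M\<^esub> x)"]) auto
    qed
    then have "k ` N' = {\<zero>\<^bsub>M\<^esub>} \<or> k ` N' = carrier M"
      using M by (simp add: simple_module_def)
    then show "N' = {\<zero>\<^bsub>M'\<^esub>} \<or> N' = carrier M'"
      using N'_eq by (metis M'_simps(1,2) image_empty image_insert)
  qed (rule lm')
  then have "a \<odot>\<^bsub>M'\<^esub> i m = \<zero>\<^bsub>M'\<^esub>"
    using a m by (auto simp del: M'_simps(2-4) simp: jacobson_radical_def)
  moreover have "a \<in> carrier R" using a by (simp add: jacobson_radical_def)
  ultimately show ?thesis
    using inj m smult_closed by (auto simp: inj_on_def)
qed

definition semiprimitive :: "('r, 'c) ring_scheme \<Rightarrow> bool" where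
  "semiprimitive R \<longleftrightarrow> jacobson_radical R = {\<zero>\<^bsub>R\<^esub>}"

end

theory Submission
  imports Defs
begin

text \<open>
  Two facts are combined. First, every nonzero ideal \<open>I\<close> of the section ring meets the
  diagonal. Write a nonzero element of \<open>I\<close> as a sum of as few sections over basic bisections as
  possible, and multiply it on the right so that one of these bisections consists of identity arrows.
  For diagonal sections \<open>\<alpha>\<close> and \<open>\<beta>\<close> the operation
  \<open>f \<mapsto> \<alpha> * f + f * \<beta>\<close> preserves \<open>I\<close> and each bisection, so by minimality it cannot
  annihilate one summand without annihilating the sum. Choosing \<open>\<beta>\<close> freely on the source of a
  bisection and \<open>\<alpha>\<close> as minus its transport to the range, one finds that every arrow in the
  support of the sum fixes its source and acts trivially on the stalk. Such a section centralises the
  diagonal, hence lies in it. This needs no topological property of the arrow space, which need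
  not be Hausdorff.

  Second, since stalks are fields and sections that agree at a point agree near it, a nonzero diagonal
  section is invertible over some nonempty compact open set \<open>K\<close>. A nonzero radical would therefore
  contain the idempotent given by the unit section over \<open>K\<close>, but a Jacobson radical contains no
  nonzero idempotent.
\<close>

section \<open>Rings without identity\<close>

text \<open>What is minimised is the number of summands, not the size of a support. When the arrow
  space is not Hausdorff, overlapping summands can cancel at germs arbitrarily close to one where
  they survive, so a support need not be open and germs cannot be separated by shrinking
  neighbourhoods. The operation of the overview, called \<open>twist\<close> below, avoids this: at
  an arrow \<gamma> it multiplies the value by the scalar \<alpha>(trg \<gamma>) +
  \<gamma>\<beta>(src \<gamma>), so it only has to separate points of the unit space, which is
  Hausdorff with a basis of compact open sets, and values of local sections. That stalks are fields
  enters this step twice: commutativity merges the left and the right factor into one scalar, and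
  without zero divisors a nonzero scalar keeps a nonzero value. The argument speaks only of arrows
  at which the whole sum is nonzero. A priori such an arrow may be a nonidentity isotropy arrow; the
  hypothesis on the diagonal is what excludes this.\<close>

locale nonunital_ring = abelian_group R for R (structure) +
  assumes m_closed [simp, intro]: "\<lbrakk>a \<in> carrier R; b \<in> carrier R\<rbrakk> \<Longrightarrow> a \<otimes> b \<in> carrier R"
    and m_assoc: "\<lbrakk>a \<in> carrier R; b \<in> carrier R; c \<in> carrier R\<rbrakk> \<Longrightarrow> (a \<otimes> b) \<otimes> c = a \<otimes> (b \<otimes> c)"
    and l_distr: "\<lbrakk>a \<in> carrier R; b \<in> carrier R; c \<in> carrier R\<rbrakk> \<Longrightarrow> (a \<oplus> b) \<otimes> c = a \<otimes> c \<oplus> b \<otimes> c"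
    and r_distr: "\<lbrakk>a \<in> carrier R; b \<in> carrier R; c \<in> carrier R\<rbrakk> \<Longrightarrow> a \<otimes> (b \<oplus> c) = a \<otimes> b \<oplus> a \<otimes> c"
begin

lemma l_null [simp]: "a \<in> carrier R \<Longrightarrow> \<zero> \<otimes> a = \<zero>"
  using l_distr[of \<zero> \<zero> a] add.l_cancel_one[of "\<zero> \<otimes> a" "\<zero> \<otimes> a"] by simp

lemma r_null [simp]: "a \<in> carrier R \<Longrightarrow> a \<otimes> \<zero> = \<zero>"
  using r_distr[of a \<zero> \<zero>] add.l_cancel_one[of "a \<otimes> \<zero>" "a \<otimes> \<zero>"] by simp

lemma l_minus: "\<lbrakk>a \<in> carrier R; b \<in> carrier R\<rbrakk> \<Longrightarrow> (\<ominus> a) \<otimes> b = \<ominus> (a \<otimes> b)"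
  using l_distr[of "\<ominus> a" a b] by (simp add: l_neg minus_equality)

lemma r_minus: "\<lbrakk>a \<in> carrier R; b \<in> carrier R\<rbrakk> \<Longrightarrow> a \<otimes> (\<ominus> b) = \<ominus> (a \<otimes> b)"
  using r_distr[of a "\<ominus> b" b] by (simp add: l_neg minus_equality)

definition centralizer :: "'a set \<Rightarrow> 'a set" where
  "centralizer S = {a \<in> carrier R. \<forall>s \<in> S. a \<otimes> s = s \<otimes> a}"

lemma subgroup_centralizer:
  assumes "S \<subseteq> carrier R"
  shows "subgroup (centralizer S) (add_monoid R)"
proof (rule add.subgroupI)
  show "centralizer S \<noteq> {}"
    using assms by (auto simp: centralizer_def intro!: exI[of _ \<zero>])
next
  fix a assume "a \<in> centralizer S"
  then show "\<ominus> a \<in> centralizer S"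
    using assms by (simp add: centralizer_def l_minus r_minus subset_iff)
next
  fix a b assume "a \<in> centralizer S" "b \<in> centralizer S"
  then show "a \<oplus> b \<in> centralizer S"
    using assms by (simp add: centralizer_def l_distr r_distr subset_iff)
qed (simp add: centralizer_def)

lemma centralizer_m_closed:
  assumes "S \<subseteq> carrier R" "a \<in> centralizer S" "b \<in> centralizer S"
  shows "a \<otimes> b \<in> centralizer S"
proof -
  have "(a \<otimes> b) \<otimes> s = s \<otimes> (a \<otimes> b)" if "s \<in> S" for s
  proof -
    have *: "a \<in> carrier R" "b \<in> carrier R" "s \<in> carrier R" "a \<otimes> s = s \<otimes> a" "b \<otimes> s = s \<otimes> b"
      using assms that by (auto simp: centralizer_def)
    then show ?thesis by (metis m_assoc)
  qed
  then show ?thesis using assms by (auto simp: centralizer_def)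
qed

text \<open>
  Maximality is applied to the bicommutant of \<open>insert a C\<close>, which is commutative because
  \<open>insert a C\<close> commutes with itself.
\<close>

lemma maximal_commutative_centralizer:
  assumes "maximal_commutative R C"
  shows "centralizer C \<subseteq> C"
proof
  fix a assume a: "a \<in> centralizer C"
  have C: "subgroup C (add_monoid R)" "\<And>a b. \<lbrakk>a \<in> C; b \<in> C\<rbrakk> \<Longrightarrow> a \<otimes> b = b \<otimes> a"
    using assms by (auto simp: maximal_commutative_def commutative_subring_def)
  let ?S = "insert a C"
  have S: "?S \<subseteq> carrier R"
    using a subgroup.subset[OF C(1)] by (auto simp: centralizer_def)
  have SS: "?S \<subseteq> centralizer ?S"
    using a S C(2) by (auto simp: centralizer_def)
  have S': "centralizer ?S \<subseteq> carrier R" by (auto simp: centralizer_def)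
  have "commutative_subring R (centralizer (centralizer ?S))"
    unfolding commutative_subring_def
  proof (intro conjI ballI)
    fix b c assume bc: "b \<in> centralizer (centralizer ?S)" "c \<in> centralizer (centralizer ?S)"
    then show "b \<otimes> c \<in> centralizer (centralizer ?S)" by (rule centralizer_m_closed[OF S'])
    have "c \<in> centralizer ?S" using bc(2) SS unfolding centralizer_def by blast
    then show "b \<otimes> c = c \<otimes> b" using bc(1) unfolding centralizer_def by blast
  qed (rule subgroup_centralizer[OF S'])
  moreover have "?S \<subseteq> centralizer (centralizer ?S)"
    using S unfolding centralizer_def by fastforce
  ultimately show "a \<in> C"
    using assms unfolding maximal_commutative_def by auto
qed

section \<open>The Jacobson radical of a ring without identity\<close>

definition two_sided_ideal :: "'a set \<Rightarrow> bool" where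
  "two_sided_ideal I \<longleftrightarrow>
     subgroup I (add_monoid R) \<and> (\<forall>a \<in> I. \<forall>r \<in> carrier R. r \<otimes> a \<in> I \<and> a \<otimes> r \<in> I)"

lemma left_module_zero_smult:
  assumes "left_module R M" "m \<in> carrier M"
  shows "\<zero> \<odot>\<^bsub>M\<^esub> m = \<zero>\<^bsub>M\<^esub>"
proof -
  interpret M: abelian_group M using assms(1) by (rule left_module.abelian)
  show ?thesis
    using left_module.smult_l_distr[OF assms(1), of \<zero> \<zero> m] assms(2)
      left_module.smult_closed[OF assms(1), of \<zero> m]
      M.add.l_cancel_one[of "\<zero> \<odot>\<^bsub>M\<^esub> m" "\<zero> \<odot>\<^bsub>M\<^esub> m"] by simp
qed

lemma left_module_smult_zero:
  assumes "left_module R M" "a \<in> carrier R"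
  shows "a \<odot>\<^bsub>M\<^esub> \<zero>\<^bsub>M\<^esub> = \<zero>\<^bsub>M\<^esub>"
proof -
  interpret M: abelian_group M using assms(1) by (rule left_module.abelian)
  show ?thesis
    using left_module.smult_r_distr[OF assms(1), of a "\<zero>\<^bsub>M\<^esub>" "\<zero>\<^bsub>M\<^esub>"] assms(2)
      left_module.smult_closed[OF assms(1), of a "\<zero>\<^bsub>M\<^esub>"]
      M.add.l_cancel_one[of "a \<odot>\<^bsub>M\<^esub> \<zero>\<^bsub>M\<^esub>" "a \<odot>\<^bsub>M\<^esub> \<zero>\<^bsub>M\<^esub>"] by simp
qed

text \<open>Closure under multiplication on the right holds because a radical element annihilates
  the whole of each simple module: (a r) m = a (r m), and r m is again in the module.\<close>

lemma jacobson_radical_ideal: "two_sided_ideal (jacobson_radical R)"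
  unfolding two_sided_ideal_def
proof (intro conjI ballI)
  have mod: "left_module R M" if "simple_module R M" for M :: "('a, 'a set) module"
    using that by (simp add: simple_module_def)
  show "subgroup (jacobson_radical R) (add_monoid R)"
  proof (rule add.subgroupI)
    show "jacobson_radical R \<noteq> {}"
      by (auto simp: jacobson_radical_def left_module_zero_smult mod intro!: exI[of _ \<zero>])
  next
    fix a assume a: "a \<in> jacobson_radical R"
    then have aR: "a \<in> carrier R" by (simp add: jacobson_radical_def)
    have "(\<ominus> a) \<odot>\<^bsub>M\<^esub> m = \<zero>\<^bsub>M\<^esub>"
      if M: "simple_module R M" and m: "m \<in> carrier M" for M :: "('a, 'a set) module" and m
    proof -
      interpret M: abelian_group M using mod[OF M] by (rule left_module.abelian)
      have "a \<odot>\<^bsub>M\<^esub> m = \<zero>\<^bsub>M\<^esub>" using a M m by (simp add: jacobson_radical_def)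
      then show ?thesis
        using left_module.smult_l_distr[OF mod[OF M], of "\<ominus> a" a m] aR m
          left_module.smult_closed[OF mod[OF M], of "\<ominus> a" m]
        by (simp add: l_neg left_module_zero_smult mod M)
    qed
    then show "\<ominus> a \<in> jacobson_radical R"
      using aR by (simp add: jacobson_radical_def)
  next
    fix a b assume ab: "a \<in> jacobson_radical R" "b \<in> jacobson_radical R"
    have "(a \<oplus> b) \<odot>\<^bsub>M\<^esub> m = \<zero>\<^bsub>M\<^esub>"
      if M: "simple_module R M" and m: "m \<in> carrier M" for M :: "('a, 'a set) module" and m
    proof -
      interpret M: abelian_group M using mod[OF M] by (rule left_module.abelian)
      show ?thesis
        using ab M m left_module.smult_l_distr[OF mod[OF M], of a b m]
        by (simp add: jacobson_radical_def)
    qed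
    then show "a \<oplus> b \<in> jacobson_radical R"
      using ab by (simp add: jacobson_radical_def)
  qed (auto simp: jacobson_radical_def)
next
  fix a r assume a: "a \<in> jacobson_radical R" and r: "r \<in> carrier R"
  have *: "(r \<otimes> a) \<odot>\<^bsub>M\<^esub> m = \<zero>\<^bsub>M\<^esub>" "(a \<otimes> r) \<odot>\<^bsub>M\<^esub> m = \<zero>\<^bsub>M\<^esub>"
    if M: "simple_module R M" and m: "m \<in> carrier M" for M :: "('a, 'a set) module" and m
  proof -
    have lm: "left_module R M" using M by (simp add: simple_module_def)
    show "(r \<otimes> a) \<odot>\<^bsub>M\<^esub> m = \<zero>\<^bsub>M\<^esub>" "(a \<otimes> r) \<odot>\<^bsub>M\<^esub> m = \<zero>\<^bsub>M\<^esub>"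
      using a r M m left_module_smult_zero[OF lm] left_module.smult_closed[OF lm]
      by (auto simp: jacobson_radical_def left_module.smult_assoc[OF lm])
  qed
  show "r \<otimes> a \<in> jacobson_radical R" "a \<otimes> r \<in> jacobson_radical R"
    using a r * by (auto simp: jacobson_radical_def)
qed

definition left_ideal :: "'a set \<Rightarrow> bool" where
  "left_ideal L \<longleftrightarrow> subgroup L (add_monoid R) \<and> (\<forall>r \<in> carrier R. \<forall>a \<in> L. r \<otimes> a \<in> L)"

lemma left_ideal_subset: "left_ideal L \<Longrightarrow> L \<subseteq> carrier R"
  unfolding left_ideal_def using subgroup.subset by fastforce

lemma left_ideal_closed:
  assumes "left_ideal L"
  shows "\<zero> \<in> L" "\<lbrakk>a \<in> L; b \<in> L\<rbrakk> \<Longrightarrow> a \<oplus> b \<in> L" "a \<in> L \<Longrightarrow> \<ominus> a \<in> L"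
    "\<lbrakk>r \<in> carrier R; a \<in> L\<rbrakk> \<Longrightarrow> r \<otimes> a \<in> L" "\<lbrakk>a \<in> L; b \<in> L\<rbrakk> \<Longrightarrow> a \<ominus> b \<in> L"
proof -
  have L: "subgroup L (add_monoid R)" using assms by (simp add: left_ideal_def)
  show "\<zero> \<in> L" using subgroup.one_closed[OF L] by simp
  show add: "\<And>a b. \<lbrakk>a \<in> L; b \<in> L\<rbrakk> \<Longrightarrow> a \<oplus> b \<in> L" using subgroup.m_closed[OF L] by simp
  show neg: "\<And>a. a \<in> L \<Longrightarrow> \<ominus> a \<in> L" using subgroup.m_inv_closed[OF L] by (simp add: a_inv_def)
  show "\<lbrakk>r \<in> carrier R; a \<in> L\<rbrakk> \<Longrightarrow> r \<otimes> a \<in> L" using assms by (simp add: left_ideal_def)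
  show "\<lbrakk>a \<in> L; b \<in> L\<rbrakk> \<Longrightarrow> a \<ominus> b \<in> L" using add neg by (simp add: a_minus_def)
qed

text \<open>A coset is a set of ring elements, so the quotient has exactly the module type over
  which \<open>jacobson_radical\<close> quantifies. The operations go through arbitrary
  representatives and are meaningful when L is a left ideal.\<close>

definition left_quotient :: "'a set \<Rightarrow> ('a, 'a set) module" where
  "left_quotient L =
     (let cls = (\<lambda>a. {b \<in> carrier R. a \<ominus> b \<in> L}); rep = (\<lambda>A. SOME a. a \<in> A) in
      \<lparr>carrier = cls ` carrier R, monoid.mult = undefined, one = undefined, zero = cls \<zero>,
       add = (\<lambda>A B. cls (rep A \<oplus> rep B)), smult = (\<lambda>r A. cls (r \<otimes> rep A))\<rparr>)"

text \<open>This interface hides the choice of representatives; from here on the quotient is handled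
  only through the map to cosets.\<close>

lemma left_quotient:
  assumes L: "left_ideal L"
  obtains cls where "carrier (left_quotient L) = cls ` carrier R" "\<zero>\<^bsub>left_quotient L\<^esub> = cls \<zero>"
    and "\<And>a b. \<lbrakk>a \<in> carrier R; b \<in> carrier R\<rbrakk> \<Longrightarrow> cls a = cls b \<longleftrightarrow> a \<ominus> b \<in> L"
    and "\<And>a b. \<lbrakk>a \<in> carrier R; b \<in> carrier R\<rbrakk> \<Longrightarrow> cls a \<oplus>\<^bsub>left_quotient L\<^esub> cls b = cls (a \<oplus> b)"
    and "\<And>a r. \<lbrakk>a \<in> carrier R; r \<in> carrier R\<rbrakk> \<Longrightarrow> r \<odot>\<^bsub>left_quotient L\<^esub> cls a = cls (r \<otimes> a)"
proof -
  note closed = left_ideal_closed[OF L]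
  define cls where "cls a = {b \<in> carrier R. a \<ominus> b \<in> L}" for a
  define rep where "rep A = (SOME a. a \<in> A)" for A :: "'a set"
  have eq: "cls a = cls b \<longleftrightarrow> a \<ominus> b \<in> L" if ab: "a \<in> carrier R" "b \<in> carrier R" for a b
  proof
    assume "cls a = cls b"
    moreover have "b \<in> cls b" using ab closed(1) by (simp add: cls_def r_neg a_minus_def)
    ultimately have "b \<in> cls a" by simp
    then show "a \<ominus> b \<in> L" by (simp add: cls_def)
  next
    assume *: "a \<ominus> b \<in> L"
    have "a \<ominus> c \<in> L \<longleftrightarrow> b \<ominus> c \<in> L" if c: "c \<in> carrier R" for c
    proof -
      have "a \<ominus> c = (a \<ominus> b) \<oplus> (b \<ominus> c)" "b \<ominus> c = \<ominus> (a \<ominus> b) \<oplus> (a \<ominus> c)"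
        using ab c by (simp_all add: a_minus_def minus_add a_ac r_neg1 r_neg2)
      then show ?thesis using closed * by metis
    qed
    then show "cls a = cls b" by (auto simp: cls_def)
  qed
  have rep: "rep (cls a) \<in> carrier R \<and> a \<ominus> rep (cls a) \<in> L" if "a \<in> carrier R" for a
  proof -
    have "a \<in> cls a" using that closed(1) by (simp add: cls_def r_neg a_minus_def)
    then have "rep (cls a) \<in> cls a" unfolding rep_def by (rule someI)
    then show ?thesis by (simp add: cls_def)
  qed
  have Q: "left_quotient L = \<lparr>carrier = cls ` carrier R, monoid.mult = undefined, one = undefined,
     zero = cls \<zero>, add = (\<lambda>A B. cls (rep A \<oplus> rep B)), smult = (\<lambda>r A. cls (r \<otimes> rep A))\<rparr>"
    by (simp add: left_quotient_def cls_def[abs_def] rep_def[abs_def] Let_def)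
  show ?thesis
  proof
    fix a b assume ab: "a \<in> carrier R" "b \<in> carrier R"
    show "cls a = cls b \<longleftrightarrow> a \<ominus> b \<in> L" using eq ab .
    \<comment> \<open>The chosen representatives differ from a and b by elements of L, and a left
      ideal absorbs the resulting difference of the sums, and below that of the products.\<close>
    have "rep (cls a) \<oplus> rep (cls b) \<ominus> (a \<oplus> b) = \<ominus> ((a \<ominus> rep (cls a)) \<oplus> (b \<ominus> rep (cls b)))"
      using rep ab by (simp add: a_minus_def minus_add a_ac)
    then have "cls (rep (cls a) \<oplus> rep (cls b)) = cls (a \<oplus> b)"
      using rep ab closed by (subst eq) auto
    then show "cls a \<oplus>\<^bsub>left_quotient L\<^esub> cls b = cls (a \<oplus> b)" by (simp add: Q)
  next
    fix a r assume ar: "a \<in> carrier R" "r \<in> carrier R"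
    have "r \<otimes> rep (cls a) \<ominus> r \<otimes> a = \<ominus> (r \<otimes> (a \<ominus> rep (cls a)))"
      using rep ar by (simp add: a_minus_def minus_add a_ac r_distr r_minus)
    then have "cls (r \<otimes> rep (cls a)) = cls (r \<otimes> a)"
      using rep ar closed by (subst eq) auto
    then show "r \<odot>\<^bsub>left_quotient L\<^esub> cls a = cls (r \<otimes> a)" by (simp add: Q)
  qed (simp_all add: Q)
qed

lemma left_module_left_quotient:
  assumes L: "left_ideal L"
  shows "left_module R (left_quotient L)"
proof -
  obtain cls where Q: "carrier (left_quotient L) = cls ` carrier R" "\<zero>\<^bsub>left_quotient L\<^esub> = cls \<zero>"
    "\<And>a b. \<lbrakk>a \<in> carrier R; b \<in> carrier R\<rbrakk> \<Longrightarrow> cls a = cls b \<longleftrightarrow> a \<ominus> b \<in> L"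
    "\<And>a b. \<lbrakk>a \<in> carrier R; b \<in> carrier R\<rbrakk> \<Longrightarrow> cls a \<oplus>\<^bsub>left_quotient L\<^esub> cls b = cls (a \<oplus> b)"
    "\<And>a r. \<lbrakk>a \<in> carrier R; r \<in> carrier R\<rbrakk> \<Longrightarrow> r \<odot>\<^bsub>left_quotient L\<^esub> cls a = cls (r \<otimes> a)"
    by (rule left_quotient[OF L], rule that)
  have "abelian_group (left_quotient L)"
  proof (rule abelian_groupI)
    fix x assume "x \<in> carrier (left_quotient L)"
    then obtain a where "a \<in> carrier R" "x = cls a" by (auto simp: Q)
    then show "\<exists>y \<in> carrier (left_quotient L). y \<oplus>\<^bsub>left_quotient L\<^esub> x = \<zero>\<^bsub>left_quotient L\<^esub>"
      by (intro bexI[of _ "cls (\<ominus> a)"]) (auto simp: Q(1,2,4) l_neg)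
  qed (auto simp: Q(1,2,4) a_ac)
  then show ?thesis
    by (intro left_module.intro) (auto simp: Q(1,2,4,5) l_distr r_distr m_assoc)
qed

text \<open>
  For an idempotent \<^term>\<open>e\<close> the left ideal of all \<^term>\<open>r \<ominus> r \<otimes> e\<close> is modular with right
  identity \<^term>\<open>e\<close>, so a left ideal containing it and maximal among those avoiding
  \<^term>\<open>e\<close> is a maximal left ideal, and its quotient is not annihilated by \<^term>\<open>e\<close>.
\<close>

lemma jacobson_radical_idempotent:
  assumes e: "e \<in> jacobson_radical R" "e \<otimes> e = e"
  shows "e = \<zero>"
proof (rule ccontr)
  assume "e \<noteq> \<zero>"
  have eR: "e \<in> carrier R" using e by (simp add: jacobson_radical_def)
  define L0 where "L0 = {r \<ominus> r \<otimes> e | r. r \<in> carrier R}"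
  define \<L> where "\<L> = {L. left_ideal L \<and> L0 \<subseteq> L \<and> e \<notin> L}"
  have "left_ideal L0"
    unfolding left_ideal_def
  proof (intro conjI ballI)
    show "subgroup L0 (add_monoid R)"
    proof (rule add.subgroupI)
      fix a assume "a \<in> L0"
      then obtain r where "r \<in> carrier R" "a = r \<ominus> r \<otimes> e" by (auto simp: L0_def)
      then have "\<ominus> r \<in> carrier R" "\<ominus> a = (\<ominus> r) \<ominus> (\<ominus> r) \<otimes> e"
        using eR by (simp_all add: a_minus_def minus_add l_minus)
      then show "\<ominus> a \<in> L0" unfolding L0_def by blast
    next
      fix a b assume "a \<in> L0" "b \<in> L0"
      then obtain r s where "r \<in> carrier R" "a = r \<ominus> r \<otimes> e" "s \<in> carrier R" "b = s \<ominus> s \<otimes> e"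
        by (auto simp: L0_def)
      then have "r \<oplus> s \<in> carrier R" "a \<oplus> b = (r \<oplus> s) \<ominus> (r \<oplus> s) \<otimes> e"
        using eR by (simp_all add: a_minus_def minus_add l_distr a_ac)
      then show "a \<oplus> b \<in> L0" unfolding L0_def by blast
    qed (use eR in \<open>auto simp: L0_def\<close>)
    fix r a assume r: "r \<in> carrier R" and "a \<in> L0"
    then obtain s where "s \<in> carrier R" "a = s \<ominus> s \<otimes> e" by (auto simp: L0_def)
    then have "r \<otimes> s \<in> carrier R" "r \<otimes> a = (r \<otimes> s) \<ominus> (r \<otimes> s) \<otimes> e"
      using eR r by (simp_all add: a_minus_def r_minus r_distr m_assoc)
    then show "r \<otimes> a \<in> L0" unfolding L0_def by blast
  qed
  moreover have "e \<notin> L0"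
  proof
    assume "e \<in> L0"
    then obtain r where r: "r \<in> carrier R" "e = r \<ominus> r \<otimes> e" by (auto simp: L0_def)
    \<comment> \<open>Right multiplication by e fixes e but kills every element of
      \<open>L0\<close>.\<close>
    have "e = (r \<ominus> r \<otimes> e) \<otimes> e" using e(2) r(2) by simp
    also have "\<dots> = \<zero>" using r(1) eR e(2) by (simp add: a_minus_def l_distr l_minus m_assoc r_neg)
    finally show False using \<open>e \<noteq> \<zero>\<close> by simp
  qed
  ultimately have "L0 \<in> \<L>" by (simp add: \<L>_def)
  have "\<exists>L \<in> \<L>. \<forall>N \<in> \<L>. L \<subseteq> N \<longrightarrow> N = L"
  proof (rule subset_Zorn_nonempty)
    show "\<L> \<noteq> {}" using \<open>L0 \<in> \<L>\<close> by blast
    fix C assume C: "C \<noteq> {}" "subset.chain \<L> C"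
    then have CL: "C \<subseteq> \<L>" by (simp add: subset.chain_def)
    have "left_ideal (\<Union>C)"
      unfolding left_ideal_def
    proof (intro conjI ballI)
      show "subgroup (\<Union>C) (add_monoid R)"
      proof (rule add.subgroupI)
        show "\<Union>C \<subseteq> carrier R" using CL left_ideal_subset by (auto simp: \<L>_def)
        show "\<Union>C \<noteq> {}" using C(1) CL left_ideal_closed(1) unfolding \<L>_def by blast
        show "\<ominus> a \<in> \<Union>C" if "a \<in> \<Union>C" for a
          using that CL left_ideal_closed(3) unfolding \<L>_def by blast
        show "a \<oplus> b \<in> \<Union>C" if ab: "a \<in> \<Union>C" "b \<in> \<Union>C" for a b
        proof -
          obtain A B where "A \<in> C" "B \<in> C" "a \<in> A" "b \<in> B" using ab by auto
          moreover then have "A \<subseteq> B \<or> B \<subseteq> A" using C(2) by (auto simp: subset.chain_def)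
          ultimately obtain N where "N \<in> C" "a \<in> N" "b \<in> N" by blast
          then show ?thesis using CL left_ideal_closed(2)[of N a b] unfolding \<L>_def by blast
        qed
      qed
      show "r \<otimes> a \<in> \<Union>C" if "r \<in> carrier R" "a \<in> \<Union>C" for r a
        using that CL left_ideal_closed(4) unfolding \<L>_def by blast
    qed
    then show "\<Union>C \<in> \<L>" using C(1) CL by (auto simp: \<L>_def)
  qed
  then obtain L where L: "left_ideal L" "L0 \<subseteq> L" "e \<notin> L" and max: "\<And>N. \<lbrakk>N \<in> \<L>; L \<subseteq> N\<rbrakk> \<Longrightarrow> N = L"
    by (auto simp: \<L>_def)
  obtain cls where Q: "carrier (left_quotient L) = cls ` carrier R" "\<zero>\<^bsub>left_quotient L\<^esub> = cls \<zero>"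
    and eq: "\<And>a b. \<lbrakk>a \<in> carrier R; b \<in> carrier R\<rbrakk> \<Longrightarrow> cls a = cls b \<longleftrightarrow> a \<ominus> b \<in> L"
    and Qadd: "\<And>a b. \<lbrakk>a \<in> carrier R; b \<in> carrier R\<rbrakk> \<Longrightarrow> cls a \<oplus>\<^bsub>left_quotient L\<^esub> cls b = cls (a \<oplus> b)"
    and Qsmult: "\<And>a r. \<lbrakk>a \<in> carrier R; r \<in> carrier R\<rbrakk> \<Longrightarrow> r \<odot>\<^bsub>left_quotient L\<^esub> cls a = cls (r \<otimes> a)"
    by (rule left_quotient[OF L(1)], rule that)
  have cls0: "cls a = cls \<zero> \<longleftrightarrow> a \<in> L" if "a \<in> carrier R" for a
    using eq[OF that, of \<zero>] that minus_equality[of \<zero> \<zero>] by (simp add: a_minus_def)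
  have ee: "e \<odot>\<^bsub>left_quotient L\<^esub> cls e \<noteq> \<zero>\<^bsub>left_quotient L\<^esub>"
    using eR e(2) L(3) cls0 by (simp add: Q Qsmult)
  have "simple_module R (left_quotient L)"
    unfolding simple_module_def
  proof (intro conjI allI impI)
    show "left_module R (left_quotient L)" using L(1) by (rule left_module_left_quotient)
    show "\<exists>a \<in> carrier R. \<exists>m \<in> carrier (left_quotient L). a \<odot>\<^bsub>left_quotient L\<^esub> m \<noteq> \<zero>\<^bsub>left_quotient L\<^esub>"
      using ee eR Q by blast
  next
    fix N assume N: "submodule_of N R (left_quotient L)"
    interpret Q: abelian_group "left_quotient L"
      using left_module_left_quotient[OF L(1)] by (rule left_module.abelian)
    have Nsub: "subgroup N (add_monoid (left_quotient L))"
      and Nsm: "\<And>r n. \<lbrakk>r \<in> carrier R; n \<in> N\<rbrakk> \<Longrightarrow> r \<odot>\<^bsub>left_quotient L\<^esub> n \<in> N"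
      using N by (auto simp: submodule_of_def)
    have N0: "cls \<zero> \<in> N" using subgroup.one_closed[OF Nsub] by (simp add: Q)
    have Nsubset: "N \<subseteq> cls ` carrier R" using subgroup.subset[OF Nsub] by (simp add: Q)
    \<comment> \<open>Submodules of the quotient correspond to left ideals above L, to which the
      maximality of L applies.\<close>
    define P where "P = {a \<in> carrier R. cls a \<in> N}"
    have NP: "N = cls ` P" using Nsubset by (auto simp: P_def)
    have P: "left_ideal P"
      unfolding left_ideal_def
    proof (intro conjI ballI)
      show "subgroup P (add_monoid R)"
      proof (rule add.subgroupI)
        show "P \<noteq> {}" using N0 by (auto simp: P_def)
        show "a \<oplus> b \<in> P" if "a \<in> P" "b \<in> P" for a b
          using that subgroup.m_closed[OF Nsub, of "cls a" "cls b"] by (auto simp: P_def Qadd)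
        show "\<ominus> a \<in> P" if a: "a \<in> P" for a
        proof -
          have "\<ominus>\<^bsub>left_quotient L\<^esub> cls a = cls (\<ominus> a)"
            using a by (intro Q.minus_equality) (auto simp: P_def Q Qadd l_neg)
          moreover have "\<ominus>\<^bsub>left_quotient L\<^esub> cls a \<in> N"
            using a subgroup.m_inv_closed[OF Nsub, of "cls a"] by (simp add: P_def a_inv_def)
          ultimately show ?thesis using a by (simp add: P_def)
        qed
      qed (auto simp: P_def)
      show "r \<otimes> a \<in> P" if "r \<in> carrier R" "a \<in> P" for r a
        using that Nsm[of r "cls a"] by (auto simp: P_def Qsmult)
    qed
    have LP: "L \<subseteq> P"
      using cls0 left_ideal_subset[OF L(1)] N0 by (metis (mono_tags, lifting) P_def mem_Collect_eq subset_iff)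
    show "N = {\<zero>\<^bsub>left_quotient L\<^esub>} \<or> N = carrier (left_quotient L)"
    proof (cases "e \<in> P")
      case False
      then have "P = L" using max[of P] P L(2) LP by (auto simp: \<L>_def)
      then have "N = {cls \<zero>}" using NP cls0 left_ideal_subset[OF L(1)] N0 by auto
      then show ?thesis by (simp add: Q)
    next
      case True
      have "r \<in> P" if r: "r \<in> carrier R" for r
      proof -
        have "r \<ominus> r \<otimes> e \<in> P" using r L(2) LP by (auto simp: L0_def)
        moreover have "r \<otimes> e \<in> P" using left_ideal_closed(4)[OF P r True] .
        moreover have "r = (r \<ominus> r \<otimes> e) \<oplus> r \<otimes> e" using r eR by (simp add: a_minus_def a_assoc l_neg)
        ultimately show ?thesis using left_ideal_closed(2)[OF P] by metis
      qed
      then have "P = carrier R" by (auto simp: P_def)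
      then show ?thesis by (simp add: NP Q)
    qed
  qed
  then show False
    using e(1) ee eR Q(1) by (auto simp: jacobson_radical_def)
qed

end

section \<open>Inverse semigroups\<close>

lemma star_inverse:
  fixes s :: "'s::inverse_semigroup"
  shows "s * star s * s = s" "star s * s * star s = star s"
  using theI'[OF ex1_star[of s]] by (simp_all add: star_def)

lemma star_unique:
  fixes s :: "'s::inverse_semigroup"
  assumes "s * t * s = s" "t * s * t = t"
  shows "star s = t"
  using ex1_star[of s] assms star_inverse[of s] by blast

lemma star_star [simp]: "star (star s) = (s::'s::inverse_semigroup)"
  by (rule star_unique) (simp_all add: star_inverse)

lemma star_idem: "idem (e::'s::inverse_semigroup) \<Longrightarrow> star e = e"
  by (rule star_unique) (simp_all add: idem_def)

lemma idem_star_mult: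
  fixes s :: "'s::inverse_semigroup"
  shows "idem (s * star s)" "idem (star s * s)"
  using star_inverse[of s] by (simp_all add: idem_def mult.assoc)

text \<open>Let x be the inverse of \<open>e * f\<close>. Then \<open>f * x * e\<close> is an
  inverse of \<open>e * f\<close> as well, so uniqueness gives \<open>x = f * x * e\<close>, and
  this form makes x idempotent. An idempotent is its own inverse, hence \<open>e * f\<close>, the
  inverse of x, equals x.\<close>

lemma idem_mult:
  fixes e f :: "'s::inverse_semigroup"
  assumes "idem e" "idem f"
  shows "idem (e * f)"
proof -
  have ee: "e * (e * z) = e * z" and ff: "f * (f * z) = f * z" for z
    using assms by (metis idem_def mult.assoc)+
  define x where "x = star (e * f)"
  have x: "e * (f * (x * (e * (f * z)))) = e * (f * z)" "e * (f * (x * (e * f))) = e * f"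
    "x * (e * (f * (x * z))) = x * z" for z
    using arg_cong[OF star_inverse(1)[of "e * f"], of "\<lambda>w. w * z"] star_inverse(1)[of "e * f"]
      arg_cong[OF star_inverse(2)[of "e * f"], of "\<lambda>w. w * z"]
    by (simp_all only: x_def mult.assoc)
  have "star (e * f) = f * x * e"
    using x by (intro star_unique) (simp_all add: mult.assoc ee ff)
  then have y: "f * (x * e) = x" by (simp add: x_def mult.assoc)
  then have "x * x = (f * (x * e)) * (f * (x * e))" by simp
  also have "\<dots> = f * (x * (e * (f * (x * e))))" by (simp only: mult.assoc)
  also have "\<dots> = x" by (subst x(3)) (rule y)
  finally have "idem x" by (simp add: idem_def)
  then have "star x = x" by (rule star_idem)
  then show ?thesis using \<open>idem x\<close> by (simp add: x_def)
qed

text \<open>Both products are idempotent by \<open>idem_mult\<close>, which makes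
  \<open>f * e\<close> an inverse of \<open>e * f\<close>; but the idempotent \<open>e * f\<close>
  is its own inverse.\<close>

lemma idem_commute:
  fixes e f :: "'s::inverse_semigroup"
  assumes "idem e" "idem f"
  shows "e * f = f * e"
proof -
  have ee: "e * (e * z) = e * z" and ff: "f * (f * z) = f * z" for z
    using assms by (metis idem_def mult.assoc)+
  have ef: "idem (e * f)" "idem (f * e)" using assms idem_mult by auto
  have "star (e * f) = f * e"
    using ef by (intro star_unique) (simp_all add: mult.assoc ee ff idem_def)
  then show ?thesis using star_idem[OF ef(1)] by simp
qed

text \<open>Since e commutes with the idempotent \<open>r * star r\<close>, it can pass from the
  left of r to the right at the price of a conjugation. Restricting after r becomes restricting
  before r, which is how germ conditions are pulled back along a composite.\<close>

lemma idem_mult_right: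
  fixes e r :: "'s::inverse_semigroup"
  assumes "idem e"
  shows "idem (star r * e * r)" "e * r = r * (star r * e * r)"
proof -
  have c: "r * star r * e = e * (r * star r)" using idem_commute idem_star_mult(1) assms by blast
  show 2: "e * r = r * (star r * e * r)" using c star_inverse[of r] by (metis mult.assoc)
  have "(star r * e * r) * (star r * e * r) = star r * e * (e * r)" using 2 by (metis mult.assoc)
  then show "idem (star r * e * r)" using assms by (metis idem_def mult.assoc)
qed

section \<open>The groupoid of germs\<close>

context inverse_semigroup_action
begin

abbreviation "G \<equiv> germ_groupoid X D \<theta>"

lemma D_subset: "D s \<subseteq> topspace X"
  using open_D openin_subset by blast

lemma topspace_inter_D [simp]: "topspace X \<inter> D s = D s"
  using D_subset by blast

lemma theta_image: "\<theta> s ` D (star s) = D s"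
  using homeomorphic_imp_surjective_map[OF homeo[of s]] by simp

lemma theta_inj: "inj_on (\<theta> s) (D (star s))"
  using homeomorphic_imp_injective_map[OF homeo[of s]] by simp

lemma theta_in: "x \<in> D (star s) \<Longrightarrow> \<theta> s x \<in> D s"
  using theta_image by blast

text \<open>Idempotence gives \<theta> e (\<theta> e x) = \<theta> e x, and injectivity of
  \<open>\<theta> e\<close> cancels one application.\<close>

lemma theta_idem: "idem e \<Longrightarrow> x \<in> D e \<Longrightarrow> \<theta> e x = x"
proof -
  assume e: "idem e" and x: "x \<in> D e"
  have "x \<in> D (star (e * e))" using e x star_idem[OF e] by (simp add: idem_def)
  then have "\<theta> e (\<theta> e x) = \<theta> e x" "\<theta> e x \<in> D (star e)"
    using act_mult[of x e e] dom_mult[of e e] e by (auto simp: idem_def)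
  then show "\<theta> e x = x" using theta_inj[of e] x star_idem[OF e] by (auto dest: inj_onD)
qed

lemma D_star_mult_idem:
  assumes "idem e"
  shows "D (star (s * e)) = D (star s) \<inter> D e"
  using dom_mult[of s e] theta_idem[OF assms] star_idem[OF assms] by auto

lemma theta_mult_idem:
  assumes "idem e" "x \<in> D (star (s * e))"
  shows "\<theta> (s * e) x = \<theta> s x"
  using act_mult[OF assms(2)] D_star_mult_idem[OF assms(1)] theta_idem[OF assms(1)] assms(2) by simp

lemma D_star_self: "D (star s * s) = D (star s)" "D (s * star s) = D s"
proof -
  have *: "D (star s * s) = D (star s)" for s
    using dom_mult[of "star s" s] theta_in[of _ s] star_idem[OF idem_star_mult(2)[of s]] by auto
  show "D (star s * s) = D (star s)" by (rule *)
  show "D (s * star s) = D s" using *[of "star s"] by simp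
qed

lemma theta_star: "x \<in> D (star s) \<Longrightarrow> \<theta> (star s) (\<theta> s x) = x"
  using act_mult[of x "star s" s] theta_idem[OF idem_star_mult(2)[of s], of x]
    D_star_self(1)[of s] star_idem[OF idem_star_mult(2)[of s]] by simp

text \<open>A common lower bound \<open>u = s * e = t * f\<close> is traded for the single
  idempotent \<open>e * f\<close>, which equalises s and t. Equalising idempotents are easier to
  combine than lower bounds: they commute, and the domain of a product is the intersection of the
  domains.\<close>

lemma germ_rel_iff:
  "((s, x), (t, y)) \<in> germ_rel D \<longleftrightarrow>
     x = y \<and> x \<in> D (star s) \<and> x \<in> D (star t) \<and> (\<exists>e. idem e \<and> x \<in> D e \<and> s * e = t * e)"
proof
  assume "((s, x), (t, y)) \<in> germ_rel D"
  then obtain e f where *: "x = y" "x \<in> D (star s)" "x \<in> D (star t)" "idem e" "idem f"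
    "s * e = t * f" "x \<in> D (star (s * e))"
    by (auto simp: germ_rel_def nat_le_def)
  have "x \<in> D e" "x \<in> D f"
    using * D_star_mult_idem[OF \<open>idem e\<close>, of s] D_star_mult_idem[OF \<open>idem f\<close>, of t] by auto
  then have "x \<in> D (e * f)"
    using D_star_mult_idem[OF \<open>idem f\<close>, of e] star_idem[OF idem_mult[OF \<open>idem e\<close> \<open>idem f\<close>]]
      star_idem[OF \<open>idem e\<close>] by auto
  moreover have "s * (e * f) = t * (e * f)"
    using * idem_commute[of e f] by (metis idem_def mult.assoc)
  ultimately show "x = y \<and> x \<in> D (star s) \<and> x \<in> D (star t) \<and>
      (\<exists>e. idem e \<and> x \<in> D e \<and> s * e = t * e)"
    using * idem_mult by blast
next
  assume *: "x = y \<and> x \<in> D (star s) \<and> x \<in> D (star t) \<and> (\<exists>e. idem e \<and> x \<in> D e \<and> s * e = t * e)"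
  then obtain e where "idem e" "x \<in> D e" "s * e = t * e" by blast
  moreover have "x \<in> D (star (s * e))" using * calculation D_star_mult_idem by blast
  ultimately show "((s, x), (t, y)) \<in> germ_rel D"
    using * unfolding germ_rel_def nat_le_def by blast
qed

lemma mem_germ_iff:
  "(t, y) \<in> germ D s x \<longleftrightarrow>
     y = x \<and> x \<in> D (star s) \<and> x \<in> D (star t) \<and> (\<exists>e. idem e \<and> x \<in> D e \<and> s * e = t * e)"
  using germ_rel_iff[of s x t y] by (auto simp: germ_def)

lemma D_idem_inter:
  assumes "idem e" "idem f"
  shows "D (e * f) = D e \<inter> D f"
  using D_star_mult_idem[OF assms(2), of e] star_idem[OF idem_mult[OF assms]] star_idem[OF assms(1)]
  by auto

text \<open>The content is transitivity of the germ relation: the equalising idempotents of two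
  consecutive pairs are multiplied, and since they commute the product equalises the outer
  pair.\<close>

lemma germ_eq_iff:
  assumes "x \<in> D (star s)" "y \<in> D (star t)"
  shows "germ D s x = germ D t y \<longleftrightarrow> x = y \<and> (\<exists>e. idem e \<and> x \<in> D e \<and> s * e = t * e)"
proof
  have "(s, x) \<in> germ D s x"
    using assms(1) D_star_self(1)[of s] idem_star_mult(2)[of s] by (auto simp: mem_germ_iff)
  then show "germ D s x = germ D t y \<Longrightarrow> x = y \<and> (\<exists>e. idem e \<and> x \<in> D e \<and> s * e = t * e)"
    by (metis mem_germ_iff)
next
  assume *: "x = y \<and> (\<exists>e. idem e \<and> x \<in> D e \<and> s * e = t * e)"
  then obtain e where e: "idem e" "x \<in> D e" "s * e = t * e" by blast
  have "(r, z) \<in> germ D t x"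
    if r: "(r, z) \<in> germ D s x" and e: "idem e" "x \<in> D e" "s * e = t * e" "x \<in> D (star t)"
    for r s t z e
  proof -
    obtain f where f: "idem f" "x \<in> D f" "s * f = r * f" using r by (auto simp: mem_germ_iff)
    have "t * (e * f) = s * e * f" using e(3) by (simp add: mult.assoc)
    also have "\<dots> = s * f * e" using idem_commute[OF e(1) f(1)] by (simp add: mult.assoc)
    also have "\<dots> = r * (e * f)" using idem_commute[OF e(1) f(1)] f(3) by (simp add: mult.assoc)
    finally have "t * (e * f) = r * (e * f)" .
    moreover have "idem (e * f)" "x \<in> D (e * f)"
      using e f idem_mult[OF e(1) f(1)] D_idem_inter[OF e(1) f(1)] by auto
    moreover have "z = x" "x \<in> D (star r)" using r by (auto simp: mem_germ_iff)
    ultimately show ?thesis using e(4) unfolding mem_germ_iff by blast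
  qed
  from this[of _ _ s e t] this[of _ _ t e s] show "germ D s x = germ D t y"
    using * e assms by auto
qed

lemma germ_eqI:
  assumes "x \<in> D (star s)" "x \<in> D (star t)" "idem e" "x \<in> D e" "s * e = t * e"
  shows "germ D s x = germ D t x"
  using assms germ_eq_iff by blast

lemma theta_cong:
  assumes "germ D s x = germ D t y" "x \<in> D (star s)" "y \<in> D (star t)"
  shows "\<theta> s x = \<theta> t y"
  using assms germ_eq_iff[OF assms(2,3)] theta_mult_idem D_star_mult_idem by (metis IntI)

lemma germ_self: "x \<in> D (star s) \<Longrightarrow> (s, x) \<in> germ D s x"
  using D_star_self(1)[of s] idem_star_mult(2)[of s] by (auto simp: mem_germ_iff)

lemma mem_germD:
  assumes "(t, y) \<in> germ D s x"
  shows "y = x" "x \<in> D (star s)" "x \<in> D (star t)" "germ D t x = germ D s x" "\<theta> t x = \<theta> s x"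
proof -
  show "y = x" "x \<in> D (star s)" "x \<in> D (star t)" using assms by (auto simp: mem_germ_iff)
  moreover show "germ D t x = germ D s x"
    using assms calculation by (subst germ_eq_iff) (auto simp: mem_germ_iff eq_commute)
  ultimately show "\<theta> t x = \<theta> s x" using theta_cong by blast
qed

lemma topspace_Arr: "topspace (Arr G) = {germ D s x | s x. x \<in> D (star s)}"
proof -
  have "topspace (Arr G) = \<Union>{germ D s ` U | s U. openin X U \<and> U \<subseteq> D (star s)}"
    by (simp add: germ_groupoid_def)
  also have "\<dots> = {germ D s x | s x. x \<in> D (star s)}"
    using open_D by blast
  finally show ?thesis .
qed

lemma Arr_cases:
  assumes "\<gamma> \<in> topspace (Arr G)"
  obtains s x where "\<gamma> = germ D s x" "x \<in> D (star s)"
  using assms topspace_Arr by auto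

lemma germ_in_Arr [simp]: "x \<in> D (star s) \<Longrightarrow> germ D s x \<in> topspace (Arr G)"
  using topspace_Arr by auto

lemma Obj_G [simp]: "Obj G = X"
  by (simp add: germ_groupoid_def)

lemma src_germ [simp]: "x \<in> D (star s) \<Longrightarrow> src G (germ D s x) = x"
proof -
  assume "x \<in> D (star s)"
  then have "{y | t y. (t, y) \<in> germ D s x} = {x}" using germ_self mem_germD(1) by blast
  then show ?thesis by (simp add: germ_groupoid_def)
qed

lemma trg_germ [simp]: "x \<in> D (star s) \<Longrightarrow> trg G (germ D s x) = \<theta> s x"
proof -
  assume "x \<in> D (star s)"
  then have "{\<theta> t y | t y. (t, y) \<in> germ D s x} = {\<theta> s x}"
    using germ_self mem_germD(1,5) by blast
  then show ?thesis by (simp add: germ_groupoid_def)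
qed

lemma D_mult: "x \<in> D (star t) \<Longrightarrow> \<theta> t x \<in> D (star s) \<Longrightarrow> x \<in> D (star (s * t))"
  by (simp add: dom_mult)

lemma theta_mult: "x \<in> D (star t) \<Longrightarrow> \<theta> t x \<in> D (star s) \<Longrightarrow> \<theta> (s * t) x = \<theta> s (\<theta> t x)"
  using act_mult D_mult by blast

text \<open>This independence of representatives is what makes the set under \<open>the_elem\<close>
  in \<open>gmult\<close> a singleton.\<close>

lemma germ_mult_cong:
  assumes "x \<in> D (star t)" "\<theta> t x \<in> D (star s)"
    and "germ D s (\<theta> t x) = germ D s' (\<theta> t x)" "\<theta> t x \<in> D (star s')"
    and "germ D t x = germ D t' x" "x \<in> D (star t')"
  shows "germ D (s * t) x = germ D (s' * t') x"
proof -
  obtain e where e: "idem e" "\<theta> t x \<in> D e" "s * e = s' * e"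
    using assms germ_eq_iff by metis
  obtain f where f: "idem f" "x \<in> D f" "t * f = t' * f"
    using assms germ_eq_iff by metis
  \<comment> \<open>The idempotent e equalises s and s' at the point \<theta> t x, so it is pulled
    back along t by conjugation; f equalises t and t' at x. Their product does both at x.\<close>
  define d where "d = star t * e * t * f"
  have th: "\<theta> t' x = \<theta> t x" using theta_cong[OF assms(5,1,6)] by simp
  have d': "idem (star t * e * t)" using idem_mult_right(1)[OF e(1)] .
  have "x \<in> D (star (e * t))" using assms(1) e(2) star_idem[OF e(1)] by (simp add: D_mult)
  then have "x \<in> D (star t * e * t)"
    using D_star_mult_idem[OF d', of t] idem_mult_right(2)[OF e(1), of t] by simp
  then have "x \<in> D d" "idem d"
    using d' f by (simp_all add: d_def D_idem_inter idem_mult)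
  moreover have "s * t * d = s' * t' * d"
  proof -
    have *: "r * t * d = (r * e) * t * f" for r
    proof -
      have "r * t * d = r * (t * (star t * e * t)) * f" by (simp add: d_def mult.assoc)
      also have "\<dots> = r * (e * t) * f" using idem_mult_right(2)[OF e(1), of t] by simp
      finally show ?thesis by (simp add: mult.assoc)
    qed
    have "s * t * d = s' * t * d" using *[of s] *[of s'] e(3) by simp
    also have "\<dots> = s' * t * f * (star t * e * t)"
      using idem_commute[OF d' f(1)] by (simp add: d_def mult.assoc)
    also have "\<dots> = s' * t' * f * (star t * e * t)" using f(3) by (metis mult.assoc)
    also have "\<dots> = s' * t' * d"
      using idem_commute[OF d' f(1)] by (simp add: d_def mult.assoc)
    finally show ?thesis .
  qed
  ultimately show ?thesis
    using assms th by (subst germ_eq_iff) (auto intro: D_mult)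
qed

lemma gmult_germ [simp]:
  assumes "x \<in> D (star t)" "\<theta> t x \<in> D (star s)"
  shows "gmult G (germ D s (\<theta> t x)) (germ D t x) = germ D (s * t) x"
proof -
  have "{germ D (s' * t') y | s' t' y. (s', \<theta> t' y) \<in> germ D s (\<theta> t x) \<and> (t', y) \<in> germ D t x}
    = {germ D (s * t) x}" (is "?L = _")
  proof (intro equalityI subsetI)
    fix z assume "z \<in> ?L"
    then obtain s' t' y where z: "z = germ D (s' * t') y" "(s', \<theta> t' y) \<in> germ D s (\<theta> t x)"
      "(t', y) \<in> germ D t x" by blast
    note t' = mem_germD[OF z(3)] and s' = mem_germD[OF z(2)]
    have "germ D (s * t) x = germ D (s' * t') x"
      using assms t' s' by (intro germ_mult_cong) simp_all
    then show "z \<in> {germ D (s * t) x}" using z t' by simp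
  qed (use assms germ_self in blast)
  then show ?thesis by (simp add: germ_groupoid_def)
qed

text \<open>Two idempotents whose domains contain x are equalised by their product, so they have the
  same germ there.\<close>

lemma ident_eq:
  assumes "idem e" "x \<in> D e"
  shows "ident G x = germ D e x"
proof -
  have "germ D f x = germ D e x" if f: "idem f" "x \<in> D f" for f
  proof (rule germ_eqI)
    show "idem (e * f)" "x \<in> D (e * f)" "x \<in> D (star f)" "x \<in> D (star e)"
      using assms f idem_mult D_idem_inter star_idem[OF assms(1)] star_idem[OF f(1)] by auto
    have "f * (e * f) = e * (f * f)" using idem_commute[OF f(1) assms(1)] by (metis mult.assoc)
    moreover have "e * (e * f) = e * f" using assms(1) by (metis idem_def mult.assoc)
    ultimately show "f * (e * f) = e * (e * f)" using f(1) by (simp add: idem_def)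
  qed
  then have "{germ D f x | f. idem f \<and> x \<in> D f} = {germ D e x}" using assms by blast
  then show ?thesis by (simp add: germ_groupoid_def)
qed

lemma exists_idem:
  assumes "x \<in> topspace X"
  obtains e where "idem e" "x \<in> D e"
proof -
  obtain s where "x \<in> D s" using assms Union_D by auto
  then show ?thesis using that[of "s * star s"] D_star_self(2)[of s] idem_star_mult(1) by auto
qed

lemma ident [simp]:
  assumes "x \<in> topspace X"
  shows "ident G x \<in> topspace (Arr G)" "src G (ident G x) = x" "trg G (ident G x) = x"
proof -
  obtain e where "idem e" "x \<in> D e" using exists_idem assms by metis
  then show "ident G x \<in> topspace (Arr G)" "src G (ident G x) = x" "trg G (ident G x) = x"
    using ident_eq[of e x] theta_idem[of e x] star_idem[of e]
      src_germ[of x e] trg_germ[of x e] germ_in_Arr[of x e] by auto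
qed

lemma src_trg_in [simp]:
  assumes "\<gamma> \<in> topspace (Arr G)"
  shows "src G \<gamma> \<in> topspace X" "trg G \<gamma> \<in> topspace X"
proof -
  obtain s x where "\<gamma> = germ D s x" "x \<in> D (star s)" using assms by (rule Arr_cases)
  then show "src G \<gamma> \<in> topspace X" "trg G \<gamma> \<in> topspace X"
    using D_subset[of s] D_subset[of "star s"] theta_in[of x s] by auto
qed

section \<open>Composition, identities and cancellation of arrows\<close>

lemma composable_cases:
  assumes "(\<beta>, \<rho>) \<in> composable G"
  obtains s t x where "x \<in> D (star t)" "\<theta> t x \<in> D (star s)" "\<beta> = germ D s (\<theta> t x)" "\<rho> = germ D t x"
proof -
  obtain s y where b: "\<beta> = germ D s y" "y \<in> D (star s)"
    using assms Arr_cases by (auto simp: composable_def)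
  obtain t x where r: "\<rho> = germ D t x" "x \<in> D (star t)"
    using assms Arr_cases by (auto simp: composable_def)
  have "y = \<theta> t x" using assms b r by (simp add: composable_def)
  then show ?thesis using that b r by simp
qed

lemma composable_germ:
  "x \<in> D (star t) \<Longrightarrow> \<theta> t x \<in> D (star s) \<Longrightarrow> (germ D s (\<theta> t x), germ D t x) \<in> composable G"
  by (simp add: composable_def)

lemma gmult_closed:
  assumes "(\<beta>, \<rho>) \<in> composable G"
  shows "gmult G \<beta> \<rho> \<in> topspace (Arr G)" "src G (gmult G \<beta> \<rho>) = src G \<rho>"
    "trg G (gmult G \<beta> \<rho>) = trg G \<beta>"
  using assms by (auto elim!: composable_cases simp: D_mult act_mult)

text \<open>Moved to the right of t by \<open>idem_mult_right\<close>, the factor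
  \<open>star s * s\<close> becomes an idempotent that only shrinks the domain around x. Undoing s
  in this way yields left cancellation.\<close>

lemma germ_star_mult:
  assumes "x \<in> D (star t)" "\<theta> t x \<in> D (star s)"
  shows "germ D (star s * (s * t)) x = germ D t x" 
proof -
  have "star s * (s * t) = t * (star t * (star s * s) * t)"
    using idem_mult_right(2)[OF idem_star_mult(2)[of s], of t] by (simp add: mult.assoc)
  moreover define e where "e = star t * (star s * s) * t"
  ultimately have e: "idem e" "star s * (s * t) = t * e"
    using idem_mult_right(1)[OF idem_star_mult(2)[of s], of t] by auto
  have "x \<in> D (star (star s * (s * t)))"
    using assms theta_in by (auto intro!: D_mult simp: theta_mult)
  moreover from this have "x \<in> D e" using e D_star_mult_idem by simp
  ultimately show ?thesis
    using assms e by (subst germ_eq_iff) (auto intro!: exI[of _ e] simp: idem_def mult.assoc)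
qed

text \<open>The counterpart for right cancellation: \<open>t * star t\<close> is an idempotent whose
  domain contains \<theta> t x.\<close>

lemma germ_mult_star:
  assumes "x \<in> D (star t)" "\<theta> t x \<in> D (star s)"
  shows "germ D (s * t * star t) (\<theta> t x) = germ D s (\<theta> t x)"
proof -
  have "\<theta> t x \<in> D (t * star t)" using assms theta_in D_star_self(2) by auto
  then show ?thesis
    using assms idem_star_mult(1)[of t] D_star_mult_idem[OF idem_star_mult(1)[of t], of s]
    by (subst germ_eq_iff)
      (auto intro!: exI[of _ "t * star t"] simp: idem_def mult.assoc)
qed

text \<open>Convolution at an arrow runs over the factorisations of that arrow. Together with
  \<open>gmult_right_cancel\<close> this says that either factor determines the other, which keeps
  these sums under control.\<close>

lemma gmult_left_cancel:
  assumes "(\<beta>, \<rho>) \<in> composable G" "(\<beta>, \<rho>') \<in> composable G" "gmult G \<beta> \<rho> = gmult G \<beta> \<rho>'"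
  shows "\<rho> = \<rho>'"
proof -
  obtain s t x where 1: "x \<in> D (star t)" "\<theta> t x \<in> D (star s)" "\<beta> = germ D s (\<theta> t x)" "\<rho> = germ D t x"
    using assms(1) by (rule composable_cases)
  obtain t' x' where 2: "x' \<in> D (star t')" "\<rho>' = germ D t' x'"
    using assms(2) by (auto simp: composable_def elim: Arr_cases)
  have "src G \<rho> = src G \<rho>'" using gmult_closed(2) assms by metis
  then have "x' = x" using 1 2 by simp
  have "\<theta> t' x = \<theta> t x" using assms(2) 1 2 \<open>x' = x\<close> by (simp add: composable_def)
  have "germ D (s * t) x = germ D (s * t') x"
    using assms(3) 1 2 \<open>x' = x\<close> \<open>\<theta> t' x = \<theta> t x\<close> gmult_germ[of x t s] gmult_germ[of x t' s] by simp
  then have "germ D (star s * (s * t)) x = germ D (star s * (s * t')) x"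
    using 1 2 \<open>x' = x\<close> \<open>\<theta> t' x = \<theta> t x\<close> theta_in[OF 1(2)]
    by (intro germ_mult_cong[of x "s * t" "star s" "star s" "s * t'"]) (simp_all add: D_mult theta_mult)
  then show ?thesis
    using germ_star_mult[of x t s] germ_star_mult[of x t' s] 1 2 \<open>x' = x\<close> \<open>\<theta> t' x = \<theta> t x\<close> by simp
qed

lemma gmult_right_cancel:
  assumes "(\<beta>, \<rho>) \<in> composable G" "(\<beta>', \<rho>) \<in> composable G" "gmult G \<beta> \<rho> = gmult G \<beta>' \<rho>"
  shows "\<beta> = \<beta>'"
proof -
  obtain s t x where 1: "x \<in> D (star t)" "\<theta> t x \<in> D (star s)" "\<beta> = germ D s (\<theta> t x)" "\<rho> = germ D t x"
    using assms(1) by (rule composable_cases)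
  obtain s' y where 2: "y \<in> D (star s')" "\<beta>' = germ D s' y"
    using assms(2) by (auto simp: composable_def elim: Arr_cases)
  have y: "y = \<theta> t x" using assms(2) 1 2 by (simp add: composable_def)
  have "germ D (s * t) x = germ D (s' * t) x"
    using assms(3) 1 2 y gmult_germ[of x t s] gmult_germ[of x t s'] by simp
  then have "germ D (s * t * star t) (\<theta> t x) = germ D (s' * t * star t) (\<theta> t x)"
    using 1 2 y theta_star[OF 1(1)] theta_in[OF 1(1)]
    by (intro germ_mult_cong[of _ "star t" "s * t" "s' * t" "star t"]) (simp_all add: D_mult)
  then show ?thesis
    using germ_mult_star[of x t s] germ_mult_star[of x t s'] 1 2 y by simp
qed

lemma gmult_ident:
  assumes "\<gamma> \<in> topspace (Arr G)"
  shows "(ident G (trg G \<gamma>), \<gamma>) \<in> composable G" "gmult G (ident G (trg G \<gamma>)) \<gamma> = \<gamma>"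
    "(\<gamma>, ident G (src G \<gamma>)) \<in> composable G" "gmult G \<gamma> (ident G (src G \<gamma>)) = \<gamma>"
proof -
  obtain s x where g: "\<gamma> = germ D s x" "x \<in> D (star s)" using assms by (rule Arr_cases)
  have 1: "ident G (\<theta> s x) = germ D (s * star s) (\<theta> s x)" "\<theta> s x \<in> D (s * star s)"
    using ident_eq[OF idem_star_mult(1)[of s]] theta_in[OF g(2)] D_star_self(2) by auto
  have 2: "ident G x = germ D (star s * s) x" "x \<in> D (star s * s)"
    using ident_eq[OF idem_star_mult(2)[of s]] g(2) D_star_self(1) by auto
  have 3: "\<theta> (star s * s) x = x" using theta_idem[OF idem_star_mult(2) 2(2)] .
  have 4: "star (s * star s) = s * star s" "star (star s * s) = star s * s"
    using star_idem idem_star_mult by auto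
  show "(ident G (trg G \<gamma>), \<gamma>) \<in> composable G" "(\<gamma>, ident G (src G \<gamma>)) \<in> composable G"
    using assms by (auto simp: composable_def)
  show "gmult G (ident G (trg G \<gamma>)) \<gamma> = \<gamma>"
    using gmult_germ[of x s "s * star s"] 1 4 g by (simp add: star_inverse)
  show "gmult G \<gamma> (ident G (src G \<gamma>)) = \<gamma>"
    using gmult_germ[of x "star s * s" s] 2 3 4 g star_inverse(1)[of s] by (simp add: mult.assoc)
qed

text \<open>The preimage of a basic open set of germs of t consists of the points admitting an
  idempotent that equalises s and t, and such an idempotent e works on the whole open set
  \<open>D e\<close>.\<close>

lemma germ_continuous: "continuous_map (subtopology X (D (star s))) (Arr G) (germ D s)"
proof -
  have *: "openin (subtopology X (D (star s))) (germ D s -` (germ D t ` U) \<inter> D (star s))"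
    if U: "openin X U" "U \<subseteq> D (star t)" for t U
  proof -
    have "germ D s -` (germ D t ` U) \<inter> D (star s)
       = (D (star s) \<inter> U) \<inter> \<Union>{D e | e. idem e \<and> s * e = t * e}"
    proof (intro equalityI subsetI)
      fix x assume "x \<in> germ D s -` (germ D t ` U) \<inter> D (star s)"
      then obtain y where "y \<in> U" "germ D s x = germ D t y" "x \<in> D (star s)" by auto
      then show "x \<in> (D (star s) \<inter> U) \<inter> \<Union>{D e | e. idem e \<and> s * e = t * e}"
        using U(2) germ_eq_iff[of x s y t] by blast
    next
      fix x assume "x \<in> (D (star s) \<inter> U) \<inter> \<Union>{D e | e. idem e \<and> s * e = t * e}"
      then have "germ D s x = germ D t x" "x \<in> U" "x \<in> D (star s)"
        using U(2) germ_eqI[of x s t] by blast+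
      then show "x \<in> germ D s -` (germ D t ` U) \<inter> D (star s)" by blast
    qed
    moreover have "openin X (\<dots>)" using open_D U(1) by (auto intro!: openin_Int openin_Union)
    ultimately show ?thesis
      using open_D by (simp add: openin_open_subtopology le_infI1)
  qed
  have "topspace (subtopology X (D (star s))) = D (star s)"
    using D_subset by (simp add: topspace_subtopology_subset)
  moreover have "germ D s x \<in> \<Union>{germ D t ` U | t U. openin X U \<and> U \<subseteq> D (star t)}"
    if "x \<in> D (star s)" for x using that open_D by blast
  ultimately show ?thesis
    unfolding germ_groupoid_def top_groupoid.simps
    by (intro continuous_on_generated_topo) (use * in auto)
qed

lemma openin_germ_image: "openin X U \<Longrightarrow> U \<subseteq> D (star s) \<Longrightarrow> openin (Arr G) (germ D s ` U)"
  unfolding germ_groupoid_def by (auto intro!: topology_generated_by_Basis)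

lemma src_continuous: "continuous_map (Arr G) X (src G)"
  unfolding continuous_map_def
proof (intro conjI allI impI)
  fix V assume V: "openin X V"
  have "{\<gamma> \<in> topspace (Arr G). src G \<gamma> \<in> V} = \<Union>{germ D s ` (V \<inter> D (star s)) | s. True}"
    by (fastforce simp: topspace_Arr)
  then show "openin (Arr G) {\<gamma> \<in> topspace (Arr G). src G \<gamma> \<in> V}"
    using V open_D by (auto intro!: openin_Union openin_germ_image)
qed auto

end

section \<open>Sections of a sheaf of fields\<close>

lemma continuous_map_locally:
  assumes "\<And>x. x \<in> S \<Longrightarrow> \<exists>W. openin X W \<and> x \<in> W \<and> continuous_map (subtopology X W) Y f"
  shows "continuous_map (subtopology X S) Y f"
proof (rule pasting_lemma)
  let ?I = "{W. openin X W \<and> continuous_map (subtopology X W) Y f}"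
  show "openin (subtopology X S) (W \<inter> S)" if "W \<in> ?I" for W
    using that by (auto simp: openin_subtopology)
  show "continuous_map (subtopology (subtopology X S) (W \<inter> S)) Y f" if "W \<in> ?I" for W
    using that continuous_map_from_subtopology_mono[of X W Y f "S \<inter> (W \<inter> S)"]
    by (auto simp: subtopology_subtopology)
  show "\<exists>W. W \<in> ?I \<and> x \<in> W \<inter> S \<and> f x = f x" if "x \<in> topspace (subtopology X S)" for x
    using that assms by auto
qed simp

locale germ_sheaf_of_fields =
  inverse_semigroup_action X D \<theta> + sheaf_of_fields "germ_groupoid X D \<theta>" \<O>
  for X :: "'x topology"
    and D :: "'s::inverse_semigroup \<Rightarrow> 'x set"
    and \<theta> :: "'s \<Rightarrow> 'x \<Rightarrow> 'x"
    and \<O> :: "(('s \<times> 'x) set, 'x, 'e) ring_sheaf" +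
  assumes Hausdorff: "Hausdorff_space X"
    and zero_dim: "zero_dimensional_space X"
begin

abbreviation "E \<equiv> Tot \<O>"
abbreviation "F \<equiv> stalk \<O>"

section \<open>Compact open subsets of the unit space\<close>

definition kopen :: "'x set \<Rightarrow> bool" where
  "kopen K \<longleftrightarrow> openin X K \<and> compactin X K"

lemma kopen_subset: "kopen K \<Longrightarrow> K \<subseteq> topspace X"
  using openin_subset by (auto simp: kopen_def)

lemma kopen_closedin: "kopen K \<Longrightarrow> closedin X K"
  using compactin_imp_closedin Hausdorff by (auto simp: kopen_def)

lemma kopen_empty: "kopen {}"
  by (simp add: kopen_def)

lemma kopen_Int: "kopen K \<Longrightarrow> kopen L \<Longrightarrow> kopen (K \<inter> L)"
  using kopen_closedin compact_Int_closedin by (auto simp: kopen_def)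

lemma kopen_Diff: "kopen K \<Longrightarrow> kopen L \<Longrightarrow> kopen (K - L)"
proof -
  assume K: "kopen K" and L: "kopen L"
  have "K - L = K \<inter> (topspace X - L)" using kopen_subset[OF K] by auto
  moreover have "closedin X (topspace X - L)" using L by (auto simp: kopen_def)
  moreover have "openin X (topspace X - L)" using kopen_closedin[OF L] by auto
  ultimately show "kopen (K - L)" using K by (auto simp: kopen_def compact_Int_closedin)
qed

lemma kopen_basis:
  assumes "openin X U" "x \<in> U"
  obtains K where "kopen K" "x \<in> K" "K \<subseteq> U"
  using assms zero_dim unfolding zero_dimensional_space_def kopen_def by metis

lemma theta_continuous: "continuous_map (subtopology X (D (star s))) X (\<theta> s)"
  using homeomorphic_imp_continuous_map[OF homeo[of s]] continuous_map_into_fulltopology by blast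

lemma kopen_theta:
  assumes "kopen K" "K \<subseteq> D (star s)"
  shows "kopen (\<theta> s ` K)"
proof -
  have "openin (subtopology X (D s)) (\<theta> s ` K)"
    using homeomorphic_imp_open_map[OF homeo[of s]] assms open_D
    by (auto simp: open_map_def kopen_def openin_open_subtopology)
  moreover have "compactin X (\<theta> s ` K)"
    using assms compact_imp_compactin_subtopology
    by (intro image_compactin[OF _ theta_continuous]) (auto simp: kopen_def)
  ultimately show ?thesis using open_D by (auto simp: kopen_def openin_open_subtopology)
qed

text \<open>Written as an image under the inverse partial homeomorphism
  \<open>\<theta> (star t)\<close>, the preimage inherits compactness.\<close>

lemma kopen_theta_vimage:
  assumes "kopen K" "kopen L" "L \<subseteq> D (star t)"
  shows "kopen {x \<in> L. \<theta> t x \<in> K}"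
proof -
  have LD: "\<theta> t ` L \<subseteq> D t" using assms(3) theta_in by auto
  have "{x \<in> L. \<theta> t x \<in> K} = \<theta> (star t) ` (\<theta> t ` L \<inter> K)"
    using assms(3) theta_star[of _ t] by (force simp: subset_iff)
  moreover have "kopen (\<theta> t ` L \<inter> K)" using assms kopen_theta kopen_Int by blast
  ultimately show ?thesis using LD kopen_theta[of _ "star t"] by (simp add: le_infI1)
qed

section \<open>Local sections of the sheaf and their algebra\<close>

lemma field_F: "x \<in> topspace X \<Longrightarrow> field (F x)"
  using stalk_field by simp

lemma ring_F: "x \<in> topspace X \<Longrightarrow> ring (F x)"
  using stalk_ring by simp

lemma carrier_F: "x \<in> topspace X \<Longrightarrow> carrier (F x) = {e \<in> topspace E. proj \<O> e = x}"
  using stalk_carrier by simp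

lemma proj_nbhd:
  assumes "e \<in> topspace E"
  obtains U where "openin E U" "e \<in> U" "openin X (proj \<O> ` U)"
    "homeomorphic_map (subtopology E U) (subtopology X (proj \<O> ` U)) (proj \<O>)"
  using proj_local_homeo assms by (auto simp: local_homeomorphism_def)

text \<open>
  The second and third conditions say that \<^term>\<open>\<phi>\<close> is a lift of \<^term>\<open>r\<close> along the
  projection; the cases of interest are the inclusion and the maps \<^term>\<open>\<theta> s\<close>.
\<close>

definition cont_sec :: "('x \<Rightarrow> 'x) \<Rightarrow> 'x set \<Rightarrow> ('x \<Rightarrow> 'e) \<Rightarrow> bool" where
  "cont_sec r V \<phi> \<longleftrightarrow> V \<subseteq> topspace X \<and> r ` V \<subseteq> topspace X \<and>
     (\<forall>x \<in> V. \<phi> x \<in> carrier (F (r x))) \<and> continuous_map (subtopology X V) E \<phi>"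

lemma cont_secD:
  assumes "cont_sec r V \<phi>"
  shows "V \<subseteq> topspace X" "x \<in> V \<Longrightarrow> x \<in> topspace X" "x \<in> V \<Longrightarrow> r x \<in> topspace X"
    "x \<in> V \<Longrightarrow> \<phi> x \<in> carrier (F (r x))" "continuous_map (subtopology X V) E \<phi>"
    "x \<in> V \<Longrightarrow> \<phi> x \<in> topspace E" "x \<in> V \<Longrightarrow> proj \<O> (\<phi> x) = r x"
proof -
  show *: "V \<subseteq> topspace X" "continuous_map (subtopology X V) E \<phi>"
    "x \<in> V \<Longrightarrow> x \<in> topspace X" "x \<in> V \<Longrightarrow> r x \<in> topspace X" "x \<in> V \<Longrightarrow> \<phi> x \<in> carrier (F (r x))"
    using assms by (auto simp: cont_sec_def)
  show "x \<in> V \<Longrightarrow> \<phi> x \<in> topspace E" "x \<in> V \<Longrightarrow> proj \<O> (\<phi> x) = r x"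
    using *(4,5) carrier_F[of "r x"] by auto
qed

lemma cont_sec_mono: "cont_sec r V \<phi> \<Longrightarrow> W \<subseteq> V \<Longrightarrow> cont_sec r W \<phi>"
  unfolding cont_sec_def by (meson continuous_map_from_subtopology_mono image_mono order_trans subsetD)

lemma cont_sec_cong:
  assumes "cont_sec r V \<phi>" "\<And>x. x \<in> V \<Longrightarrow> \<phi> x = \<psi> x" "\<And>x. x \<in> V \<Longrightarrow> r x = r' x"
  shows "cont_sec r' V \<psi>"
proof -
  have "continuous_map (subtopology X V) E \<psi>"
    using cont_secD(5)[OF assms(1)] assms(2) by (rule continuous_map_eq) simp
  moreover have "r' x \<in> topspace X \<and> \<psi> x \<in> carrier (F (r' x))" if "x \<in> V" for x
    using cont_secD(3,4)[OF assms(1) that] assms(2,3)[OF that] by simp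
  ultimately show ?thesis using cont_secD(1)[OF assms(1)] by (auto simp: cont_sec_def)
qed

lemma cont_sec_locally:
  assumes "V \<subseteq> topspace X" "\<And>x. x \<in> V \<Longrightarrow> \<exists>W. openin X W \<and> x \<in> W \<and> cont_sec r W \<phi>"
  shows "cont_sec r V \<phi>"
proof -
  have "continuous_map (subtopology X V) E \<phi>"
    using assms(2) by (intro continuous_map_locally) (meson cont_secD(5))
  moreover have "r x \<in> topspace X \<and> \<phi> x \<in> carrier (F (r x))" if "x \<in> V" for x
    using assms(2)[OF that] by (auto dest: cont_secD)
  ultimately show ?thesis using assms(1) by (auto simp: cont_sec_def)
qed

lemma cont_sec_add:
  assumes "cont_sec r V \<phi>" "cont_sec r V \<psi>"
  shows "cont_sec r V (\<lambda>x. \<phi> x \<oplus>\<^bsub>F (r x)\<^esub> \<psi> x)"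
proof -
  let ?T = "subtopology (prod_topology E E) {(a, b). proj \<O> a = proj \<O> b}"
  have "continuous_map (subtopology X V) ?T (\<lambda>x. (\<phi> x, \<psi> x))"
    using cont_secD[OF assms(1)] cont_secD[OF assms(2)]
    by (auto intro!: continuous_map_into_subtopology continuous_map_pairedI)
  from continuous_map_compose[OF this add_continuous]
  have "continuous_map (subtopology X V) E (\<lambda>x. \<phi> x \<oplus>\<^bsub>F (r x)\<^esub> \<psi> x)"
    by (rule continuous_map_eq) (use cont_secD[OF assms(1)] in auto)
  moreover have "\<phi> x \<oplus>\<^bsub>F (r x)\<^esub> \<psi> x \<in> carrier (F (r x))" if "x \<in> V" for x
  proof -
    interpret ring "F (r x)" using ring_F cont_secD(3)[OF assms(1) that] .
    show ?thesis using cont_secD(4)[OF assms(1) that] cont_secD(4)[OF assms(2) that] by simp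
  qed
  ultimately show ?thesis using assms(1) by (simp add: cont_sec_def)
qed

lemma cont_sec_mult:
  assumes "cont_sec r V \<phi>" "cont_sec r V \<psi>"
  shows "cont_sec r V (\<lambda>x. \<phi> x \<otimes>\<^bsub>F (r x)\<^esub> \<psi> x)"
proof -
  let ?T = "subtopology (prod_topology E E) {(a, b). proj \<O> a = proj \<O> b}"
  have "continuous_map (subtopology X V) ?T (\<lambda>x. (\<phi> x, \<psi> x))"
    using cont_secD[OF assms(1)] cont_secD[OF assms(2)]
    by (auto intro!: continuous_map_into_subtopology continuous_map_pairedI)
  from continuous_map_compose[OF this mult_continuous]
  have "continuous_map (subtopology X V) E (\<lambda>x. \<phi> x \<otimes>\<^bsub>F (r x)\<^esub> \<psi> x)"
    by (rule continuous_map_eq) (use cont_secD[OF assms(1)] in auto)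
  moreover have "\<phi> x \<otimes>\<^bsub>F (r x)\<^esub> \<psi> x \<in> carrier (F (r x))" if "x \<in> V" for x
  proof -
    interpret ring "F (r x)" using ring_F cont_secD(3)[OF assms(1) that] .
    show ?thesis using cont_secD(4)[OF assms(1) that] cont_secD(4)[OF assms(2) that] by simp
  qed
  ultimately show ?thesis using assms(1) by (simp add: cont_sec_def)
qed

lemma cont_sec_compose:
  assumes "cont_sec r V \<phi>" "continuous_map (subtopology X W) X h" "h ` W \<subseteq> V" "W \<subseteq> topspace X"
  shows "cont_sec (\<lambda>x. r (h x)) W (\<lambda>x. \<phi> (h x))"
proof -
  have "continuous_map (subtopology X W) (subtopology X V) h"
    using assms by (intro continuous_map_into_subtopology) auto
  from continuous_map_compose[OF this cont_secD(5)[OF assms(1)]]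
  have "continuous_map (subtopology X W) E (\<lambda>x. \<phi> (h x))" by (simp add: o_def)
  then show ?thesis using assms cont_secD[OF assms(1)] by (auto simp: cont_sec_def)
qed

lemma act_hom:
  assumes "\<gamma> \<in> topspace (Arr G)"
  shows "act \<O> \<gamma> \<in> ring_hom (F (src G \<gamma>)) (F (trg G \<gamma>))"
  using act_ring_hom assms by simp

lemma act_closed:
  assumes "\<gamma> \<in> topspace (Arr G)" "a \<in> carrier (F (src G \<gamma>))"
  shows "act \<O> \<gamma> a \<in> carrier (F (trg G \<gamma>))"
  using act_hom[OF assms(1)] assms(2) by (rule ring_hom_closed)

lemma cont_sec_act:
  assumes "cont_sec r V \<phi>" "continuous_map (subtopology X V) (Arr G) g"
    and "\<And>x. x \<in> V \<Longrightarrow> src G (g x) = r x"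
  shows "cont_sec (\<lambda>x. trg G (g x)) V (\<lambda>x. act \<O> (g x) (\<phi> x))"
proof -
  let ?T = "subtopology (prod_topology (Arr G) E) {(\<gamma>, e). src G \<gamma> = proj \<O> e}"
  have g: "g x \<in> topspace (Arr G)" if "x \<in> V" for x
    using assms(2) that cont_secD(2)[OF assms(1) that] by (auto simp: continuous_map_def)
  have "continuous_map (subtopology X V) ?T (\<lambda>x. (g x, \<phi> x))"
    using cont_secD[OF assms(1)] assms(2,3)
    by (auto intro!: continuous_map_into_subtopology continuous_map_pairedI)
  from continuous_map_compose[OF this act_continuous]
  have "continuous_map (subtopology X V) E (\<lambda>x. act \<O> (g x) (\<phi> x))" by (simp add: o_def)
  moreover have "act \<O> (g x) (\<phi> x) \<in> carrier (F (trg G (g x)))" if "x \<in> V" for x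
    using act_closed[OF g[OF that]] assms(3)[OF that] cont_secD(4)[OF assms(1) that] by simp
  ultimately show ?thesis
    using g cont_secD(1)[OF assms(1)] by (auto simp: cont_sec_def)
qed

text \<open>Near the common value the projection is injective. Both sections lie over the same
  points r y, so they coincide wherever both values stay in that neighbourhood. Most identities
  between local sections below are spread from a point to a neighbourhood in this way.\<close>

lemma cont_sec_agree:
  assumes "cont_sec r V \<phi>" "cont_sec r V \<psi>" "openin X V" "x \<in> V" "\<phi> x = \<psi> x"
  obtains K where "kopen K" "x \<in> K" "K \<subseteq> V" "\<And>y. y \<in> K \<Longrightarrow> \<phi> y = \<psi> y"
proof -
  obtain U where U: "openin E U" "\<phi> x \<in> U"
    "homeomorphic_map (subtopology E U) (subtopology X (proj \<O> ` U)) (proj \<O>)"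
    using proj_nbhd cont_secD(6)[OF assms(1,4)] by metis
  have inj: "inj_on (proj \<O>) U"
    using homeomorphic_imp_injective_map[OF U(3)] openin_subset[OF U(1)]
    by (simp add: Int_absorb1)
  have "openin X {y \<in> V. \<xi> y \<in> U}" if "cont_sec r V \<xi>" for \<xi>
    using openin_continuous_map_preimage[OF cont_secD(5)[OF that] U(1)] assms(3)
      cont_secD(1)[OF that]
    by (simp add: openin_open_subtopology Int_absorb1)
  then have "openin X ({y \<in> V. \<phi> y \<in> U} \<inter> {y \<in> V. \<psi> y \<in> U})" using assms by blast
  moreover have "x \<in> {y \<in> V. \<phi> y \<in> U} \<inter> {y \<in> V. \<psi> y \<in> U}" using assms U by auto
  ultimately obtain K where K: "kopen K" "x \<in> K" "K \<subseteq> {y \<in> V. \<phi> y \<in> U} \<inter> {y \<in> V. \<psi> y \<in> U}"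
    by (rule kopen_basis)
  then have "\<phi> y = \<psi> y" if "y \<in> K" for y
    using that inj cont_secD(7)[OF assms(1), of y] cont_secD(7)[OF assms(2), of y]
    by (auto simp: inj_on_def subset_iff)
  then show ?thesis using that K by blast
qed

text \<open>The section is a local inverse of the projection around a.\<close>

lemma cont_sec_extend:
  assumes "x \<in> topspace X" "a \<in> carrier (F x)" "openin X V" "x \<in> V"
  obtains K \<phi> where "kopen K" "x \<in> K" "K \<subseteq> V" "cont_sec (\<lambda>x. x) K \<phi>" "\<phi> x = a"
proof -
  have a: "a \<in> topspace E" "proj \<O> a = x" using assms carrier_F by auto
  obtain U where U: "openin E U" "a \<in> U" "openin X (proj \<O> ` U)"
    "homeomorphic_map (subtopology E U) (subtopology X (proj \<O> ` U)) (proj \<O>)"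
    using proj_nbhd a(1) by metis
  obtain \<phi> where "homeomorphic_maps (subtopology E U) (subtopology X (proj \<O> ` U)) (proj \<O>) \<phi>"
    using U(4) homeomorphic_map_maps by blast
  then have \<phi>: "continuous_map (subtopology X (proj \<O> ` U)) (subtopology E U) \<phi>"
    "\<And>e. e \<in> U \<Longrightarrow> \<phi> (proj \<O> e) = e"
    "\<And>y. y \<in> proj \<O> ` U \<Longrightarrow> proj \<O> (\<phi> y) = y"
    using openin_subset[OF U(1)] openin_subset[OF U(3)]
    by (auto simp: homeomorphic_maps_def subset_iff image_subset_iff)
  have "\<phi> y \<in> carrier (F y)" if "y \<in> proj \<O> ` U" for y
    using that \<phi>(2,3) openin_subset[OF U(1)] openin_subset[OF U(3)] by (subst carrier_F) auto
  then have sec: "cont_sec (\<lambda>x. x) (proj \<O> ` U) \<phi>"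
    using continuous_map_into_fulltopology[OF \<phi>(1)] openin_subset[OF U(3)] by (auto simp: cont_sec_def)
  have "openin X (proj \<O> ` U \<inter> V)" "x \<in> proj \<O> ` U \<inter> V" using U assms a by auto
  then obtain K where K: "kopen K" "x \<in> K" "K \<subseteq> proj \<O> ` U \<inter> V" by (rule kopen_basis)
  show ?thesis
    using that[OF K(1,2) _ cont_sec_mono[OF sec]] K(3) \<phi>(2)[OF U(2)] a(2) by auto
qed

lemma cont_sec_one: "cont_sec (\<lambda>x. x) (topspace X) (\<lambda>x. \<one>\<^bsub>F x\<^esub>)"
  using one_continuous ring_F by (auto simp: cont_sec_def ring.ring_simprules)

text \<open>A local section through zero agrees with its double near the point, so it vanishes there.\<close>

lemma cont_sec_zero: "cont_sec (\<lambda>x. x) (topspace X) (\<lambda>x. \<zero>\<^bsub>F x\<^esub>)"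
proof (rule cont_sec_locally)
  fix x assume x: "x \<in> topspace X"
  have "\<zero>\<^bsub>F x\<^esub> \<in> carrier (F x)" using ring_F[OF x] by (simp add: ring.ring_simprules)
  then obtain K \<phi> where K: "kopen K" "x \<in> K" "cont_sec (\<lambda>x. x) K \<phi>" "\<phi> x = \<zero>\<^bsub>F x\<^esub>"
    using cont_sec_extend[OF x _ _ x] by (metis openin_topspace)
  have "\<phi> x \<oplus>\<^bsub>F x\<^esub> \<phi> x = \<phi> x" using K(4) ring_F[OF x] by (simp add: ring.ring_simprules)
  then obtain L where L: "kopen L" "x \<in> L" "L \<subseteq> K" "\<And>y. y \<in> L \<Longrightarrow> \<phi> y \<oplus>\<^bsub>F y\<^esub> \<phi> y = \<phi> y"
    using cont_sec_agree[OF cont_sec_add[OF K(3,3)] K(3) _ K(2)] K(1) unfolding kopen_def by metis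
  have "\<phi> y = \<zero>\<^bsub>F y\<^esub>" if y: "y \<in> L" for y
  proof -
    have "y \<in> topspace X" "\<phi> y \<in> carrier (F y)" using cont_secD[OF K(3)] y L(3) by auto
    interpret ring "F y" using ring_F \<open>y \<in> topspace X\<close> .
    show ?thesis using L(4)[OF y] \<open>\<phi> y \<in> carrier (F y)\<close> add.l_cancel_one by metis
  qed
  then have "cont_sec (\<lambda>x. x) L (\<lambda>x. \<zero>\<^bsub>F x\<^esub>)"
    by (intro cont_sec_cong[OF cont_sec_mono[OF K(3) L(3)]]) auto
  then show "\<exists>W. openin X W \<and> x \<in> W \<and> cont_sec (\<lambda>x. x) W (\<lambda>x. \<zero>\<^bsub>F x\<^esub>)"
    using L by (auto simp: kopen_def)
qed simp

text \<open>Continuity of negation is not among the sheaf axioms and is derived: a local section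
  through minus one, added to the unit section, agrees with the zero section at the point, hence
  near it.\<close>

lemma cont_sec_minus_one: "cont_sec (\<lambda>x. x) (topspace X) (\<lambda>x. \<ominus>\<^bsub>F x\<^esub> \<one>\<^bsub>F x\<^esub>)"
proof (rule cont_sec_locally)
  fix x assume x: "x \<in> topspace X"
  have "\<ominus>\<^bsub>F x\<^esub> \<one>\<^bsub>F x\<^esub> \<in> carrier (F x)" using ring_F[OF x] by (simp add: ring.ring_simprules)
  then obtain K \<phi> where K: "kopen K" "x \<in> K" "cont_sec (\<lambda>x. x) K \<phi>" "\<phi> x = \<ominus>\<^bsub>F x\<^esub> \<one>\<^bsub>F x\<^esub>"
    using cont_sec_extend[OF x _ _ x] by (metis openin_topspace)
  have "\<phi> x \<oplus>\<^bsub>F x\<^esub> \<one>\<^bsub>F x\<^esub> = \<zero>\<^bsub>F x\<^esub>" using K(4) ring_F[OF x] by (simp add: ring.ring_simprules)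
  then obtain L where L: "kopen L" "x \<in> L" "L \<subseteq> K" "\<And>y. y \<in> L \<Longrightarrow> \<phi> y \<oplus>\<^bsub>F y\<^esub> \<one>\<^bsub>F y\<^esub> = \<zero>\<^bsub>F y\<^esub>"
    using cont_sec_agree[OF cont_sec_add[OF K(3) cont_sec_mono[OF cont_sec_one]]
        cont_sec_mono[OF cont_sec_zero] _ K(2)] K(1) kopen_subset[OF K(1)]
    unfolding kopen_def by metis
  have "\<phi> y = \<ominus>\<^bsub>F y\<^esub> \<one>\<^bsub>F y\<^esub>" if y: "y \<in> L" for y
  proof -
    have "y \<in> topspace X" "\<phi> y \<in> carrier (F y)" using cont_secD[OF K(3)] y L(3) by auto
    interpret ring "F y" using ring_F \<open>y \<in> topspace X\<close> .
    show ?thesis using minus_equality[OF L(4)[OF y]] \<open>\<phi> y \<in> carrier (F y)\<close> by simp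
  qed
  then have "cont_sec (\<lambda>x. x) L (\<lambda>x. \<ominus>\<^bsub>F x\<^esub> \<one>\<^bsub>F x\<^esub>)"
    by (intro cont_sec_cong[OF cont_sec_mono[OF K(3) L(3)]]) auto
  then show "\<exists>W. openin X W \<and> x \<in> W \<and> cont_sec (\<lambda>x. x) W (\<lambda>x. \<ominus>\<^bsub>F x\<^esub> \<one>\<^bsub>F x\<^esub>)"
    using L by (auto simp: kopen_def)
qed simp

text \<open>Negation is multiplication by the section minus one, pulled back along r; continuity of
  r is what makes this pullback a section.\<close>

lemma cont_sec_minus:
  assumes "cont_sec r V \<phi>" "continuous_map (subtopology X V) X r"
  shows "cont_sec r V (\<lambda>x. \<ominus>\<^bsub>F (r x)\<^esub> \<phi> x)"
proof -
  have "cont_sec r V (\<lambda>x. \<ominus>\<^bsub>F (r x)\<^esub> \<one>\<^bsub>F (r x)\<^esub>)"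
    using cont_sec_compose[OF cont_sec_minus_one assms(2)] assms(1) by (auto simp: cont_sec_def)
  from cont_sec_mult[OF this assms(1)] show ?thesis
  proof (rule cont_sec_cong)
    fix x assume x: "x \<in> V"
    interpret ring "F (r x)" using ring_F cont_secD(3)[OF assms(1) x] .
    show "\<ominus>\<^bsub>F (r x)\<^esub> \<one>\<^bsub>F (r x)\<^esub> \<otimes>\<^bsub>F (r x)\<^esub> \<phi> x = \<ominus>\<^bsub>F (r x)\<^esub> \<phi> x"
      using cont_secD(4)[OF assms(1) x] by (simp add: l_minus)
  qed simp
qed

text \<open>Only the value at x has to be inverted. The product of \<phi> with a local section
  through that inverse agrees with the unit section at x, hence on a neighbourhood.\<close>

lemma cont_sec_inverse:
  assumes "cont_sec (\<lambda>x. x) V \<phi>" "openin X V" "x \<in> V" "\<phi> x \<noteq> \<zero>\<^bsub>F x\<^esub>"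
  obtains K \<psi> where "kopen K" "x \<in> K" "K \<subseteq> V" "cont_sec (\<lambda>x. x) K \<psi>"
    "\<And>y. y \<in> K \<Longrightarrow> \<phi> y \<otimes>\<^bsub>F y\<^esub> \<psi> y = \<one>\<^bsub>F y\<^esub>"
proof -
  have x: "x \<in> topspace X" using cont_secD(2)[OF assms(1,3)] .
  interpret field "F x" using field_F[OF x] .
  have "\<phi> x \<in> Units (F x)" using cont_secD(4)[OF assms(1,3)] assms(4) by (simp add: field_Units)
  then have inv: "inv\<^bsub>F x\<^esub> \<phi> x \<in> carrier (F x)" "\<phi> x \<otimes>\<^bsub>F x\<^esub> inv\<^bsub>F x\<^esub> \<phi> x = \<one>\<^bsub>F x\<^esub>" by auto
  obtain L \<psi> where L: "kopen L" "x \<in> L" "L \<subseteq> V" "cont_sec (\<lambda>x. x) L \<psi>" "\<psi> x = inv\<^bsub>F x\<^esub> \<phi> x"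
    using cont_sec_extend[OF x inv(1) assms(2,3)] by metis
  have "openin X L" "\<phi> x \<otimes>\<^bsub>F x\<^esub> \<psi> x = \<one>\<^bsub>F x\<^esub>" using L inv by (auto simp: kopen_def)
  then obtain K where K: "kopen K" "x \<in> K" "K \<subseteq> L" "\<And>y. y \<in> K \<Longrightarrow> \<phi> y \<otimes>\<^bsub>F y\<^esub> \<psi> y = \<one>\<^bsub>F y\<^esub>"
    using cont_sec_agree[OF cont_sec_mult[OF cont_sec_mono[OF assms(1) L(3)] L(4)]
        cont_sec_mono[OF cont_sec_one kopen_subset[OF L(1)]] _ L(2)] by metis
  show ?thesis using that[of K \<psi>] K L cont_sec_mono[OF L(4)] by auto
qed

text \<open>A compact set is closed in the Hausdorff space X, so K and its complement are both open
  and continuity is checked on each.\<close>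

lemma cont_sec_extend_by_zero:
  assumes "cont_sec (\<lambda>x. x) K \<phi>" "kopen K"
  shows "cont_sec (\<lambda>x. x) (topspace X) (\<lambda>x. if x \<in> K then \<phi> x else \<zero>\<^bsub>F x\<^esub>)"
proof (rule cont_sec_locally)
  fix x assume x: "x \<in> topspace X"
  show "\<exists>W. openin X W \<and> x \<in> W \<and> cont_sec (\<lambda>x. x) W (\<lambda>x. if x \<in> K then \<phi> x else \<zero>\<^bsub>F x\<^esub>)"
  proof (cases "x \<in> K")
    case True
    have "cont_sec (\<lambda>x. x) K (\<lambda>x. if x \<in> K then \<phi> x else \<zero>\<^bsub>F x\<^esub>)"
      using assms(1) by (rule cont_sec_cong) auto
    then show ?thesis using True assms(2) by (auto simp: kopen_def)
  next
    case False
    have "cont_sec (\<lambda>x. x) (topspace X - K) (\<lambda>x. if x \<in> K then \<phi> x else \<zero>\<^bsub>F x\<^esub>)"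
      using cont_sec_mono[OF cont_sec_zero, of "topspace X - K"] by (rule cont_sec_cong) auto
    moreover have "openin X (topspace X - K)" using kopen_closedin[OF assms(2)] by auto
    ultimately show ?thesis using False x by blast
  qed
qed simp

text \<open>
  The group \<open>SG\<close> is a multiplicative record: its product is pointwise addition and its
  identity is the zero section.
\<close>

abbreviation "Ar \<equiv> topspace (Arr G)"
abbreviation "SG \<equiv> section_group G \<O>"
abbreviation "SR \<equiv> section_ring G \<O>"
abbreviation "conv \<equiv> convolution G \<O>"

lemma ring_trg: "\<gamma> \<in> Ar \<Longrightarrow> ring (F (trg G \<gamma>))"
  using ring_F src_trg_in(2) by blast

lemma comm_group_SG: "comm_group SG"
proof -
  have grp: "comm_group (add_monoid (F (trg G \<gamma>)))" if "\<gamma> \<in> Ar" for \<gamma>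
    using ring_trg[OF that] ring.is_abelian_group abelian_group.a_comm_group by blast
  then have "group SG"
    unfolding section_group_def using comm_group.axioms(2) by (intro product_group) blast
  then show ?thesis
  proof (rule group.group_comm_groupI)
    fix f g assume "f \<in> carrier SG" "g \<in> carrier SG"
    then show "f \<otimes>\<^bsub>SG\<^esub> g = g \<otimes>\<^bsub>SG\<^esub> f"
      using comm_monoid.m_comm[OF comm_group.axioms(1)[OF grp]]
      by (auto simp: section_group_def PiE_iff intro!: restrict_ext)
  qed
qed

sublocale SG: comm_group SG
  by (rule comm_group_SG)

lemma SG_iff: "f \<in> carrier SG \<longleftrightarrow> f \<in> (\<Pi>\<^sub>E \<gamma> \<in> Ar. carrier (F (trg G \<gamma>)))"
  by (simp add: section_group_def)

lemma SG_closed: "f \<in> carrier SG \<Longrightarrow> \<gamma> \<in> Ar \<Longrightarrow> f \<gamma> \<in> carrier (F (trg G \<gamma>))"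
  by (auto simp: SG_iff)

lemma SG_add: "\<gamma> \<in> Ar \<Longrightarrow> (f \<otimes>\<^bsub>SG\<^esub> g) \<gamma> = f \<gamma> \<oplus>\<^bsub>F (trg G \<gamma>)\<^esub> g \<gamma>"
  by (simp add: section_group_def)

lemma SG_zero: "\<gamma> \<in> Ar \<Longrightarrow> \<one>\<^bsub>SG\<^esub> \<gamma> = \<zero>\<^bsub>F (trg G \<gamma>)\<^esub>"
  by (simp add: section_group_def)

lemma SG_eqI:
  assumes "f \<in> carrier SG" "g \<in> carrier SG" "\<And>\<gamma>. \<gamma> \<in> Ar \<Longrightarrow> f \<gamma> = g \<gamma>"
  shows "f = g"
  using assms unfolding SG_iff by (intro PiE_ext)

lemma SG_inv: "f \<in> carrier SG \<Longrightarrow> \<gamma> \<in> Ar \<Longrightarrow> (inv\<^bsub>SG\<^esub> f) \<gamma> = \<ominus>\<^bsub>F (trg G \<gamma>)\<^esub> f \<gamma>"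
proof -
  assume f: "f \<in> carrier SG" and g: "\<gamma> \<in> Ar"
  interpret ring "F (trg G \<gamma>)" using ring_trg[OF g] .
  have "(inv\<^bsub>SG\<^esub> f) \<gamma> \<oplus>\<^bsub>F (trg G \<gamma>)\<^esub> f \<gamma> = \<zero>\<^bsub>F (trg G \<gamma>)\<^esub>"
    using SG.l_inv[OF f] SG_add[OF g, of "inv\<^bsub>SG\<^esub> f" f] SG_zero[OF g] by simp
  then show ?thesis
    using minus_equality SG_closed[OF f g] SG_closed[OF SG.inv_closed[OF f] g] by simp
qed

subsection \<open>Basic sections\<close>

text \<open>The coefficient \<phi> is indexed by the source of a germ although its values lie over
  the range. All basic sections are thereby described by functions on subsets of X, away from the
  arrow space.\<close>

definition basic :: "'s \<Rightarrow> 'x set \<Rightarrow> ('x \<Rightarrow> 'e) \<Rightarrow> bool" where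
  "basic s K \<phi> \<longleftrightarrow> kopen K \<and> K \<subseteq> D (star s) \<and> cont_sec (\<theta> s) K \<phi>"

definition bs :: "'s \<Rightarrow> 'x set \<Rightarrow> ('x \<Rightarrow> 'e) \<Rightarrow> ('s \<times> 'x) set \<Rightarrow> 'e" where
  "bs s K \<phi> = (\<lambda>\<gamma> \<in> Ar. if \<gamma> \<in> germ D s ` K then \<phi> (src G \<gamma>) else \<zero>\<^bsub>F (trg G \<gamma>)\<^esub>)"

definition Basics :: "(('s \<times> 'x) set \<Rightarrow> 'e) set" where
  "Basics = {bs s K \<phi> | s K \<phi>. basic s K \<phi>}"

lemma basicD:
  assumes "basic s K \<phi>"
  shows "kopen K" "K \<subseteq> D (star s)" "x \<in> K \<Longrightarrow> x \<in> D (star s)" "cont_sec (\<theta> s) K \<phi>"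
    "x \<in> K \<Longrightarrow> \<phi> x \<in> carrier (F (\<theta> s x))" "x \<in> K \<Longrightarrow> \<theta> s x \<in> topspace X"
  using assms cont_secD[of "\<theta> s" K \<phi>] by (auto simp: basic_def)

lemma bs_germ: "K \<subseteq> D (star s) \<Longrightarrow> x \<in> K \<Longrightarrow> bs s K \<phi> (germ D s x) = \<phi> x"
  using germ_in_Arr[of x s] src_germ[of x s] by (auto simp: bs_def)

lemma bs_outside: "\<gamma> \<in> Ar \<Longrightarrow> \<gamma> \<notin> germ D s ` K \<Longrightarrow> bs s K \<phi> \<gamma> = \<zero>\<^bsub>F (trg G \<gamma>)\<^esub>"
  by (simp add: bs_def)

lemma bs_closed: "basic s K \<phi> \<Longrightarrow> bs s K \<phi> \<in> carrier SG"
  unfolding SG_iff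
proof (rule PiE_I)
  fix \<gamma> assume b: "basic s K \<phi>" and g: "\<gamma> \<in> Ar"
  show "bs s K \<phi> \<gamma> \<in> carrier (F (trg G \<gamma>))"
  proof (cases "\<gamma> \<in> germ D s ` K")
    case True
    then obtain x where x: "x \<in> K" "\<gamma> = germ D s x" by auto
    then show ?thesis using basicD[OF b] bs_germ by auto
  next
    case False
    then show ?thesis using g ring_trg[OF g] by (simp add: bs_outside ring.ring_simprules)
  qed
qed (simp add: bs_def)

lemma Basics_subset: "Basics \<subseteq> carrier SG"
  using bs_closed by (auto simp: Basics_def)

lemma bs_cong:
  assumes "K \<subseteq> D (star s)" "\<And>x. x \<in> K \<Longrightarrow> \<phi> x = \<psi> x"
  shows "bs s K \<phi> = bs s K \<psi>"
proof
  fix \<gamma>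
  show "bs s K \<phi> \<gamma> = bs s K \<psi> \<gamma>"
  proof (cases "\<gamma> \<in> germ D s ` K")
    case True
    then show ?thesis using assms bs_germ by auto
  qed (simp add: bs_def)
qed

lemma bs_eqI:
  assumes "f \<in> carrier SG" "basic s K \<phi>"
    and "\<And>x. x \<in> K \<Longrightarrow> f (germ D s x) = \<phi> x"
    and "\<And>\<gamma>. \<gamma> \<in> Ar \<Longrightarrow> \<gamma> \<notin> germ D s ` K \<Longrightarrow> f \<gamma> = \<zero>\<^bsub>F (trg G \<gamma>)\<^esub>"
  shows "f = bs s K \<phi>"
proof (rule SG_eqI[OF assms(1) bs_closed[OF assms(2)]])
  fix \<gamma> assume g: "\<gamma> \<in> Ar"
  show "f \<gamma> = bs s K \<phi> \<gamma>"
  proof (cases "\<gamma> \<in> germ D s ` K")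
    case True
    then show ?thesis using assms(3) bs_germ basicD(2)[OF assms(2)] by auto
  next
    case False
    then show ?thesis using assms(4) g bs_outside by simp
  qed
qed

lemma germ_image_inj:
  assumes "K \<subseteq> D (star s)"
  shows "inj_on (src G) (germ D s ` K)" "inj_on (trg G) (germ D s ` K)"
  using assms theta_inj[of s] by (auto simp: inj_on_def subset_iff)

lemma bs_elementary: "basic s K \<phi> \<Longrightarrow> bs s K \<phi> \<in> elementary_sections G \<O>"
proof -
  assume b: "basic s K \<phi>"
  note K = basicD[OF b]
  let ?U = "germ D s ` K"
  have U: "?U \<subseteq> Ar" using K(3) by auto
  have "bisection G ?U" using germ_image_inj[OF K(2)] U by (simp add: bisection_def)
  moreover have "openin (Arr G) ?U" using K(1,2) openin_germ_image by (simp add: kopen_def)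
  moreover have "compactin (Arr G) ?U"
    using K(1,2) compact_imp_compactin_subtopology
    by (intro image_compactin[OF _ germ_continuous]) (auto simp: kopen_def)
  moreover have "continuous_map (subtopology (Arr G) ?U) E (bs s K \<phi>)"
  proof -
    have "continuous_map (subtopology (Arr G) ?U) (subtopology X K) (src G)"
      using src_continuous K(3)
      by (intro continuous_map_into_subtopology continuous_map_from_subtopology) auto
    from continuous_map_compose[OF this cont_secD(5)[OF K(4)]]
    show ?thesis by (rule continuous_map_eq) (use K(3) in \<open>auto simp: bs_def\<close>)
  qed
  ultimately show ?thesis
    unfolding elementary_sections_def using bs_closed[OF b] bs_outside[of _ s K \<phi>] by blast
qed

lemma theta_continuous_on: "K \<subseteq> D (star s) \<Longrightarrow> continuous_map (subtopology X K) X (\<theta> s)"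
  using theta_continuous continuous_map_from_subtopology_mono by blast

text \<open>As additive inverses of basic sections are basic, the group generated by them consists
  of plain finite sums; this is what allows summands to be counted and removes the inverse case from
  \<open>SR_induct\<close>.\<close>

lemma basic_minus:
  assumes "basic s K \<phi>"
  shows "basic s K (\<lambda>x. \<ominus>\<^bsub>F (\<theta> s x)\<^esub> \<phi> x)"
    "inv\<^bsub>SG\<^esub> (bs s K \<phi>) = bs s K (\<lambda>x. \<ominus>\<^bsub>F (\<theta> s x)\<^esub> \<phi> x)"
proof -
  note K = basicD[OF assms]
  show b: "basic s K (\<lambda>x. \<ominus>\<^bsub>F (\<theta> s x)\<^esub> \<phi> x)"
    using K cont_sec_minus[OF K(4) theta_continuous_on[OF K(2)]] by (simp add: basic_def)
  show "inv\<^bsub>SG\<^esub> (bs s K \<phi>) = bs s K (\<lambda>x. \<ominus>\<^bsub>F (\<theta> s x)\<^esub> \<phi> x)"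
  proof (rule bs_eqI[OF _ b])
    fix \<gamma> assume g: "\<gamma> \<in> Ar" "\<gamma> \<notin> germ D s ` K"
    interpret ring "F (trg G \<gamma>)" using ring_trg[OF g(1)] .
    show "(inv\<^bsub>SG\<^esub> (bs s K \<phi>)) \<gamma> = \<zero>\<^bsub>F (trg G \<gamma>)\<^esub>"
      using g bs_closed[OF assms] minus_zero by (simp add: SG_inv bs_outside)
  qed (use bs_closed[OF assms] K in \<open>auto simp: SG_inv bs_germ\<close>)
qed

subsection \<open>Generation by basic sections\<close>

text \<open>Around each source point the bisection contains the germs of one semigroup element, and
  there the section is basic. Compactness leaves finitely many such pieces, which are then made
  disjoint.\<close>

lemma elementary_generated:
  assumes f: "f \<in> elementary_sections G \<O>"
  shows "f \<in> generate SG Basics"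
proof -
  obtain U where fS: "f \<in> carrier SG" and bis: "bisection G U" and open_U: "openin (Arr G) U"
    and comp: "compactin (Arr G) U" and cont: "continuous_map (subtopology (Arr G) U) E f"
    and f0: "\<And>\<gamma>. \<gamma> \<in> Ar \<Longrightarrow> \<gamma> \<notin> U \<Longrightarrow> f \<gamma> = \<zero>\<^bsub>F (trg G \<gamma>)\<^esub>"
    using f by (auto simp: elementary_sections_def)
  have UA: "U \<subseteq> Ar" and inj: "inj_on (src G) U" using bis by (auto simp: bisection_def)
  \<comment> \<open>f is cut down to the part of U with sources in K. The cutting is done over X,
    where differences of compact open sets are compact open; in the possibly non-Hausdorff arrow
    space they need not be.\<close>
  define f' where
    "f' K = (\<lambda>\<gamma> \<in> Ar. if \<gamma> \<in> U \<and> src G \<gamma> \<in> K then f \<gamma> else \<zero>\<^bsub>F (trg G \<gamma>)\<^esub>)" for K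
  have f'S: "f' K \<in> carrier SG" for K
    unfolding SG_iff f'_def using SG_closed[OF fS] ring_trg
    by (auto simp: ring.ring_simprules)
  \<comment> \<open>Smallness is required of all compact open subsets because the induction below
    applies it to \<open>K - \<Union>\<F>\<close> and not to K.\<close>
  define small where
    "small = {K. kopen K \<and> (\<forall>L \<subseteq> K. kopen L \<longrightarrow> f' L \<in> generate SG Basics)}"
  have local: "\<exists>K \<in> small. x \<in> K" if x: "x \<in> src G ` U" for x
  proof -
    obtain s where s: "germ D s x \<in> U" "x \<in> D (star s)"
      using x UA by (auto elim!: Arr_cases dest!: subsetD)
    let ?W = "{y \<in> D (star s). germ D s y \<in> U}"
    have "openin X ?W"
      using openin_continuous_map_preimage[OF germ_continuous[of s] open_U] open_D[of "star s"]
      by (simp add: openin_open_subtopology)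
    then obtain K where K: "kopen K" "x \<in> K" "K \<subseteq> ?W" using s kopen_basis by (metis (mono_tags, lifting) mem_Collect_eq)
    have "f' L \<in> generate SG Basics" if L: "L \<subseteq> K" "kopen L" for L
    proof -
      have LD: "L \<subseteq> D (star s)" and LU: "germ D s ` L \<subseteq> U" using L K by auto
      have "continuous_map (subtopology X L) (subtopology (Arr G) U) (germ D s)"
        using LD LU D_subset[of "star s"]
        by (intro continuous_map_into_subtopology continuous_map_from_subtopology_mono[OF germ_continuous]) auto
      from continuous_map_compose[OF this cont]
      have "continuous_map (subtopology X L) E (\<lambda>y. f (germ D s y))" by (simp add: o_def)
      moreover have "\<theta> s y \<in> topspace X \<and> f (germ D s y) \<in> carrier (F (\<theta> s y))" if "y \<in> L" for y
        using that LD D_subset[of s] theta_in[of y s] SG_closed[OF fS, of "germ D s y"] by auto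
      ultimately have "cont_sec (\<theta> s) L (\<lambda>y. f (germ D s y))"
        using LD D_subset[of "star s"] by (auto simp: cont_sec_def)
      then have b: "basic s L (\<lambda>y. f (germ D s y))" using L LD by (simp add: basic_def)
      have "f' L = bs s L (\<lambda>y. f (germ D s y))"
      proof (rule bs_eqI[OF f'S b])
        fix y assume "y \<in> L"
        then show "f' L (germ D s y) = f (germ D s y)" using LD LU by (auto simp: f'_def)
      next
        fix \<gamma> assume g: "\<gamma> \<in> Ar" "\<gamma> \<notin> germ D s ` L"
        \<comment> \<open>U holds at most one arrow over each source, and over L this arrow is the
          germ of s.\<close>
        have "\<not> (\<gamma> \<in> U \<and> src G \<gamma> \<in> L)"
        proof
          assume *: "\<gamma> \<in> U \<and> src G \<gamma> \<in> L"
          then have "src G \<gamma> = src G (germ D s (src G \<gamma>))" "germ D s (src G \<gamma>) \<in> U"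
            using LD LU by auto
          then have "\<gamma> = germ D s (src G \<gamma>)" using inj * by (meson inj_onD)
          then show False using g * by blast
        qed
        then show "f' L \<gamma> = \<zero>\<^bsub>F (trg G \<gamma>)\<^esub>" using g by (auto simp: f'_def)
      qed
      then show ?thesis using b by (auto simp: Basics_def intro!: generate.incl)
    qed
    then show ?thesis using K by (auto simp: small_def)
  qed
  have "compactin X (src G ` U)" using image_compactin[OF comp src_continuous] .
  moreover have "\<And>K. K \<in> small \<Longrightarrow> openin X K" by (simp add: small_def kopen_def)
  moreover have "src G ` U \<subseteq> \<Union>small" using local by blast
  ultimately obtain \<F> where \<F>: "finite \<F>" "\<F> \<subseteq> small" "src G ` U \<subseteq> \<Union>\<F>"
    by (meson compactinD)
  have "kopen (\<Union>\<F>) \<and> f' (\<Union>\<F>) \<in> generate SG Basics"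
    using \<F>(1,2)
  proof (induction rule: finite_induct)
    case empty
    have "f' {} = \<one>\<^bsub>SG\<^esub>" by (rule SG_eqI[OF f'S]) (simp_all add: f'_def SG_zero)
    then show ?case by (simp add: kopen_empty generate.one)
  next
    case (insert K \<F>)
    have K: "kopen K" "\<And>L. L \<subseteq> K \<Longrightarrow> kopen L \<Longrightarrow> f' L \<in> generate SG Basics"
      using insert.prems by (auto simp: small_def)
    have IH: "kopen (\<Union>\<F>)" "f' (\<Union>\<F>) \<in> generate SG Basics" using insert by auto
    have "kopen (K \<union> \<Union>\<F>)" using K(1) IH(1) by (simp add: kopen_def compactin_Un openin_Un)
    \<comment> \<open>Removing the part already covered makes the two pieces disjoint, so no value
      of f is counted twice.\<close>
    moreover have "f' (K \<union> \<Union>\<F>) = f' (K - \<Union>\<F>) \<otimes>\<^bsub>SG\<^esub> f' (\<Union>\<F>)"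
    proof (rule SG_eqI[OF f'S SG.m_closed[OF f'S f'S]])
      fix \<gamma> assume g: "\<gamma> \<in> Ar"
      interpret ring "F (trg G \<gamma>)" using ring_trg[OF g] .
      show "f' (K \<union> \<Union>\<F>) \<gamma> = (f' (K - \<Union>\<F>) \<otimes>\<^bsub>SG\<^esub> f' (\<Union>\<F>)) \<gamma>"
        using g SG_closed[OF fS g] by (auto simp: SG_add f'_def)
    qed
    moreover have "f' (K - \<Union>\<F>) \<in> generate SG Basics"
      using K IH kopen_Diff by blast
    ultimately show ?case using IH by (simp add: generate.eng)
  qed
  moreover have "f' (\<Union>\<F>) = f"
  proof (rule SG_eqI[OF f'S fS])
    fix \<gamma> assume g: "\<gamma> \<in> Ar"
    show "f' (\<Union>\<F>) \<gamma> = f \<gamma>"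
    proof (cases "\<gamma> \<in> U")
      case True
      then show ?thesis using \<F>(3) g by (auto simp: f'_def)
    next
      case False
      then show ?thesis using f0 g by (simp add: f'_def)
    qed
  qed
  ultimately show ?thesis by simp
qed

lemma SR_simps [simp]: "add SR = monoid.mult SG" "zero SR = \<one>\<^bsub>SG\<^esub>" "monoid.mult SR = conv"
  by (simp_all add: section_ring_def)

lemma carrier_SR: "carrier SR = generate SG Basics"
proof -
  have "elementary_sections G \<O> \<subseteq> carrier SG" by (auto simp: elementary_sections_def)
  moreover have "Basics \<subseteq> elementary_sections G \<O>"
    using bs_elementary by (auto simp: Basics_def)
  ultimately have "generate SG (elementary_sections G \<O>) = generate SG Basics"
    using elementary_generated SG.generate_is_subgroup[OF Basics_subset]
      SG.generate_subgroup_incl[of "elementary_sections G \<O>" "generate SG Basics"]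
      SG.mono_generate[of Basics "elementary_sections G \<O>"] by blast
  then show ?thesis by (simp add: section_ring_def)
qed

lemma SR_subset: "carrier SR \<subseteq> carrier SG"
  using carrier_SR SG.generate_incl[OF Basics_subset] by simp

lemma Basics_SR: "Basics \<subseteq> carrier SR"
  using carrier_SR generate.incl by fastforce

text \<open>Sums are indexed by lists because their length is the quantity minimised in
  \<open>ideal_meets_diagonal\<close>; repetitions are allowed.\<close>

definition lsum :: "(('s \<times> 'x) set \<Rightarrow> 'e) list \<Rightarrow> ('s \<times> 'x) set \<Rightarrow> 'e" where
  "lsum bl = foldr (monoid.mult SG) bl \<one>\<^bsub>SG\<^esub>"

lemma lsum_simps [simp]: "lsum [] = \<one>\<^bsub>SG\<^esub>" "lsum (b # bl) = b \<otimes>\<^bsub>SG\<^esub> lsum bl"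
  by (simp_all add: lsum_def)

lemma lsum_closed: "set bl \<subseteq> Basics \<Longrightarrow> lsum bl \<in> carrier SR"
  by (induction bl) (auto simp: carrier_SR intro: generate.intros)

lemma lsum_SG: "set bl \<subseteq> carrier SG \<Longrightarrow> lsum bl \<in> carrier SG"
  by (induction bl) auto

lemma lsum_append:
  "set bl \<subseteq> carrier SG \<Longrightarrow> set cl \<subseteq> carrier SG \<Longrightarrow> lsum (bl @ cl) = lsum bl \<otimes>\<^bsub>SG\<^esub> lsum cl"
  by (induction bl) (auto simp: lsum_SG SG.m_assoc)

lemma SR_lsum:
  assumes "f \<in> carrier SR"
  obtains bl where "set bl \<subseteq> Basics" "f = lsum bl"
proof -
  have single: "h = lsum [h]" if "h \<in> Basics" for h
    using that Basics_subset by auto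
  have "\<exists>bl. set bl \<subseteq> Basics \<and> f = lsum bl"
    using assms unfolding carrier_SR
  proof induction
    case one
    show ?case by (rule exI[of _ "[]"]) simp
  next
    case (incl h)
    then show ?case using single by (intro exI[of _ "[h]"]) simp
  next
    case (inv h)
    then have "inv\<^bsub>SG\<^esub> h \<in> Basics" using basic_minus unfolding Basics_def by blast
    then show ?case using single by (intro exI[of _ "[inv\<^bsub>SG\<^esub> h]"]) simp
  next
    case (eng h1 h2)
    then obtain bl cl where "set bl \<subseteq> Basics" "h1 = lsum bl" "set cl \<subseteq> Basics" "h2 = lsum cl"
      by blast
    then show ?case
      using Basics_subset by (intro exI[of _ "bl @ cl"]) (auto simp: lsum_append)
  qed
  then show ?thesis using that by blast
qed

lemma SR_induct [consumes 1, case_names zero basic add]: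
  assumes "f \<in> carrier SR"
    and "P \<one>\<^bsub>SG\<^esub>"
    and "\<And>s K \<phi>. basic s K \<phi> \<Longrightarrow> P (bs s K \<phi>)"
    and "\<And>f g. \<lbrakk>f \<in> carrier SR; g \<in> carrier SR; P f; P g\<rbrakk> \<Longrightarrow> P (f \<otimes>\<^bsub>SG\<^esub> g)"
  shows "P f"
proof -
  obtain bl where "set bl \<subseteq> Basics" "f = lsum bl" using assms(1) by (rule SR_lsum)
  moreover from this(1) have "P (lsum bl)"
  proof (induction bl)
    case (Cons b bl)
    then have "b \<in> carrier SR" "P b" "lsum bl \<in> carrier SR"
      using Basics_SR assms(3) lsum_closed[of bl] by (auto simp: Basics_def)
    then show ?case using Cons assms(4) by simp
  qed (simp add: assms(2))
  ultimately show ?thesis by simp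
qed

subsection \<open>Convolution\<close>

lemma act_simps:
  assumes "\<gamma> \<in> Ar"
  shows "act \<O> \<gamma> \<zero>\<^bsub>F (src G \<gamma>)\<^esub> = \<zero>\<^bsub>F (trg G \<gamma>)\<^esub>" "act \<O> \<gamma> \<one>\<^bsub>F (src G \<gamma>)\<^esub> = \<one>\<^bsub>F (trg G \<gamma>)\<^esub>"
    "\<lbrakk>a \<in> carrier (F (src G \<gamma>)); b \<in> carrier (F (src G \<gamma>))\<rbrakk> \<Longrightarrow>
      act \<O> \<gamma> (a \<oplus>\<^bsub>F (src G \<gamma>)\<^esub> b) = act \<O> \<gamma> a \<oplus>\<^bsub>F (trg G \<gamma>)\<^esub> act \<O> \<gamma> b"
    "\<lbrakk>a \<in> carrier (F (src G \<gamma>)); b \<in> carrier (F (src G \<gamma>))\<rbrakk> \<Longrightarrow>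
      act \<O> \<gamma> (a \<otimes>\<^bsub>F (src G \<gamma>)\<^esub> b) = act \<O> \<gamma> a \<otimes>\<^bsub>F (trg G \<gamma>)\<^esub> act \<O> \<gamma> b"
  using act_hom[OF assms] ring_hom_zero ring_F src_trg_in[OF assms]
  by (auto simp: ring_hom_one ring_hom_add ring_hom_mult)

text \<open>Nonzero values are finite in number on every range fibre. Without this the index set in
  \<open>convolution\<close> could be infinite, \<open>finsum\<close> would return zero, and
  distributivity would break down. A basic section has at most one such value per fibre, since
  ranges are injective on its bisection.\<close>

definition fibfin :: "(('s \<times> 'x) set \<Rightarrow> 'e) \<Rightarrow> bool" where
  "fibfin f \<longleftrightarrow> (\<forall>z. finite {\<beta> \<in> Ar. trg G \<beta> = z \<and> f \<beta> \<noteq> \<zero>\<^bsub>F z\<^esub>})"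

lemma SR_fibfin: "f \<in> carrier SR \<Longrightarrow> fibfin f"
proof (induction rule: SR_induct)
  case zero
  have empty: "{\<beta> \<in> Ar. trg G \<beta> = z \<and> \<one>\<^bsub>SG\<^esub> \<beta> \<noteq> \<zero>\<^bsub>F z\<^esub>} = {}" for z by (auto simp: SG_zero)
  show ?case unfolding fibfin_def empty by simp
next
  case (basic s K \<phi>)
  note K = basicD[OF basic]
  have "finite {\<beta> \<in> Ar. trg G \<beta> = z \<and> bs s K \<phi> \<beta> \<noteq> \<zero>\<^bsub>F z\<^esub>}" (is "finite ?B") for z
  proof -
    have B: "?B \<subseteq> germ D s ` K" using bs_outside[of _ s K \<phi>] by auto
    have "inj_on (trg G) ?B" using inj_on_subset[OF germ_image_inj(2)[OF K(2)] B] .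
    moreover have "trg G ` ?B \<subseteq> {z}" by auto
    ultimately show ?thesis by (meson finite.emptyI finite.insertI inj_on_finite)
  qed
  then show ?case by (simp add: fibfin_def)
next
  case (add f g)
  have "{\<beta> \<in> Ar. trg G \<beta> = z \<and> (f \<otimes>\<^bsub>SG\<^esub> g) \<beta> \<noteq> \<zero>\<^bsub>F z\<^esub>} \<subseteq>
    {\<beta> \<in> Ar. trg G \<beta> = z \<and> f \<beta> \<noteq> \<zero>\<^bsub>F z\<^esub>} \<union> {\<beta> \<in> Ar. trg G \<beta> = z \<and> g \<beta> \<noteq> \<zero>\<^bsub>F z\<^esub>}" for z
    using ring_trg by (auto simp: SG_add ring.ring_simprules)
  then show ?case
    using add.IH unfolding fibfin_def by (meson finite_UnI finite_subset)
qed

definition fact_pairs :: "('s \<times> 'x) set \<Rightarrow> (('s \<times> 'x) set \<times> ('s \<times> 'x) set) set" where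
  "fact_pairs \<gamma> = {(\<beta>, \<rho>) \<in> composable G. gmult G \<beta> \<rho> = \<gamma>}"

lemma fact_pairsD:
  assumes "(\<beta>, \<rho>) \<in> fact_pairs \<gamma>"
  shows "(\<beta>, \<rho>) \<in> composable G" "\<beta> \<in> Ar" "\<rho> \<in> Ar" "src G \<beta> = trg G \<rho>" "trg G \<beta> = trg G \<gamma>"
    "src G \<rho> = src G \<gamma>" "gmult G \<beta> \<rho> = \<gamma>" "\<gamma> \<in> Ar"
  using assms gmult_closed[of \<beta> \<rho>] by (auto simp: fact_pairs_def composable_def)

lemma conv_term_closed:
  assumes "f \<in> carrier SG" "g \<in> carrier SG" "(\<beta>, \<rho>) \<in> fact_pairs \<gamma>"
  shows "f \<beta> \<in> carrier (F (trg G \<gamma>))" "act \<O> \<beta> (g \<rho>) \<in> carrier (F (trg G \<gamma>))"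
    "f \<beta> \<otimes>\<^bsub>F (trg G \<gamma>)\<^esub> act \<O> \<beta> (g \<rho>) \<in> carrier (F (trg G \<gamma>))"
proof -
  note p = fact_pairsD[OF assms(3)]
  show 1: "f \<beta> \<in> carrier (F (trg G \<gamma>))" using SG_closed[OF assms(1) p(2)] p(5) by simp
  show 2: "act \<O> \<beta> (g \<rho>) \<in> carrier (F (trg G \<gamma>))"
    using act_closed[OF p(2)] SG_closed[OF assms(2) p(3)] p(4,5) by simp
  show "f \<beta> \<otimes>\<^bsub>F (trg G \<gamma>)\<^esub> act \<O> \<beta> (g \<rho>) \<in> carrier (F (trg G \<gamma>))"
    using 1 2 ring_trg[OF p(8)] by (simp add: ring.ring_simprules)
qed

text \<open>The index set in \<open>convolution\<close> depends on both factors. Here any finite set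
  of factorisations outside which one factor vanishes may replace it, so that convolutions of
  different sections can be summed over a common set.\<close>

lemma conv_eq:
  assumes f: "f \<in> carrier SG" and g: "g \<in> carrier SG" and \<gamma>: "\<gamma> \<in> Ar"
    and P: "finite P" "P \<subseteq> fact_pairs \<gamma>"
    and zero: "\<And>\<beta> \<rho>. \<lbrakk>(\<beta>, \<rho>) \<in> fact_pairs \<gamma>; (\<beta>, \<rho>) \<notin> P\<rbrakk> \<Longrightarrow>
      f \<beta> = \<zero>\<^bsub>F (trg G \<beta>)\<^esub> \<or> g \<rho> = \<zero>\<^bsub>F (trg G \<rho>)\<^esub>"
  shows "conv f g \<gamma> =
    finsum (F (trg G \<gamma>)) (\<lambda>(\<beta>, \<rho>). f \<beta> \<otimes>\<^bsub>F (trg G \<gamma>)\<^esub> act \<O> \<beta> (g \<rho>)) P"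
proof -
  interpret ring "F (trg G \<gamma>)" using ring_trg[OF \<gamma>] .
  define h where "h = (\<lambda>(\<beta>, \<rho>). f \<beta> \<otimes>\<^bsub>F (trg G \<gamma>)\<^esub> act \<O> \<beta> (g \<rho>))"
  have h: "h p \<in> carrier (F (trg G \<gamma>))" if "p \<in> fact_pairs \<gamma>" for p
    using that conv_term_closed(3)[OF f g] by (cases p) (simp add: h_def)
  have h0: "h p = \<zero>\<^bsub>F (trg G \<gamma>)\<^esub>" if p: "p \<in> fact_pairs \<gamma>" "p \<notin> P" for p
  proof -
    obtain \<beta> \<rho> where [simp]: "p = (\<beta>, \<rho>)" by fastforce
    note q = fact_pairsD[OF p(1)[simplified]] and c = conv_term_closed[OF f g p(1)[simplified]]
    from zero p have "f \<beta> = \<zero>\<^bsub>F (trg G \<beta>)\<^esub> \<or> g \<rho> = \<zero>\<^bsub>F (trg G \<rho>)\<^esub>" by simp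
    then show ?thesis
    proof
      assume "g \<rho> = \<zero>\<^bsub>F (trg G \<rho>)\<^esub>"
      then have "act \<O> \<beta> (g \<rho>) = \<zero>\<^bsub>F (trg G \<gamma>)\<^esub>" using act_simps(1)[OF q(2)] q(4,5) by simp
      then show ?thesis using c by (simp add: h_def)
    qed (use c q in \<open>simp add: h_def\<close>)
  qed
  have "conv f g \<gamma> = finsum (F (trg G \<gamma>)) h {p \<in> fact_pairs \<gamma>. h p \<noteq> \<zero>\<^bsub>F (trg G \<gamma>)\<^esub>}"
    using \<gamma> by (auto simp: convolution_def Let_def h_def fact_pairs_def case_prod_unfold
        intro!: arg_cong[of _ _ "finsum (F (trg G \<gamma>)) h"])
  also have "\<dots> = finsum (F (trg G \<gamma>)) h P"
  proof (rule add.finprod_mono_neutral_cong_left)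
    show "{p \<in> fact_pairs \<gamma>. h p \<noteq> \<zero>\<^bsub>F (trg G \<gamma>)\<^esub>} \<subseteq> P" using h0 by blast
    show "h \<in> P \<rightarrow> carrier (F (trg G \<gamma>))" using P(2) h by blast
    show "h p = \<zero>\<^bsub>F (trg G \<gamma>)\<^esub>" if "p \<in> P - {p \<in> fact_pairs \<gamma>. h p \<noteq> \<zero>\<^bsub>F (trg G \<gamma>)\<^esub>}" for p
      using that P(2) by blast
  qed (use P(1) in auto)
  finally show ?thesis by (simp add: h_def)
qed

lemma conv_closed:
  assumes "f \<in> carrier SG" "g \<in> carrier SG"
  shows "conv f g \<in> carrier SG"
  unfolding SG_iff
proof (rule PiE_I)
  fix \<gamma> assume g: "\<gamma> \<in> Ar"
  interpret ring "F (trg G \<gamma>)" using ring_trg[OF g] .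
  have "(case p of (\<beta>, \<rho>) \<Rightarrow> f \<beta> \<otimes>\<^bsub>F (trg G \<gamma>)\<^esub> act \<O> \<beta> (g \<rho>)) \<in> carrier (F (trg G \<gamma>))"
    if "p \<in> fact_pairs \<gamma>" for p
    using conv_term_closed(3)[OF assms] that by (cases p) simp
  then show "conv f g \<gamma> \<in> carrier (F (trg G \<gamma>))"
    using g by (auto simp: convolution_def Let_def fact_pairs_def intro!: finsum_closed)
qed (simp add: convolution_def)

text \<open>This applies whenever one factor lives on a bisection or on the identity arrows:
  cancellation then leaves a single factorisation that can contribute.\<close>

lemma conv_single:
  assumes f: "f \<in> carrier SG" and g: "g \<in> carrier SG" and c: "(\<beta>, \<rho>) \<in> composable G"
    and zero: "\<And>\<beta>' \<rho>'. \<lbrakk>(\<beta>', \<rho>') \<in> fact_pairs (gmult G \<beta> \<rho>); (\<beta>', \<rho>') \<noteq> (\<beta>, \<rho>)\<rbrakk> \<Longrightarrow>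
      f \<beta>' = \<zero>\<^bsub>F (trg G \<beta>')\<^esub> \<or> g \<rho>' = \<zero>\<^bsub>F (trg G \<rho>')\<^esub>"
  shows "conv f g (gmult G \<beta> \<rho>) = f \<beta> \<otimes>\<^bsub>F (trg G \<beta>)\<^esub> act \<O> \<beta> (g \<rho>)"
proof -
  have p: "(\<beta>, \<rho>) \<in> fact_pairs (gmult G \<beta> \<rho>)" using c by (simp add: fact_pairs_def)
  note q = fact_pairsD[OF p] and cl = conv_term_closed[OF f g p]
  interpret ring "F (trg G \<beta>)" using ring_trg[OF q(2)] .
  have "conv f g (gmult G \<beta> \<rho>) = finsum (F (trg G (gmult G \<beta> \<rho>)))
      (\<lambda>(\<beta>', \<rho>'). f \<beta>' \<otimes>\<^bsub>F (trg G (gmult G \<beta> \<rho>))\<^esub> act \<O> \<beta>' (g \<rho>')) {(\<beta>, \<rho>)}"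
    using f g q(8) p zero by (intro conv_eq) auto
  also have "\<dots> = finsum (F (trg G \<beta>)) (\<lambda>(\<beta>', \<rho>'). f \<beta>' \<otimes>\<^bsub>F (trg G \<beta>)\<^esub> act \<O> \<beta>' (g \<rho>')) {(\<beta>, \<rho>)}"
    using q(5) by simp
  also have "\<dots> = f \<beta> \<otimes>\<^bsub>F (trg G \<beta>)\<^esub> act \<O> \<beta> (g \<rho>)"
    using cl[folded q(5)] by simp
  finally show ?thesis .
qed

lemma conv_zero:
  assumes f: "f \<in> carrier SG" and g: "g \<in> carrier SG" and "\<gamma> \<in> Ar"
    and zero: "\<And>\<beta> \<rho>. (\<beta>, \<rho>) \<in> fact_pairs \<gamma> \<Longrightarrow> f \<beta> = \<zero>\<^bsub>F (trg G \<beta>)\<^esub> \<or> g \<rho> = \<zero>\<^bsub>F (trg G \<rho>)\<^esub>"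
  shows "conv f g \<gamma> = \<zero>\<^bsub>F (trg G \<gamma>)\<^esub>"
proof -
  interpret ring "F (trg G \<gamma>)" using ring_trg[OF assms(3)] .
  show ?thesis using conv_eq[OF f g assms(3), of "{}"] zero by simp
qed

text \<open>By left cancellation the first factor determines the pair, and all first factors lie in
  one range fibre.\<close>

lemma finite_fact_pairs:
  assumes "fibfin f" "\<gamma> \<in> Ar"
  shows "finite {(\<beta>, \<rho>) \<in> fact_pairs \<gamma>. f \<beta> \<noteq> \<zero>\<^bsub>F (trg G \<beta>)\<^esub>}" (is "finite ?P")
proof -
  have "inj_on fst ?P"
  proof (rule inj_onI)
    fix p q assume pq: "p \<in> ?P" "q \<in> ?P" "fst p = fst q"
    then obtain \<beta> \<rho> \<rho>' where "p = (\<beta>, \<rho>)" "q = (\<beta>, \<rho>')" "(\<beta>, \<rho>) \<in> fact_pairs \<gamma>" "(\<beta>, \<rho>') \<in> fact_pairs \<gamma>"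
      by (cases p; cases q) simp
    then show "p = q" using fact_pairsD(1,7) gmult_left_cancel[of \<beta> \<rho> \<rho>'] by simp
  qed
  moreover have "fst ` ?P \<subseteq> {\<beta> \<in> Ar. trg G \<beta> = trg G \<gamma> \<and> f \<beta> \<noteq> \<zero>\<^bsub>F (trg G \<gamma>)\<^esub>}"
  proof
    fix \<beta> assume "\<beta> \<in> fst ` ?P"
    then obtain \<rho> where "(\<beta>, \<rho>) \<in> fact_pairs \<gamma>" "f \<beta> \<noteq> \<zero>\<^bsub>F (trg G \<beta>)\<^esub>" by fastforce
    then show "\<beta> \<in> {\<beta> \<in> Ar. trg G \<beta> = trg G \<gamma> \<and> f \<beta> \<noteq> \<zero>\<^bsub>F (trg G \<gamma>)\<^esub>}"
      using fact_pairsD(2,5)[of \<beta> \<rho> \<gamma>] by simp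
  qed
  ultimately show ?thesis
    using assms(1) unfolding fibfin_def by (meson inj_on_finite)
qed

text \<open>The union of the two index sets serves all three convolutions. Finiteness is asked only
  of the left factors, so g may be an extended unit section known merely to lie in
  \<open>SG\<close>.\<close>

lemma conv_l_distr:
  assumes f: "f1 \<in> carrier SR" "f2 \<in> carrier SR" and g: "g \<in> carrier SG"
  shows "conv (f1 \<otimes>\<^bsub>SG\<^esub> f2) g = conv f1 g \<otimes>\<^bsub>SG\<^esub> conv f2 g"
proof (rule SG_eqI)
  have f': "f1 \<in> carrier SG" "f2 \<in> carrier SG" using f SR_subset by auto
  then show "conv (f1 \<otimes>\<^bsub>SG\<^esub> f2) g \<in> carrier SG" "conv f1 g \<otimes>\<^bsub>SG\<^esub> conv f2 g \<in> carrier SG"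
    using g by (auto intro: conv_closed)
  fix \<gamma> assume \<gamma>: "\<gamma> \<in> Ar"
  interpret ring "F (trg G \<gamma>)" using ring_trg[OF \<gamma>] .
  let ?P = "\<lambda>f. {(\<beta>, \<rho>) \<in> fact_pairs \<gamma>. f \<beta> \<noteq> \<zero>\<^bsub>F (trg G \<beta>)\<^esub>}"
  let ?t = "\<lambda>f (\<beta>, \<rho>). f \<beta> \<otimes>\<^bsub>F (trg G \<gamma>)\<^esub> act \<O> \<beta> (g \<rho>)"
  define P where "P = ?P f1 \<union> ?P f2"
  have P: "finite P" "P \<subseteq> fact_pairs \<gamma>"
    using finite_fact_pairs[OF SR_fibfin \<gamma>] f by (auto simp: P_def)
  have eq: "conv f g \<gamma> = finsum (F (trg G \<gamma>)) (?t f) P"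
    if "f \<in> carrier SG" "\<And>\<beta>. \<lbrakk>\<beta> \<in> Ar; f1 \<beta> = \<zero>\<^bsub>F (trg G \<beta>)\<^esub>; f2 \<beta> = \<zero>\<^bsub>F (trg G \<beta>)\<^esub>\<rbrakk> \<Longrightarrow> f \<beta> = \<zero>\<^bsub>F (trg G \<beta>)\<^esub>" for f
    using that g \<gamma> P by (intro conv_eq) (auto simp: P_def dest: fact_pairsD)
  have "conv (f1 \<otimes>\<^bsub>SG\<^esub> f2) g \<gamma> = finsum (F (trg G \<gamma>)) (?t (f1 \<otimes>\<^bsub>SG\<^esub> f2)) P"
    using f' ring_trg by (intro eq) (auto simp: SG_add ring.ring_simprules)
  also have "\<dots> = finsum (F (trg G \<gamma>)) (\<lambda>p. ?t f1 p \<oplus>\<^bsub>F (trg G \<gamma>)\<^esub> ?t f2 p) P"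
  proof (rule finsum_cong')
    fix p assume "p \<in> P"
    then obtain \<beta> \<rho> where p: "p = (\<beta>, \<rho>)" "(\<beta>, \<rho>) \<in> fact_pairs \<gamma>" using P(2) by (cases p) auto
    show "?t (f1 \<otimes>\<^bsub>SG\<^esub> f2) p = ?t f1 p \<oplus>\<^bsub>F (trg G \<gamma>)\<^esub> ?t f2 p"
      using fact_pairsD[OF p(2)] conv_term_closed[OF f'(1) g p(2)] conv_term_closed[OF f'(2) g p(2)]
      by (simp add: p(1) SG_add l_distr)
  qed (use P conv_term_closed[OF f'(1) g] conv_term_closed[OF f'(2) g] in \<open>auto simp: subset_iff\<close>)
  also have "\<dots> = finsum (F (trg G \<gamma>)) (?t f1) P \<oplus>\<^bsub>F (trg G \<gamma>)\<^esub> finsum (F (trg G \<gamma>)) (?t f2) P"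
    using P conv_term_closed[OF f'(1) g] conv_term_closed[OF f'(2) g]
    by (intro finsum_addf) (auto simp: subset_iff)
  also have "\<dots> = conv f1 g \<gamma> \<oplus>\<^bsub>F (trg G \<gamma>)\<^esub> conv f2 g \<gamma>"
    using f' by (simp add: eq)
  finally show "conv (f1 \<otimes>\<^bsub>SG\<^esub> f2) g \<gamma> = (conv f1 g \<otimes>\<^bsub>SG\<^esub> conv f2 g) \<gamma>"
    using \<gamma> by (simp add: SG_add)
qed

lemma conv_r_distr:
  assumes f: "f \<in> carrier SR" and g: "g1 \<in> carrier SG" "g2 \<in> carrier SG"
  shows "conv f (g1 \<otimes>\<^bsub>SG\<^esub> g2) = conv f g1 \<otimes>\<^bsub>SG\<^esub> conv f g2"
proof (rule SG_eqI)
  have f': "f \<in> carrier SG" using f SR_subset by auto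
  then show "conv f (g1 \<otimes>\<^bsub>SG\<^esub> g2) \<in> carrier SG" "conv f g1 \<otimes>\<^bsub>SG\<^esub> conv f g2 \<in> carrier SG"
    using g by (auto intro: conv_closed)
  fix \<gamma> assume \<gamma>: "\<gamma> \<in> Ar"
  interpret ring "F (trg G \<gamma>)" using ring_trg[OF \<gamma>] .
  let ?t = "\<lambda>g (\<beta>, \<rho>). f \<beta> \<otimes>\<^bsub>F (trg G \<gamma>)\<^esub> act \<O> \<beta> (g \<rho>)"
  define P where "P = {(\<beta>, \<rho>) \<in> fact_pairs \<gamma>. f \<beta> \<noteq> \<zero>\<^bsub>F (trg G \<beta>)\<^esub>}"
  have P: "finite P" "P \<subseteq> fact_pairs \<gamma>"
    using finite_fact_pairs[OF SR_fibfin \<gamma>] f by (auto simp: P_def)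
  have eq: "conv f g \<gamma> = finsum (F (trg G \<gamma>)) (?t g) P" if "g \<in> carrier SG" for g
    using that f' \<gamma> P by (intro conv_eq) (auto simp: P_def)
  have "conv f (g1 \<otimes>\<^bsub>SG\<^esub> g2) \<gamma> = finsum (F (trg G \<gamma>)) (?t (g1 \<otimes>\<^bsub>SG\<^esub> g2)) P"
    using g by (intro eq) auto
  also have "\<dots> = finsum (F (trg G \<gamma>)) (\<lambda>p. ?t g1 p \<oplus>\<^bsub>F (trg G \<gamma>)\<^esub> ?t g2 p) P"
  proof (rule finsum_cong')
    fix p assume "p \<in> P"
    then obtain \<beta> \<rho> where p: "p = (\<beta>, \<rho>)" "(\<beta>, \<rho>) \<in> fact_pairs \<gamma>" using P(2) by (cases p) auto
    note q = fact_pairsD[OF p(2)]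
    have "act \<O> \<beta> ((g1 \<otimes>\<^bsub>SG\<^esub> g2) \<rho>) = act \<O> \<beta> (g1 \<rho>) \<oplus>\<^bsub>F (trg G \<gamma>)\<^esub> act \<O> \<beta> (g2 \<rho>)"
      using act_simps(3)[OF q(2), of "g1 \<rho>" "g2 \<rho>"] SG_closed[OF g(1) q(3)] SG_closed[OF g(2) q(3)] q
      by (simp add: SG_add)
    then show "?t (g1 \<otimes>\<^bsub>SG\<^esub> g2) p = ?t g1 p \<oplus>\<^bsub>F (trg G \<gamma>)\<^esub> ?t g2 p"
      using conv_term_closed[OF f' g(1) p(2)] conv_term_closed[OF f' g(2) p(2)]
      by (simp add: p(1) r_distr)
  qed (use P conv_term_closed[OF f' g(1)] conv_term_closed[OF f' g(2)] in \<open>auto simp: subset_iff\<close>)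
  also have "\<dots> = finsum (F (trg G \<gamma>)) (?t g1) P \<oplus>\<^bsub>F (trg G \<gamma>)\<^esub> finsum (F (trg G \<gamma>)) (?t g2) P"
    using P conv_term_closed[OF f' g(1)] conv_term_closed[OF f' g(2)]
    by (intro finsum_addf) (auto simp: subset_iff)
  also have "\<dots> = conv f g1 \<gamma> \<oplus>\<^bsub>F (trg G \<gamma>)\<^esub> conv f g2 \<gamma>"
    using g by (simp add: eq)
  finally show "conv f (g1 \<otimes>\<^bsub>SG\<^esub> g2) \<gamma> = (conv f g1 \<otimes>\<^bsub>SG\<^esub> conv f g2) \<gamma>"
    using \<gamma> by (simp add: SG_add)
qed

lemma act_germ_closed:
  assumes "x \<in> D (star s)" "a \<in> carrier (F x)"
  shows "act \<O> (germ D s x) a \<in> carrier (F (\<theta> s x))"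
  using act_closed[of "germ D s x" a] assms by simp

text \<open>The product of two bisections is again a bisection, given by germs of
  \<open>s * t\<close> over those sources in L that t moves into K. Each of its arrows has exactly
  one factorisation with factors in the two bisections.\<close>

lemma bs_mult:
  fixes s t K L \<phi> \<psi>
  defines "M \<equiv> {x \<in> L. \<theta> t x \<in> K}"
    and "\<eta> \<equiv> (\<lambda>x. \<phi> (\<theta> t x) \<otimes>\<^bsub>F (\<theta> s (\<theta> t x))\<^esub> act \<O> (germ D s (\<theta> t x)) (\<psi> x))"
  assumes b: "basic s K \<phi>" and c: "basic t L \<psi>"
  shows "basic (s * t) M \<eta>" "conv (bs s K \<phi>) (bs t L \<psi>) = bs (s * t) M \<eta>"
proof -
  note K = basicD[OF b] and L = basicD[OF c]
  have M: "x \<in> L" "\<theta> t x \<in> K" "x \<in> D (star t)" "\<theta> t x \<in> D (star s)" "x \<in> D (star (s * t))"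
    "\<theta> (s * t) x = \<theta> s (\<theta> t x)" if "x \<in> M" for x
    using that K(3) L(3) by (auto simp: M_def D_mult theta_mult)
  have Msub: "M \<subseteq> L" "M \<subseteq> D (star t)" "M \<subseteq> topspace X"
    using L(2) kopen_subset[OF L(1)] by (auto simp: M_def)
  have cont: "continuous_map (subtopology X M) X (\<theta> t)" using theta_continuous_on Msub(2) .
  have c1: "cont_sec (\<lambda>x. \<theta> s (\<theta> t x)) M (\<lambda>x. \<phi> (\<theta> t x))"
    using M Msub by (intro cont_sec_compose[OF K(4) cont]) auto
  have "continuous_map (subtopology X M) (Arr G) (\<lambda>x. germ D s (\<theta> t x))"
    using continuous_map_compose[OF continuous_map_into_subtopology[OF cont] germ_continuous[of s]] M(4)
    by (auto simp: o_def)
  then have "cont_sec (\<lambda>x. trg G (germ D s (\<theta> t x))) M (\<lambda>x. act \<O> (germ D s (\<theta> t x)) (\<psi> x))"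
    using M(4) by (intro cont_sec_act[OF cont_sec_mono[OF L(4) Msub(1)]]) auto
  then have "cont_sec (\<lambda>x. \<theta> s (\<theta> t x)) M (\<lambda>x. act \<O> (germ D s (\<theta> t x)) (\<psi> x))"
    by (rule cont_sec_cong) (simp_all add: M(4))
  from cont_sec_mult[OF c1 this]
  have "cont_sec (\<theta> (s * t)) M \<eta>"
    by (rule cont_sec_cong) (simp_all add: \<eta>_def M(6))
  moreover have "kopen M" unfolding M_def using kopen_theta_vimage[OF K(1) L(1,2)] .
  ultimately show st: "basic (s * t) M \<eta>" using M(5) by (auto simp: basic_def)
  have S: "bs s K \<phi> \<in> carrier SG" "bs t L \<psi> \<in> carrier SG" using bs_closed b c by auto
  show "conv (bs s K \<phi>) (bs t L \<psi>) = bs (s * t) M \<eta>"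
  proof (rule bs_eqI[OF conv_closed[OF S] st])
    fix x assume x: "x \<in> M"
    note x' = M[OF x]
    let ?\<beta> = "germ D s (\<theta> t x)" and ?\<rho> = "germ D t x"
    have cp: "(?\<beta>, ?\<rho>) \<in> composable G" using composable_germ x'(3,4) .
    have "conv (bs s K \<phi>) (bs t L \<psi>) (gmult G ?\<beta> ?\<rho>) =
        bs s K \<phi> ?\<beta> \<otimes>\<^bsub>F (trg G ?\<beta>)\<^esub> act \<O> ?\<beta> (bs t L \<psi> ?\<rho>)"
    proof (rule conv_single[OF S cp])
      fix \<beta> \<rho> assume p: "(\<beta>, \<rho>) \<in> fact_pairs (gmult G ?\<beta> ?\<rho>)" "(\<beta>, \<rho>) \<noteq> (?\<beta>, ?\<rho>)"
      note q = fact_pairsD[OF p(1)]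
      have src: "src G \<rho> = x" using q(6) x'(3-5) by simp
      \<comment> \<open>The second bisection has only one arrow over x, and cancellation then fixes
        the first factor as well.\<close>
      have "\<rho> \<notin> germ D t ` L"
      proof
        assume "\<rho> \<in> germ D t ` L"
        then have "\<rho> = ?\<rho>" using src L(3) by auto
        moreover from this have "\<beta> = ?\<beta>" using gmult_right_cancel q(1,7) cp by blast
        ultimately show False using p(2) by simp
      qed
      then show "bs s K \<phi> \<beta> = \<zero>\<^bsub>F (trg G \<beta>)\<^esub> \<or> bs t L \<psi> \<rho> = \<zero>\<^bsub>F (trg G \<rho>)\<^esub>"
        using bs_outside q(3) by blast
    qed
    then show "conv (bs s K \<phi>) (bs t L \<psi>) (germ D (s * t) x) = \<eta> x"
      using x' K(2) L(2) by (simp add: bs_germ \<eta>_def)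
  next
    fix \<gamma> assume g: "\<gamma> \<in> Ar" "\<gamma> \<notin> germ D (s * t) ` M"
    show "conv (bs s K \<phi>) (bs t L \<psi>) \<gamma> = \<zero>\<^bsub>F (trg G \<gamma>)\<^esub>"
    proof (rule conv_zero[OF S g(1)])
      fix \<beta> \<rho> assume p: "(\<beta>, \<rho>) \<in> fact_pairs \<gamma>"
      note q = fact_pairsD[OF p]
      have "\<not> (\<beta> \<in> germ D s ` K \<and> \<rho> \<in> germ D t ` L)"
      proof
        assume "\<beta> \<in> germ D s ` K \<and> \<rho> \<in> germ D t ` L"
        then obtain y x where *: "y \<in> K" "\<beta> = germ D s y" "x \<in> L" "\<rho> = germ D t x" by blast
        then have "y = \<theta> t x" using q(4) K(3) L(3) by simp
        then show False using * g(2) q(7) K(3) L(3) by (auto simp: M_def)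
      qed
      then show "bs s K \<phi> \<beta> = \<zero>\<^bsub>F (trg G \<beta>)\<^esub> \<or> bs t L \<psi> \<rho> = \<zero>\<^bsub>F (trg G \<rho>)\<^esub>"
        using bs_outside q(2,3) by blast
    qed
  qed
qed

lemma conv_null:
  assumes "f \<in> carrier SG"
  shows "conv f \<one>\<^bsub>SG\<^esub> = \<one>\<^bsub>SG\<^esub>" "conv \<one>\<^bsub>SG\<^esub> f = \<one>\<^bsub>SG\<^esub>"
proof -
  show "conv f \<one>\<^bsub>SG\<^esub> = \<one>\<^bsub>SG\<^esub>"
  proof (rule SG_eqI[OF conv_closed[OF assms SG.one_closed] SG.one_closed])
    fix \<gamma> assume "\<gamma> \<in> Ar"
    then show "conv f \<one>\<^bsub>SG\<^esub> \<gamma> = \<one>\<^bsub>SG\<^esub> \<gamma>"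
      using conv_zero[OF assms SG.one_closed] SG_zero fact_pairsD(3) by simp
  qed
  show "conv \<one>\<^bsub>SG\<^esub> f = \<one>\<^bsub>SG\<^esub>"
  proof (rule SG_eqI[OF conv_closed[OF SG.one_closed assms] SG.one_closed])
    fix \<gamma> assume "\<gamma> \<in> Ar"
    then show "conv \<one>\<^bsub>SG\<^esub> f \<gamma> = \<one>\<^bsub>SG\<^esub> \<gamma>"
      using conv_zero[OF SG.one_closed assms] SG_zero fact_pairsD(2) by simp
  qed
qed

text \<open>By \<open>bs_mult\<close> both sides are basic for the same semigroup element over the
  same set of sources. The coefficients agree because germs act by ring homomorphisms and compatibly
  with composition.\<close>

lemma bs_assoc:
  assumes b: "basic s K \<phi>" and c: "basic t L \<psi>" and d: "basic u M \<xi>"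
  shows "conv (conv (bs s K \<phi>) (bs t L \<psi>)) (bs u M \<xi>) = conv (bs s K \<phi>) (conv (bs t L \<psi>) (bs u M \<xi>))"
proof -
  note K = basicD[OF b] and L = basicD[OF c] and M = basicD[OF d]
  let ?N = "{x \<in> M. \<theta> u x \<in> {y \<in> L. \<theta> t y \<in> K}}"
  have N: "{x \<in> {x \<in> M. \<theta> u x \<in> L}. \<theta> (t * u) x \<in> K} = ?N"
    using M(3) L(3) by (auto simp: theta_mult)
  show ?thesis
    unfolding bs_mult(2)[OF b c] bs_mult(2)[OF c d]
      bs_mult(2)[OF bs_mult(1)[OF b c] d] bs_mult(2)[OF b bs_mult(1)[OF c d]] N mult.assoc
  proof (rule bs_cong)
    show "?N \<subseteq> D (star (s * (t * u)))"
      using K(3) L(3) M(3) by (auto simp: D_mult theta_mult)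
    fix x assume x: "x \<in> ?N"
    define y z where "y = \<theta> u x" and "z = \<theta> t y"
    have d': "x \<in> D (star u)" "y \<in> D (star t)" "z \<in> D (star s)" "\<theta> u x = y" "\<theta> t y = z" "\<theta> (t * u) x = z"
      "\<theta> (s * t) y = \<theta> s z"
      using x K(3) L(3) M(3) by (auto simp: y_def z_def theta_mult)
    have c': "\<phi> z \<in> carrier (F (\<theta> s z))" "\<psi> y \<in> carrier (F z)" "\<xi> x \<in> carrier (F y)"
      using x K(5)[of z] L(5)[of y] M(5)[of x] by (auto simp: y_def z_def)
    have \<xi>E: "\<xi> x \<in> topspace E" "proj \<O> (\<xi> x) = y"
      using cont_secD(6,7)[OF M(4), of x] x by (auto simp: y_def)
    interpret ring "F (\<theta> s z)" using ring_F K(6)[of z] x by (simp add: y_def z_def)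
    have "act \<O> (germ D (s * t) y) (\<xi> x) = act \<O> (germ D s z) (act \<O> (germ D t y) (\<xi> x))"
      using act_act[of "germ D s z" "germ D t y" "\<xi> x"] composable_germ[of y t s] gmult_germ[of y t s] d' \<xi>E by simp
    moreover have "act \<O> (germ D s z) (\<psi> y \<otimes>\<^bsub>F z\<^esub> act \<O> (germ D t y) (\<xi> x)) =
      act \<O> (germ D s z) (\<psi> y) \<otimes>\<^bsub>F (\<theta> s z)\<^esub> act \<O> (germ D s z) (act \<O> (germ D t y) (\<xi> x))"
      using act_simps(4)[of "germ D s z" "\<psi> y" "act \<O> (germ D t y) (\<xi> x)"] d' c' act_germ_closed[of y t] by simp
    moreover have "act \<O> (germ D s z) (act \<O> (germ D t y) (\<xi> x)) \<in> carrier (F (\<theta> s z))"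
      "act \<O> (germ D s z) (\<psi> y) \<in> carrier (F (\<theta> s z))"
      using d' c' act_germ_closed[of y t "\<xi> x"] act_germ_closed[of z s] by simp_all
    ultimately show "\<phi> (\<theta> t (\<theta> u x)) \<otimes>\<^bsub>F (\<theta> s (\<theta> t (\<theta> u x)))\<^esub> act \<O> (germ D s (\<theta> t (\<theta> u x))) (\<psi> (\<theta> u x))
        \<otimes>\<^bsub>F (\<theta> (s * t) (\<theta> u x))\<^esub> act \<O> (germ D (s * t) (\<theta> u x)) (\<xi> x)
      = \<phi> (\<theta> (t * u) x) \<otimes>\<^bsub>F (\<theta> s (\<theta> (t * u) x))\<^esub> act \<O> (germ D s (\<theta> (t * u) x))
        (\<psi> (\<theta> u x) \<otimes>\<^bsub>F (\<theta> t (\<theta> u x))\<^esub> act \<O> (germ D t (\<theta> u x)) (\<xi> x))"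
      using c' by (simp add: d' m_assoc)
  qed
qed

lemma SR_add_closed: "f \<in> carrier SR \<Longrightarrow> g \<in> carrier SR \<Longrightarrow> f \<otimes>\<^bsub>SG\<^esub> g \<in> carrier SR"
  by (simp add: carrier_SR generate.eng)

lemma SR_zero_closed: "\<one>\<^bsub>SG\<^esub> \<in> carrier SR"
  by (simp add: carrier_SR generate.one)

lemma SR_SG: "f \<in> carrier SR \<Longrightarrow> f \<in> carrier SG"
  using SR_subset by auto

lemma bs_SR: "basic s K \<phi> \<Longrightarrow> bs s K \<phi> \<in> carrier SR"
  using Basics_SR by (auto simp: Basics_def)

lemma SR_mult_closed:
  assumes f: "f \<in> carrier SR" and g: "g \<in> carrier SR"
  shows "conv f g \<in> carrier SR"
  using f
proof (induction rule: SR_induct)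
  case zero
  show ?case using g by (simp add: conv_null SR_SG SR_zero_closed)
next
  case (basic s K \<phi>)
  show ?case
    using g
  proof (induction rule: SR_induct)
    case zero
    show ?case using bs_closed[OF basic] by (simp add: conv_null SR_zero_closed)
  next
    case (basic t L \<psi>)
    then show ?case using bs_mult[OF \<open>basic s K \<phi>\<close> basic] bs_SR by simp
  next
    case (add g h)
    then show ?case using conv_r_distr[OF bs_SR[OF basic]] by (simp add: SR_SG SR_add_closed)
  qed
next
  case (add f h)
  then show ?case using conv_l_distr g by (simp add: SR_SG SR_add_closed)
qed

text \<open>Additivity reduces the claim to basic sections, one argument after another starting with
  the last; no double sum over factorisations has to be rearranged.\<close>

lemma SR_mult_assoc:
  assumes f: "f \<in> carrier SR" and g: "g \<in> carrier SR" and h: "h \<in> carrier SR"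
  shows "conv (conv f g) h = conv f (conv g h)"
proof -
  have 1: "conv (conv f g) h = conv f (conv g h)"
    if f: "basic s K \<phi>" "f = bs s K \<phi>" and g: "basic t L \<psi>" "g = bs t L \<psi>" and h: "h \<in> carrier SR"
    for s K \<phi> f t L \<psi> g h
    using h
  proof (induction rule: SR_induct)
    case zero
    show ?case using f g by (simp add: conv_null bs_closed conv_closed)
  next
    case (basic u M \<xi>)
    then show ?case using bs_assoc f g by simp
  next
    case (add h1 h2)
    then show ?case
      using f g by (simp add: conv_r_distr SR_mult_closed SR_SG bs_SR)
  qed
  have 2: "conv (conv f g) h = conv f (conv g h)"
    if f: "basic s K \<phi>" "f = bs s K \<phi>" and g: "g \<in> carrier SR" for s K \<phi> f g
    using g
  proof (induction rule: SR_induct)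
    case zero
    show ?case using f h by (simp add: conv_null bs_closed SR_SG)
  next
    case (basic t L \<psi>)
    then show ?case using 1 f h by blast
  next
    case (add g1 g2)
    then show ?case
      using f h by (simp add: conv_r_distr conv_l_distr SR_mult_closed SR_SG bs_SR)
  qed
  show ?thesis
    using f
  proof (induction rule: SR_induct)
    case zero
    show ?case using g h by (simp add: conv_null SR_SG conv_closed)
  next
    case (basic s K \<phi>)
    then show ?case using 2 g by blast
  next
    case (add f1 f2)
    then show ?case
      using g h by (simp add: conv_l_distr SR_mult_closed SR_SG)
  qed
qed

lemma nonunital_ring_SR: "nonunital_ring SR"
proof -
  have "abelian_group SR"
  proof (rule abelian_groupI)
    fix f assume "f \<in> carrier SR"
    moreover from this have "inv\<^bsub>SG\<^esub> f \<in> carrier SR"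
      using subgroup.m_inv_closed[OF SG.generate_is_subgroup[OF Basics_subset]] by (simp add: carrier_SR)
    ultimately show "\<exists>g \<in> carrier SR. g \<oplus>\<^bsub>SR\<^esub> f = \<zero>\<^bsub>SR\<^esub>"
      by (intro bexI[of _ "inv\<^bsub>SG\<^esub> f"]) (simp_all add: SR_SG)
  qed (simp_all add: SR_add_closed SR_zero_closed SR_SG SG.m_ac)
  then show ?thesis
    by (intro nonunital_ring.intro nonunital_ring_axioms.intro)
      (simp_all add: SR_mult_closed SR_mult_assoc conv_l_distr conv_r_distr SR_SG)
qed

sublocale SR: nonunital_ring SR
  by (rule nonunital_ring_SR)

subsection \<open>The diagonal\<close>

abbreviation "ext \<equiv> extend_by_zero G \<O>"

lemma unit_sectionD:
  assumes "\<alpha> \<in> unit_space_sections G \<O>"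
  shows "cont_sec (\<lambda>x. x) (topspace X) \<alpha>" "x \<in> topspace X \<Longrightarrow> \<alpha> x \<in> carrier (F x)"
  using assms by (auto simp: unit_space_sections_def cont_sec_def)

lemma ext_closed:
  assumes "\<alpha> \<in> unit_space_sections G \<O>"
  shows "ext \<alpha> \<in> carrier SG"
  unfolding SG_iff
proof (rule PiE_I)
  fix \<gamma> assume g: "\<gamma> \<in> Ar"
  show "ext \<alpha> \<gamma> \<in> carrier (F (trg G \<gamma>))"
  proof (cases "\<gamma> = ident G (src G \<gamma>)")
    case True
    then have "trg G \<gamma> = src G \<gamma>" using ident(3) src_trg_in(1)[OF g] by metis
    then show ?thesis
      using True g unit_sectionD(2)[OF assms] src_trg_in(1)[OF g] by (simp add: extend_by_zero_def)
  next
    case False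
    then show ?thesis using g ring_trg[OF g] by (simp add: extend_by_zero_def ring.ring_simprules)
  qed
qed (simp add: extend_by_zero_def)

lemma ext_ident: "x \<in> topspace X \<Longrightarrow> ext \<alpha> (ident G x) = \<alpha> x"
  by (simp add: extend_by_zero_def)

lemma ext_off: "\<gamma> \<in> Ar \<Longrightarrow> \<gamma> \<noteq> ident G (src G \<gamma>) \<Longrightarrow> ext \<alpha> \<gamma> = \<zero>\<^bsub>F (trg G \<gamma>)\<^esub>"
  by (simp add: extend_by_zero_def)

lemma act_ident_stalk: "x \<in> topspace X \<Longrightarrow> a \<in> carrier (F x) \<Longrightarrow> act \<O> (ident G x) a = a"
  using act_ident[of a] carrier_F[of x] by auto

lemma conv_ext_left:
  assumes a: "\<alpha> \<in> unit_space_sections G \<O>" and f: "f \<in> carrier SG" and g: "\<gamma> \<in> Ar"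
  shows "conv (ext \<alpha>) f \<gamma> = \<alpha> (trg G \<gamma>) \<otimes>\<^bsub>F (trg G \<gamma>)\<^esub> f \<gamma>"
proof -
  note z = src_trg_in(2)[OF g] and i = gmult_ident(1,2)[OF g]
  have "conv (ext \<alpha>) f (gmult G (ident G (trg G \<gamma>)) \<gamma>) =
      ext \<alpha> (ident G (trg G \<gamma>)) \<otimes>\<^bsub>F (trg G (ident G (trg G \<gamma>)))\<^esub> act \<O> (ident G (trg G \<gamma>)) (f \<gamma>)"
  proof (rule conv_single[OF ext_closed[OF a] f i(1)])
    fix \<beta> \<rho> assume p: "(\<beta>, \<rho>) \<in> fact_pairs (gmult G (ident G (trg G \<gamma>)) \<gamma>)" "(\<beta>, \<rho>) \<noteq> (ident G (trg G \<gamma>), \<gamma>)"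
    note q = fact_pairsD[OF p(1), unfolded i(2)]
    have "\<beta> \<noteq> ident G (src G \<beta>)"
    proof
      assume "\<beta> = ident G (src G \<beta>)"
      moreover from this have "src G \<beta> = trg G \<beta>" using ident(3) src_trg_in(1)[OF q(2)] by metis
      ultimately have "\<beta> = ident G (trg G \<gamma>)" using q(5) by simp
      then show False using p(2) q(1,7) i gmult_left_cancel by blast
    qed
    then show "ext \<alpha> \<beta> = \<zero>\<^bsub>F (trg G \<beta>)\<^esub> \<or> f \<rho> = \<zero>\<^bsub>F (trg G \<rho>)\<^esub>" using ext_off q(2) by blast
  qed
  then show ?thesis using i(2) z SG_closed[OF f g] by (simp add: ext_ident act_ident_stalk)
qed

lemma conv_ext_right:
  assumes a: "\<alpha> \<in> unit_space_sections G \<O>" and f: "f \<in> carrier SG" and g: "\<gamma> \<in> Ar"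
  shows "conv f (ext \<alpha>) \<gamma> = f \<gamma> \<otimes>\<^bsub>F (trg G \<gamma>)\<^esub> act \<O> \<gamma> (\<alpha> (src G \<gamma>))"
proof -
  note z = src_trg_in(1)[OF g] and i = gmult_ident(3,4)[OF g]
  have "conv f (ext \<alpha>) (gmult G \<gamma> (ident G (src G \<gamma>))) =
      f \<gamma> \<otimes>\<^bsub>F (trg G \<gamma>)\<^esub> act \<O> \<gamma> (ext \<alpha> (ident G (src G \<gamma>)))"
  proof (rule conv_single[OF f ext_closed[OF a] i(1)])
    fix \<beta> \<rho> assume p: "(\<beta>, \<rho>) \<in> fact_pairs (gmult G \<gamma> (ident G (src G \<gamma>)))" "(\<beta>, \<rho>) \<noteq> (\<gamma>, ident G (src G \<gamma>))"
    note q = fact_pairsD[OF p(1), unfolded i(2)]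
    have "\<rho> \<noteq> ident G (src G \<rho>)"
    proof
      assume "\<rho> = ident G (src G \<rho>)"
      then have "\<rho> = ident G (src G \<gamma>)" using q(6) by simp
      then show False using p(2) q(1,7) i gmult_right_cancel by blast
    qed
    then show "f \<beta> = \<zero>\<^bsub>F (trg G \<beta>)\<^esub> \<or> ext \<alpha> \<rho> = \<zero>\<^bsub>F (trg G \<rho>)\<^esub>" using ext_off q(3) by blast
  qed
  then show ?thesis using i(2) z by (simp add: ext_ident)
qed

text \<open>The outer restriction makes the function extensional, as
  \<open>unit_space_sections\<close> requires; the inner case is extension by zero from K.\<close>

definition usec :: "'x set \<Rightarrow> ('x \<Rightarrow> 'e) \<Rightarrow> 'x \<Rightarrow> 'e" where
  "usec K \<phi> = (\<lambda>x \<in> topspace X. if x \<in> K then \<phi> x else \<zero>\<^bsub>F x\<^esub>)"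

lemma usec_apply: "x \<in> topspace X \<Longrightarrow> usec K \<phi> x = (if x \<in> K then \<phi> x else \<zero>\<^bsub>F x\<^esub>)"
  by (simp add: usec_def)

lemma usec_unit_section:
  assumes "cont_sec (\<lambda>x. x) K \<phi>" "kopen K"
  shows "usec K \<phi> \<in> unit_space_sections G \<O>"
proof -
  have c: "cont_sec (\<lambda>x. x) (topspace X) (usec K \<phi>)"
    using cont_sec_extend_by_zero[OF assms] by (rule cont_sec_cong) (simp_all add: usec_apply)
  have "{x \<in> topspace X. usec K \<phi> x \<noteq> \<zero>\<^bsub>F x\<^esub>} \<subseteq> K" by (auto simp: usec_apply split: if_splits)
  then have "X closure_of {x \<in> topspace X. usec K \<phi> x \<noteq> \<zero>\<^bsub>F x\<^esub>} \<subseteq> K"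
    using kopen_closedin[OF assms(2)] by (rule closure_of_minimal)
  then have "compactin X (X closure_of {x \<in> topspace X. usec K \<phi> x \<noteq> \<zero>\<^bsub>F x\<^esub>})"
    using assms(2) closed_compactin[OF _ _ closedin_closure_of] unfolding kopen_def by blast
  then show ?thesis
    using cont_secD(4,5)[OF c] by (auto simp: unit_space_sections_def usec_def)
qed

lemma usec_one: "kopen K \<Longrightarrow> usec K (\<lambda>x. \<one>\<^bsub>F x\<^esub>) \<in> unit_space_sections G \<O>"
  using usec_unit_section cont_sec_mono[OF cont_sec_one kopen_subset] by blast

section \<open>Twists by diagonal sections\<close>

definition twist :: "('x \<Rightarrow> 'e) \<Rightarrow> ('x \<Rightarrow> 'e) \<Rightarrow> (('s \<times> 'x) set \<Rightarrow> 'e) \<Rightarrow> ('s \<times> 'x) set \<Rightarrow> 'e" where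
  "twist \<alpha> \<beta> f = conv (ext \<alpha>) f \<otimes>\<^bsub>SG\<^esub> conv f (ext \<beta>)"

lemma twist_closed:
  assumes "\<alpha> \<in> unit_space_sections G \<O>" "\<beta> \<in> unit_space_sections G \<O>" "f \<in> carrier SG"
  shows "twist \<alpha> \<beta> f \<in> carrier SG"
  using assms by (simp add: twist_def conv_closed ext_closed)

text \<open>The stalk is commutative, so the factor on the left and the transported factor on the
  right combine into one scalar that depends on the arrow but not on f.\<close>

lemma twist_apply:
  assumes "\<alpha> \<in> unit_space_sections G \<O>" "\<beta> \<in> unit_space_sections G \<O>" "f \<in> carrier SG" "\<gamma> \<in> Ar"
  shows "twist \<alpha> \<beta> f \<gamma> =
    f \<gamma> \<otimes>\<^bsub>F (trg G \<gamma>)\<^esub> (\<alpha> (trg G \<gamma>) \<oplus>\<^bsub>F (trg G \<gamma>)\<^esub> act \<O> \<gamma> (\<beta> (src G \<gamma>)))"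
proof -
  interpret field "F (trg G \<gamma>)" using field_F src_trg_in(2)[OF assms(4)] .
  have "f \<gamma> \<in> carrier (F (trg G \<gamma>))" "\<alpha> (trg G \<gamma>) \<in> carrier (F (trg G \<gamma>))"
    "act \<O> \<gamma> (\<beta> (src G \<gamma>)) \<in> carrier (F (trg G \<gamma>))"
    using SG_closed[OF assms(3,4)] unit_sectionD(2)[OF assms(1)] unit_sectionD(2)[OF assms(2)]
      src_trg_in[OF assms(4)] act_closed[OF assms(4)] by auto
  then show ?thesis
    using assms by (simp add: twist_def SG_add conv_ext_left conv_ext_right r_distr m_comm)
qed

text \<open>Only the coefficient is rescaled and the bisection stays, so a twist never increases the
  number of summands of a sum.\<close>

lemma twist_basic:
  assumes a: "\<alpha> \<in> unit_space_sections G \<O>" "\<beta> \<in> unit_space_sections G \<O>" and b: "basic s K \<phi>"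
  shows "twist \<alpha> \<beta> (bs s K \<phi>) \<in> Basics"
proof -
  note K = basicD[OF b]
  have KX: "K \<subseteq> topspace X" using kopen_subset[OF K(1)] .
  let ?\<psi> = "\<lambda>x. \<phi> x \<otimes>\<^bsub>F (\<theta> s x)\<^esub> (\<alpha> (\<theta> s x) \<oplus>\<^bsub>F (\<theta> s x)\<^esub> act \<O> (germ D s x) (\<beta> x))"
  have "cont_sec (\<theta> s) K (\<lambda>x. \<alpha> (\<theta> s x))"
    using K(6) KX by (intro cont_sec_compose[OF unit_sectionD(1)[OF a(1)] theta_continuous_on[OF K(2)]]) auto
  moreover have "cont_sec (\<lambda>x. trg G (germ D s x)) K (\<lambda>x. act \<O> (germ D s x) (\<beta> x))"
    using K(3) cont_sec_mono[OF unit_sectionD(1)[OF a(2)] KX]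
    by (intro cont_sec_act[of "\<lambda>x. x"] continuous_map_from_subtopology_mono[OF germ_continuous K(2)]) auto
  then have "cont_sec (\<theta> s) K (\<lambda>x. act \<O> (germ D s x) (\<beta> x))"
    by (rule cont_sec_cong) (simp_all add: K(3))
  ultimately have "basic s K ?\<psi>"
    using K by (auto simp: basic_def intro: cont_sec_mult cont_sec_add)
  moreover have "twist \<alpha> \<beta> (bs s K \<phi>) = bs s K ?\<psi>"
  proof (rule bs_eqI[OF twist_closed[OF a bs_closed[OF b]] calculation])
    fix x assume x: "x \<in> K"
    then show "twist \<alpha> \<beta> (bs s K \<phi>) (germ D s x) = ?\<psi> x"
      using twist_apply[OF a bs_closed[OF b], of "germ D s x"] K(3)[OF x] K(2) by (simp add: bs_germ)
  next
    fix \<gamma> assume g: "\<gamma> \<in> Ar" "\<gamma> \<notin> germ D s ` K"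
    interpret ring "F (trg G \<gamma>)" using ring_trg[OF g(1)] .
    have "\<alpha> (trg G \<gamma>) \<oplus>\<^bsub>F (trg G \<gamma>)\<^esub> act \<O> \<gamma> (\<beta> (src G \<gamma>)) \<in> carrier (F (trg G \<gamma>))"
      using unit_sectionD(2)[OF a(1)] unit_sectionD(2)[OF a(2)] src_trg_in[OF g(1)] act_closed[OF g(1)]
      by auto
    then show "twist \<alpha> \<beta> (bs s K \<phi>) \<gamma> = \<zero>\<^bsub>F (trg G \<gamma>)\<^esub>"
      using twist_apply[OF a bs_closed[OF b] g(1)] g by (simp add: bs_outside)
  qed
  ultimately show ?thesis unfolding Basics_def by blast
qed

lemma twist_eq_zero:
  assumes a: "\<alpha> \<in> unit_space_sections G \<O>" "\<beta> \<in> unit_space_sections G \<O>" and b: "basic s K \<phi>"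
    and kill: "\<And>w. w \<in> K \<Longrightarrow> \<alpha> (\<theta> s w) \<oplus>\<^bsub>F (\<theta> s w)\<^esub> act \<O> (germ D s w) (\<beta> w) = \<zero>\<^bsub>F (\<theta> s w)\<^esub>"
  shows "twist \<alpha> \<beta> (bs s K \<phi>) = \<one>\<^bsub>SG\<^esub>"
proof (rule SG_eqI[OF twist_closed[OF a bs_closed[OF b]] SG.one_closed])
  fix \<gamma> assume g: "\<gamma> \<in> Ar"
  interpret ring "F (trg G \<gamma>)" using ring_trg[OF g] .
  have c: "\<alpha> (trg G \<gamma>) \<oplus>\<^bsub>F (trg G \<gamma>)\<^esub> act \<O> \<gamma> (\<beta> (src G \<gamma>)) \<in> carrier (F (trg G \<gamma>))"
    using unit_sectionD(2)[OF a(1)] unit_sectionD(2)[OF a(2)] src_trg_in[OF g] act_closed[OF g] by auto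
  have "twist \<alpha> \<beta> (bs s K \<phi>) \<gamma> = \<zero>\<^bsub>F (trg G \<gamma>)\<^esub>"
  proof (cases "\<gamma> \<in> germ D s ` K")
    case True
    then obtain w where w: "w \<in> K" "\<gamma> = germ D s w" by blast
    then have "\<alpha> (trg G \<gamma>) \<oplus>\<^bsub>F (trg G \<gamma>)\<^esub> act \<O> \<gamma> (\<beta> (src G \<gamma>)) = \<zero>\<^bsub>F (trg G \<gamma>)\<^esub>"
      using kill basicD(3)[OF b] by simp
    then show ?thesis using twist_apply[OF a bs_closed[OF b] g] SG_closed[OF bs_closed[OF b] g] by simp
  next
    case False
    then show ?thesis using twist_apply[OF a bs_closed[OF b] g] c bs_outside[OF g] by simp
  qed
  then show "twist \<alpha> \<beta> (bs s K \<phi>) \<gamma> = \<one>\<^bsub>SG\<^esub> \<gamma>" using SG_zero[OF g] by simp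
qed

text \<open>The section on the sources is free. Requiring the scalar to vanish along the bisection
  then prescribes \<alpha> on its range, as minus the transported section, and \<alpha> is set to
  zero elsewhere. These are the test pairs for \<open>twist_separates\<close>.\<close>

lemma twist_transport:
  assumes b: "basic s K \<phi>" and c: "cont_sec (\<lambda>x. x) K \<psi>"
  obtains \<alpha> where "\<alpha> \<in> unit_space_sections G \<O>" "usec K \<psi> \<in> unit_space_sections G \<O>"
    "twist \<alpha> (usec K \<psi>) (bs s K \<phi>) = \<one>\<^bsub>SG\<^esub>"
    "\<And>w. w \<in> K \<Longrightarrow> \<alpha> (\<theta> s w) = \<ominus>\<^bsub>F (\<theta> s w)\<^esub> act \<O> (germ D s w) (\<psi> w)"
    "\<And>z. z \<in> topspace X \<Longrightarrow> z \<notin> \<theta> s ` K \<Longrightarrow> \<alpha> z = \<zero>\<^bsub>F z\<^esub>"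
proof -
  note K = basicD[OF b]
  let ?L = "\<theta> s ` K"
  \<comment> \<open>The inverse map \<open>\<theta> (star s)\<close> recovers the source belonging
    to a range point z, and the germ of s carries the value of \<psi> back to z.\<close>
  let ?act = "\<lambda>z. act \<O> (germ D s (\<theta> (star s) z)) (\<psi> (\<theta> (star s) z))"
  have kL: "kopen ?L" using kopen_theta K(1,2) .
  have bk: "\<theta> (star s) z \<in> K" "\<theta> (star s) z \<in> D (star s)" "\<theta> s (\<theta> (star s) z) = z" if "z \<in> ?L" for z
    using that K(3) theta_star[of _ s] by auto
  have "?L \<subseteq> D (star (star s))" using K(3) theta_in by auto
  then have cont: "continuous_map (subtopology X ?L) X (\<theta> (star s))" by (rule theta_continuous_on)
  have 1: "cont_sec (\<theta> (star s)) ?L (\<lambda>z. \<psi> (\<theta> (star s) z))"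
    using bk(1) kopen_subset[OF kL] by (intro cont_sec_compose[OF c cont]) auto
  have 2: "continuous_map (subtopology X ?L) (Arr G) (\<lambda>z. germ D s (\<theta> (star s) z))"
    using continuous_map_compose[OF continuous_map_into_subtopology[OF cont] germ_continuous[of s]]
      bk(2) by (auto simp: o_def)
  have "cont_sec (\<lambda>z. trg G (germ D s (\<theta> (star s) z))) ?L ?act"
    using bk(2) by (intro cont_sec_act[OF 1 2]) simp
  then have "cont_sec (\<lambda>z. z) ?L ?act"
    by (rule cont_sec_cong) (simp_all add: bk(2,3))
  then have "cont_sec (\<lambda>z. z) ?L (\<lambda>z. \<ominus>\<^bsub>F z\<^esub> ?act z)"
    by (rule cont_sec_minus) (simp add: continuous_map_from_subtopology)
  define \<alpha> where "\<alpha> = usec ?L (\<lambda>z. \<ominus>\<^bsub>F z\<^esub> ?act z)"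
  have a: "\<alpha> \<in> unit_space_sections G \<O>"
    unfolding \<alpha>_def using \<open>cont_sec (\<lambda>z. z) ?L (\<lambda>z. \<ominus>\<^bsub>F z\<^esub> ?act z)\<close> kL by (rule usec_unit_section)
  have u: "usec K \<psi> \<in> unit_space_sections G \<O>" using c K(1) by (rule usec_unit_section)
  have w: "\<alpha> (\<theta> s w) = \<ominus>\<^bsub>F (\<theta> s w)\<^esub> act \<O> (germ D s w) (\<psi> w)" if "w \<in> K" for w
    using that K(3,6) theta_star[of w s] by (simp add: \<alpha>_def usec_apply)
  have "twist \<alpha> (usec K \<psi>) (bs s K \<phi>) = \<one>\<^bsub>SG\<^esub>"
  proof (rule twist_eq_zero[OF a u b])
    fix x assume x: "x \<in> K"
    interpret ring "F (\<theta> s x)" using ring_F K(6)[OF x] .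
    have "act \<O> (germ D s x) (\<psi> x) \<in> carrier (F (\<theta> s x))"
      using act_germ_closed K(3)[OF x] cont_secD(4)[OF c x] by simp
    moreover have "usec K \<psi> x = \<psi> x" using x cont_secD(2)[OF c x] by (simp add: usec_apply)
    ultimately show "\<alpha> (\<theta> s x) \<oplus>\<^bsub>F (\<theta> s x)\<^esub> act \<O> (germ D s x) (usec K \<psi> x) = \<zero>\<^bsub>F (\<theta> s x)\<^esub>"
      using w[OF x] by (simp add: l_neg)
  qed
  then show ?thesis using that a u w by (simp add: \<alpha>_def usec_apply)
qed

lemma one_F: "x \<in> topspace X \<Longrightarrow> \<one>\<^bsub>F x\<^esub> \<in> carrier (F x)" "x \<in> topspace X \<Longrightarrow> \<one>\<^bsub>F x\<^esub> \<noteq> \<zero>\<^bsub>F x\<^esub>"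
  using field_F ring_F by (auto simp: ring.ring_simprules field_def domain_def domain_axioms_def)

lemma kopen_separate:
  assumes "x \<in> topspace X" "kopen K" "x \<notin> K"
  obtains V where "kopen V" "x \<in> V" "V \<inter> K = {}"
proof -
  have "openin X (topspace X - K)" "x \<in> topspace X - K" using kopen_closedin[OF assms(2)] assms by auto
  then obtain V where "kopen V" "x \<in> V" "V \<subseteq> topspace X - K" by (rule kopen_basis)
  then show ?thesis using that by blast
qed

text \<open>
  By \<open>twist_apply\<close>, the assumption says that every twist annihilating the basic section also
  annihilates all values at \<^term>\<open>\<gamma>\<close>.
\<close>

lemma twist_separates:
  assumes b: "basic s K \<phi>" and g: "\<gamma> \<in> Ar"
    and vanish: "\<And>\<alpha> \<beta>. \<lbrakk>\<alpha> \<in> unit_space_sections G \<O>; \<beta> \<in> unit_space_sections G \<O>;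
      twist \<alpha> \<beta> (bs s K \<phi>) = \<one>\<^bsub>SG\<^esub>\<rbrakk> \<Longrightarrow>
      \<alpha> (trg G \<gamma>) \<oplus>\<^bsub>F (trg G \<gamma>)\<^esub> act \<O> \<gamma> (\<beta> (src G \<gamma>)) = \<zero>\<^bsub>F (trg G \<gamma>)\<^esub>"
  shows "src G \<gamma> \<in> K" "\<theta> s (src G \<gamma>) = trg G \<gamma>"
    "a \<in> carrier (F (src G \<gamma>)) \<Longrightarrow> act \<O> (germ D s (src G \<gamma>)) a = act \<O> \<gamma> a"
proof -
  note K = basicD[OF b]
  define y z where "y = src G \<gamma>" and "z = trg G \<gamma>"
  have yz: "y \<in> topspace X" "z \<in> topspace X" using src_trg_in[OF g] by (simp_all add: y_def z_def)
  interpret ring "F z" using ring_F[OF yz(2)] .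
  have act1: "act \<O> \<gamma> \<one>\<^bsub>F y\<^esub> = \<one>\<^bsub>F z\<^esub>" and act0: "act \<O> \<gamma> \<zero>\<^bsub>F y\<^esub> = \<zero>\<^bsub>F z\<^esub>"
    using act_simps[OF g] by (simp_all add: y_def z_def)
  have actc: "act \<O> \<gamma> e \<in> carrier (F z)" if "e \<in> carrier (F y)" for e
    using act_closed[OF g] that by (simp add: y_def z_def)
  have yK: "y \<in> K"
  proof (rule ccontr)
    assume "y \<notin> K"
    then obtain V where V: "kopen V" "y \<in> V" "V \<inter> K = {}" using kopen_separate yz(1) K(1) by metis
    \<comment> \<open>Zero on the range side and one near y on the source side: the scalar vanishes
      along the bisection but equals one at \<gamma>.\<close>
    let ?z = "usec {} (\<lambda>x. \<one>\<^bsub>F x\<^esub>)" and ?o = "usec V (\<lambda>x. \<one>\<^bsub>F x\<^esub>)"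
    have u: "?z \<in> unit_space_sections G \<O>" "?o \<in> unit_space_sections G \<O>"
      using usec_one kopen_empty V(1) by auto
    have "twist ?z ?o (bs s K \<phi>) = \<one>\<^bsub>SG\<^esub>"
    proof (rule twist_eq_zero[OF u b])
      fix w assume w: "w \<in> K"
      interpret w: ring "F (\<theta> s w)" using ring_F K(6)[OF w] .
      have "w \<notin> V" "w \<in> topspace X" using w V(3) kopen_subset[OF K(1)] by auto
      then show "?z (\<theta> s w) \<oplus>\<^bsub>F (\<theta> s w)\<^esub> act \<O> (germ D s w) (?o w) = \<zero>\<^bsub>F (\<theta> s w)\<^esub>"
        using K(3,6)[OF w] act_simps(1)[of "germ D s w"] by (simp add: usec_apply)
    qed
    from vanish[OF u this] have "\<one>\<^bsub>F z\<^esub> = \<zero>\<^bsub>F z\<^esub>"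
      using yz V(2) act1 by (simp add: usec_apply flip: y_def z_def)
    then show False using one_F(2)[OF yz(2)] by simp
  qed
  \<comment> \<open>With \<psi> on the sources and its compensating transport on the ranges,
    vanishing of the scalar at \<gamma> compares the action of \<gamma> on \<psi> y with the value
    the bisection carries to z. The latter is zero if no arrow of the bisection ends at z.\<close>
  have tr: "(\<exists>w \<in> K. z = \<theta> s w \<and> act \<O> (germ D s w) (\<psi> w) = act \<O> \<gamma> (\<psi> y)) \<or>
      z \<notin> \<theta> s ` K \<and> act \<O> \<gamma> (\<psi> y) = \<zero>\<^bsub>F z\<^esub>"
    if c: "cont_sec (\<lambda>x. x) K \<psi>" for \<psi>
  proof -
    obtain \<alpha> where \<alpha>: "\<alpha> \<in> unit_space_sections G \<O>" "usec K \<psi> \<in> unit_space_sections G \<O>"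
      "twist \<alpha> (usec K \<psi>) (bs s K \<phi>) = \<one>\<^bsub>SG\<^esub>"
      and in_K: "\<And>w. w \<in> K \<Longrightarrow> \<alpha> (\<theta> s w) = \<ominus>\<^bsub>F (\<theta> s w)\<^esub> act \<O> (germ D s w) (\<psi> w)"
      and out_K: "\<And>z. z \<in> topspace X \<Longrightarrow> z \<notin> \<theta> s ` K \<Longrightarrow> \<alpha> z = \<zero>\<^bsub>F z\<^esub>"
      using twist_transport[OF b c] by blast
    have \<psi>y: "\<psi> y \<in> carrier (F y)" using cont_secD(4)[OF c yK] .
    have v: "\<alpha> z \<oplus>\<^bsub>F z\<^esub> act \<O> \<gamma> (\<psi> y) = \<zero>\<^bsub>F z\<^esub>"
      using vanish[OF \<alpha>] yz yK by (simp add: usec_apply flip: y_def z_def)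
    show ?thesis
    proof (cases "z \<in> \<theta> s ` K")
      case True
      then obtain w where w: "w \<in> K" "z = \<theta> s w" by blast
      have cl: "act \<O> (germ D s w) (\<psi> w) \<in> carrier (F z)"
        using act_germ_closed[OF K(3)] cont_secD(4)[OF c] w by simp
      then have "act \<O> \<gamma> (\<psi> y) = act \<O> (germ D s w) (\<psi> w)"
        using v in_K[OF w(1)] w(2) actc[OF \<psi>y] minus_equality[of "\<ominus>\<^bsub>F z\<^esub> act \<O> (germ D s w) (\<psi> w)" "act \<O> \<gamma> (\<psi> y)"]
        by (metis add.inv_closed minus_equality minus_minus)
      then show ?thesis using w by auto
    next
      case False
      then show ?thesis using v out_K[OF yz(2)] actc[OF \<psi>y] by simp
    qed
  qed
  have one_sec: "cont_sec (\<lambda>x. x) K (\<lambda>x. \<one>\<^bsub>F x\<^esub>)" using cont_sec_mono[OF cont_sec_one kopen_subset[OF K(1)]] .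
  \<comment> \<open>For the unit section the second alternative would say that one equals zero, so
    some arrow of the bisection ends at z, and w is its source. By injectivity of
    \<open>\<theta> s\<close> on its domain the same w serves every \<psi>.\<close>
  obtain w where w: "w \<in> K" "z = \<theta> s w"
    using tr[OF one_sec] act1 one_F(2)[OF yz(2)] by auto
  have inj: "w' = w" if "w' \<in> K" "z = \<theta> s w'" for w'
    using that w K(3) theta_inj[of s] by (auto dest: inj_onD)
  have tr_w: "act \<O> (germ D s w) (\<psi> w) = act \<O> \<gamma> (\<psi> y)" if c: "cont_sec (\<lambda>x. x) K \<psi>" for \<psi>
  proof -
    have "z \<in> \<theta> s ` K" using w by blast
    then obtain w' where "w' \<in> K" "z = \<theta> s w'" "act \<O> (germ D s w') (\<psi> w') = act \<O> \<gamma> (\<psi> y)"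
      using tr[OF c] by blast
    moreover from this(1,2) have "w' = w" by (rule inj)
    ultimately show ?thesis by simp
  qed
  have "w = y"
  proof (rule ccontr)
    assume "w \<noteq> y"
    \<comment> \<open>A section that is one at y and zero at w would give the same element of the
      stalk over z as both one and zero.\<close>
    have "openin X (K - {w})"
      using K(1) Hausdorff w(1) kopen_subset[OF K(1)]
      by (auto simp: kopen_def intro!: openin_diff closedin_Hausdorff_singleton)
    then obtain V where V: "kopen V" "y \<in> V" "V \<subseteq> K - {w}"
      using yK \<open>w \<noteq> y\<close> kopen_basis by (metis Diff_iff singletonD)
    let ?\<psi> = "usec V (\<lambda>x. \<one>\<^bsub>F x\<^esub>)"
    have "cont_sec (\<lambda>x. x) K ?\<psi>"
      using cont_sec_mono[OF unit_sectionD(1)[OF usec_one[OF V(1)]] kopen_subset[OF K(1)]] .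
    then have "act \<O> (germ D s w) (?\<psi> w) = act \<O> \<gamma> (?\<psi> y)" by (rule tr_w)
    moreover have "w \<in> topspace X" "w \<notin> V" using w(1) V(3) kopen_subset[OF K(1)] by auto
    ultimately have "act \<O> (germ D s w) \<zero>\<^bsub>F w\<^esub> = act \<O> \<gamma> \<one>\<^bsub>F y\<^esub>"
      using V(2) yz by (simp add: usec_apply)
    then have "\<zero>\<^bsub>F z\<^esub> = \<one>\<^bsub>F z\<^esub>"
      using act1 act_simps(1)[of "germ D s w"] K(3)[OF w(1)] w(2) by simp
    then show False using one_F(2)[OF yz(2)] by simp
  qed
  then show "src G \<gamma> \<in> K" "\<theta> s (src G \<gamma>) = trg G \<gamma>" using w by (simp_all add: y_def z_def)
  assume "a \<in> carrier (F (src G \<gamma>))"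
  then have "a \<in> carrier (F y)" by (simp add: y_def)
  \<comment> \<open>Every stalk element extends to a local section and then, by zero, to K, so the
    comparison in \<open>tr_w\<close> reaches the whole stalk.\<close>
  then obtain V \<psi> where V: "kopen V" "y \<in> V" "V \<subseteq> K" "cont_sec (\<lambda>x. x) V \<psi>" "\<psi> y = a"
    using cont_sec_extend[OF yz(1), of a K] yK K(1) unfolding kopen_def by metis
  have "cont_sec (\<lambda>x. x) K (usec V \<psi>)"
    using cont_sec_mono[OF unit_sectionD(1)[OF usec_unit_section[OF V(4,1)]] kopen_subset[OF K(1)]] .
  from tr_w[OF this] have "act \<O> (germ D s y) (usec V \<psi> y) = act \<O> \<gamma> (usec V \<psi> y)"
    using \<open>w = y\<close> by simp
  then show "act \<O> (germ D s (src G \<gamma>)) a = act \<O> \<gamma> a"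
    using V(2,5) yz(1) by (simp add: usec_apply y_def)
qed

text \<open>At an arrow \<gamma> the two products with a diagonal section differ only in whether its
  value is taken at the range or transported by \<gamma> from the source; where f vanishes both are
  zero.\<close>

lemma centralizes_diagonal:
  assumes f: "f \<in> carrier SR"
    and supp: "\<And>\<gamma>. \<lbrakk>\<gamma> \<in> Ar; f \<gamma> \<noteq> \<zero>\<^bsub>F (trg G \<gamma>)\<^esub>\<rbrakk> \<Longrightarrow>
      src G \<gamma> = trg G \<gamma> \<and> (\<forall>a \<in> carrier (F (src G \<gamma>)). act \<O> \<gamma> a = a)"
  shows "f \<in> SR.centralizer (diagonal_subring G \<O>)"
  unfolding SR.centralizer_def
proof (intro CollectI conjI ballI f)
  fix d assume "d \<in> diagonal_subring G \<O>"
  then obtain \<alpha> where \<alpha>: "\<alpha> \<in> unit_space_sections G \<O>" "d = ext \<alpha>" by (auto simp: diagonal_subring_def)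
  note fS = SR_SG[OF f]
  have "conv f (ext \<alpha>) = conv (ext \<alpha>) f"
  proof (rule SG_eqI[OF conv_closed[OF fS ext_closed] conv_closed[OF ext_closed fS]])
    fix \<gamma> assume g: "\<gamma> \<in> Ar"
    interpret field "F (trg G \<gamma>)" using field_F src_trg_in(2)[OF g] .
    have a: "\<alpha> (trg G \<gamma>) \<in> carrier (F (trg G \<gamma>))" "act \<O> \<gamma> (\<alpha> (src G \<gamma>)) \<in> carrier (F (trg G \<gamma>))"
      using unit_sectionD(2)[OF \<alpha>(1)] src_trg_in[OF g] act_closed[OF g] by auto
    show "conv f (ext \<alpha>) \<gamma> = conv (ext \<alpha>) f \<gamma>"
    proof (cases "f \<gamma> = \<zero>\<^bsub>F (trg G \<gamma>)\<^esub>")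
      case True
      then show ?thesis using a by (simp add: conv_ext_left[OF \<alpha>(1) fS g] conv_ext_right[OF \<alpha>(1) fS g])
    next
      case False
      have "act \<O> \<gamma> (\<alpha> (src G \<gamma>)) = \<alpha> (trg G \<gamma>)" using supp[OF g False] a(1) by simp
      then show ?thesis
        using a SG_closed[OF fS g]
        by (simp add: conv_ext_left[OF \<alpha>(1) fS g] conv_ext_right[OF \<alpha>(1) fS g] m_comm)
    qed
  qed (use \<alpha> in auto)
  then show "f \<otimes>\<^bsub>SR\<^esub> d = d \<otimes>\<^bsub>SR\<^esub> f" by (simp add: \<alpha>(2))
qed

section \<open>Shortest sums in an ideal\<close>

lemma lsum_map:
  assumes T: "T \<one>\<^bsub>SG\<^esub> = \<one>\<^bsub>SG\<^esub>"
    "\<And>f g. \<lbrakk>f \<in> carrier SR; g \<in> carrier SR\<rbrakk> \<Longrightarrow> T (f \<otimes>\<^bsub>SG\<^esub> g) = T f \<otimes>\<^bsub>SG\<^esub> T g"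
  shows "set bl \<subseteq> Basics \<Longrightarrow> T (lsum bl) = lsum (map T bl)"
  by (induction bl) (use T lsum_closed Basics_SR in auto)

lemma lsum_nonzero:
  assumes "set bl \<subseteq> carrier SG" "\<gamma> \<in> Ar" "lsum bl \<gamma> \<noteq> \<zero>\<^bsub>F (trg G \<gamma>)\<^esub>"
  obtains b where "b \<in> set bl" "b \<gamma> \<noteq> \<zero>\<^bsub>F (trg G \<gamma>)\<^esub>"
proof -
  interpret ring "F (trg G \<gamma>)" using ring_trg[OF assms(2)] .
  have "\<exists>b \<in> set bl. b \<gamma> \<noteq> \<zero>\<^bsub>F (trg G \<gamma>)\<^esub>"
    using assms(1,3)
  proof (induction bl)
    case Nil
    then show ?case using SG_zero[OF assms(2)] by simp
  next
    case (Cons b bl)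
    then have "lsum bl \<gamma> \<in> carrier (F (trg G \<gamma>))" using SG_closed[OF lsum_SG assms(2)] by simp
    with Cons show ?case using SG_add[OF assms(2)] by (cases "b \<gamma> = \<zero>\<^bsub>F (trg G \<gamma>)\<^esub>") auto
  qed
  then show ?thesis using that by blast
qed

lemma SG_nonzero:
  assumes "f \<in> carrier SG" "f \<noteq> \<one>\<^bsub>SG\<^esub>"
  obtains \<gamma> where "\<gamma> \<in> Ar" "f \<gamma> \<noteq> \<zero>\<^bsub>F (trg G \<gamma>)\<^esub>"
  using assms SG_eqI[OF assms(1) SG.one_closed] SG_zero by metis

lemma twist_zero:
  assumes a: "\<alpha> \<in> unit_space_sections G \<O>" "\<beta> \<in> unit_space_sections G \<O>"
  shows "twist \<alpha> \<beta> \<one>\<^bsub>SG\<^esub> = \<one>\<^bsub>SG\<^esub>"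
  using assms by (simp add: twist_def conv_null ext_closed)

lemma twist_add:
  assumes a: "\<alpha> \<in> unit_space_sections G \<O>" "\<beta> \<in> unit_space_sections G \<O>"
    and ext_SR: "ext \<alpha> \<in> carrier SR"
    and f: "f \<in> carrier SR" "g \<in> carrier SR"
  shows "twist \<alpha> \<beta> (f \<otimes>\<^bsub>SG\<^esub> g) = twist \<alpha> \<beta> f \<otimes>\<^bsub>SG\<^esub> twist \<alpha> \<beta> g"
  using assms
  by (simp add: twist_def conv_l_distr conv_r_distr SR_SG ext_closed conv_closed SG.m_ac)

lemma ideal_meets_diagonal:
  assumes mc: "maximal_commutative SR (diagonal_subring G \<O>)"
    and I: "SR.two_sided_ideal I" and h: "h \<in> I" "h \<noteq> \<one>\<^bsub>SG\<^esub>"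
  obtains f where "f \<in> I" "f \<noteq> \<one>\<^bsub>SG\<^esub>" "f \<in> diagonal_subring G \<O>"
proof -
  have sub: "subgroup I (add_monoid SR)"
    and mult: "\<And>a r. a \<in> I \<Longrightarrow> r \<in> carrier SR \<Longrightarrow> conv r a \<in> I \<and> conv a r \<in> I"
    using I by (auto simp: SR.two_sided_ideal_def)
  have ISR: "a \<in> carrier SR" if "a \<in> I" for a using subgroup.subset[OF sub] that by auto
  have Iadd: "a \<otimes>\<^bsub>SG\<^esub> b \<in> I" if "a \<in> I" "b \<in> I" for a b
    using subgroup.m_closed[OF sub that] by simp
  have ext_SR: "ext \<alpha> \<in> carrier SR" if "\<alpha> \<in> unit_space_sections G \<O>" for \<alpha>
  proof -
    \<comment> \<open>That extended unit sections belong to the section ring is read off the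
      hypothesis: a commutative subring is in particular an additive subgroup.\<close>
    have "subgroup (diagonal_subring G \<O>) (add_monoid SR)"
      using mc by (simp add: maximal_commutative_def commutative_subring_def)
    then have "diagonal_subring G \<O> \<subseteq> carrier SR" using subgroup.subset by fastforce
    then show ?thesis using that by (auto simp: diagonal_subring_def)
  qed
  \<comment> \<open>The minimum is taken over all nonzero elements of I at once, not over the
    representations of one element, because the translated and twisted sums below are other elements
    of I.\<close>
  define P where "P n \<longleftrightarrow> (\<exists>bl. set bl \<subseteq> Basics \<and> length bl = n \<and> lsum bl \<in> I \<and> lsum bl \<noteq> \<one>\<^bsub>SG\<^esub>)" for n
  obtain hl where "set hl \<subseteq> Basics" "h = lsum hl" using SR_lsum[OF ISR[OF h(1)]] by blast
  then have "P (length hl)" using h by (auto simp: P_def)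
  then have "P (LEAST n. P n)" by (rule LeastI)
  then obtain bl where bl: "set bl \<subseteq> Basics" "length bl = (LEAST n. P n)" "lsum bl \<in> I" "lsum bl \<noteq> \<one>\<^bsub>SG\<^esub>"
    by (auto simp: P_def)
  have min: "length bl \<le> length cl"
    if "set cl \<subseteq> Basics" "lsum cl \<in> I" "lsum cl \<noteq> \<one>\<^bsub>SG\<^esub>" for cl
    using Least_le[of P "length cl"] that bl(2) by (auto simp: P_def)
  let ?f = "lsum bl"
  have fS: "?f \<in> carrier SG" "?f \<in> carrier SR" using ISR[OF bl(3)] SR_SG by auto
  obtain \<gamma>\<^sub>0 where g0: "\<gamma>\<^sub>0 \<in> Ar" "?f \<gamma>\<^sub>0 \<noteq> \<zero>\<^bsub>F (trg G \<gamma>\<^sub>0)\<^esub>" using SG_nonzero[OF fS(1) bl(4)] by blast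
  obtain b where b: "b \<in> set bl" "b \<gamma>\<^sub>0 \<noteq> \<zero>\<^bsub>F (trg G \<gamma>\<^sub>0)\<^esub>"
    using lsum_nonzero[OF _ g0] bl(1) Basics_subset by blast
  then obtain s K \<phi> where bb: "basic s K \<phi>" "b = bs s K \<phi>" using bl(1) by (auto simp: Basics_def)
  note K = basicD[OF bb(1)]
  have "\<gamma>\<^sub>0 \<in> germ D s ` K" using bs_outside[OF g0(1), of s K \<phi>] b(2) bb(2) by blast
  then obtain y where y: "y \<in> K" "\<gamma>\<^sub>0 = germ D s y" by blast
  \<comment> \<open>This section is one on the inverse of the bisection of b, so
    \<open>conv b u\<close> is basic for the idempotent \<open>s * star s\<close> and lives on
    identity arrows.\<close>
  define u where "u = bs (star s) (\<theta> s ` K) (\<lambda>z. \<one>\<^bsub>F (\<theta> (star s) z)\<^esub>)"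
  have KD: "\<theta> s ` K \<subseteq> D (star (star s))" using K(3) theta_in by auto
  have bu: "basic (star s) (\<theta> s ` K) (\<lambda>z. \<one>\<^bsub>F (\<theta> (star s) z)\<^esub>)"
    unfolding basic_def
  proof (intro conjI KD kopen_theta[OF K(1,2)])
    show "cont_sec (\<theta> (star s)) (\<theta> s ` K) (\<lambda>z. \<one>\<^bsub>F (\<theta> (star s) z)\<^esub>)"
      using theta_star[of _ s] K(3) kopen_subset[OF K(1)] kopen_subset[OF kopen_theta[OF K(1,2)]]
      by (intro cont_sec_compose[OF cont_sec_one theta_continuous_on[OF KD]]) auto
  qed
  have uS: "u \<in> carrier SG" "u \<in> carrier SR" using bs_closed[OF bu] bs_SR[OF bu] by (simp_all add: u_def)
  \<comment> \<open>Multiplication by u acts summand by summand, so the translated sum has the same,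
    hence still minimal, length.\<close>
  define bl' where "bl' = map (\<lambda>b. conv b u) bl"
  have "conv c u \<in> Basics" if c: "c \<in> Basics" for c
  proof -
    obtain t L \<psi> where "basic t L \<psi>" "c = bs t L \<psi>" using c by (auto simp: Basics_def)
    then show ?thesis using bs_mult[OF _ bu] unfolding Basics_def u_def by blast
  qed
  then have bl': "set bl' \<subseteq> Basics" using bl(1) by (auto simp: bl'_def)
  have f': "conv ?f u = lsum bl'"
    unfolding bl'_def using bl(1) uS by (intro lsum_map) (simp_all add: conv_null conv_l_distr)
  have I': "lsum bl' \<in> I" using mult[OF bl(3) uS(2)] by (simp add: f')
  let ?\<rho> = "germ D (star s) (\<theta> s y)"
  have ty: "\<theta> (star s) (\<theta> s y) = y" "\<theta> s y \<in> D s" "y \<in> D (star s)"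
    using y(1) K(3) theta_star theta_in by auto
  have cp: "(\<gamma>\<^sub>0, ?\<rho>) \<in> composable G"
    using composable_germ[of "\<theta> s y" "star s" s] ty by (simp add: y(2))
  \<comment> \<open>The arrow \<open>?\<rho>\<close> is inverse to \<open>\<gamma>\<^sub>0\<close>.
    As u lives on a bisection, only this factorisation contributes at their product, so the value of
    the sum at \<open>\<gamma>\<^sub>0\<close> reappears there and the translated sum is not
    zero.\<close>
  have "conv ?f u (gmult G \<gamma>\<^sub>0 ?\<rho>) = ?f \<gamma>\<^sub>0 \<otimes>\<^bsub>F (trg G \<gamma>\<^sub>0)\<^esub> act \<O> \<gamma>\<^sub>0 (u ?\<rho>)"
  proof (rule conv_single[OF fS(1) uS(1) cp])
    fix \<beta> \<rho> assume p: "(\<beta>, \<rho>) \<in> fact_pairs (gmult G \<gamma>\<^sub>0 ?\<rho>)" "(\<beta>, \<rho>) \<noteq> (\<gamma>\<^sub>0, ?\<rho>)"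
    note q = fact_pairsD[OF p(1)]
    have "\<rho> \<notin> germ D (star s) ` (\<theta> s ` K)"
    proof
      assume "\<rho> \<in> germ D (star s) ` (\<theta> s ` K)"
      then obtain z where z: "z \<in> \<theta> s ` K" "\<rho> = germ D (star s) z" by blast
      then have "z = \<theta> s y" using q(6) gmult_closed(2)[OF cp] KD ty(2) by auto
      then have "\<rho> = ?\<rho>" using z by simp
      moreover from this have "\<beta> = \<gamma>\<^sub>0" using gmult_right_cancel q(1,7) cp by blast
      ultimately show False using p(2) by simp
    qed
    then show "?f \<beta> = \<zero>\<^bsub>F (trg G \<beta>)\<^esub> \<or> u \<rho> = \<zero>\<^bsub>F (trg G \<rho>)\<^esub>"
      using bs_outside[OF q(3)] by (simp add: u_def)
  qed
  moreover have "act \<O> \<gamma>\<^sub>0 (u ?\<rho>) = \<one>\<^bsub>F (trg G \<gamma>\<^sub>0)\<^esub>"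
    using act_simps(2)[OF g0(1)] y ty KD by (simp add: u_def bs_germ)
  moreover have "?f \<gamma>\<^sub>0 \<otimes>\<^bsub>F (trg G \<gamma>\<^sub>0)\<^esub> \<one>\<^bsub>F (trg G \<gamma>\<^sub>0)\<^esub> = ?f \<gamma>\<^sub>0"
  proof -
    interpret ring "F (trg G \<gamma>\<^sub>0)" using ring_trg[OF g0(1)] .
    show ?thesis using SG_closed[OF fS(1) g0(1)] by simp
  qed
  ultimately have "lsum bl' (gmult G \<gamma>\<^sub>0 ?\<rho>) \<noteq> \<zero>\<^bsub>F (trg G (gmult G \<gamma>\<^sub>0 ?\<rho>))\<^esub>"
    using g0(2) gmult_closed(3)[OF cp] by (simp add: f')
  then have nz': "lsum bl' \<noteq> \<one>\<^bsub>SG\<^esub>" using SG_zero gmult_closed(1)[OF cp] by auto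
  have fS': "lsum bl' \<in> carrier SR" "lsum bl' \<in> carrier SG" using ISR[OF I'] SR_SG by auto
  \<comment> \<open>If the scalar were nonzero, the twisted sum would be nonzero at \<gamma>, would
    still lie in I, and would be the sum of the twists of the summands other than c: a list shorter
    than the minimum.\<close>
  have vanish: "\<alpha> (trg G \<gamma>) \<oplus>\<^bsub>F (trg G \<gamma>)\<^esub> act \<O> \<gamma> (\<beta> (src G \<gamma>)) = \<zero>\<^bsub>F (trg G \<gamma>)\<^esub>"
    if a: "\<alpha> \<in> unit_space_sections G \<O>" "\<beta> \<in> unit_space_sections G \<O>"
      and c: "c \<in> set bl'" "twist \<alpha> \<beta> c = \<one>\<^bsub>SG\<^esub>"
      and g: "\<gamma> \<in> Ar" "lsum bl' \<gamma> \<noteq> \<zero>\<^bsub>F (trg G \<gamma>)\<^esub>" for \<alpha> \<beta> c \<gamma>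
  proof (rule ccontr)
    assume nz: "\<alpha> (trg G \<gamma>) \<oplus>\<^bsub>F (trg G \<gamma>)\<^esub> act \<O> \<gamma> (\<beta> (src G \<gamma>)) \<noteq> \<zero>\<^bsub>F (trg G \<gamma>)\<^esub>"
    obtain pre suf where ps: "bl' = pre @ c # suf" using split_list[OF c(1)] by blast
    let ?T = "twist \<alpha> \<beta>"
    have TB: "?T ` Basics \<subseteq> Basics" using twist_basic[OF a] by (auto simp: Basics_def)
    have pS: "set pre \<subseteq> Basics" "set suf \<subseteq> Basics" using bl' ps by auto
    have "?T (lsum bl') = lsum (map ?T bl')"
      using bl' by (intro lsum_map) (simp_all add: twist_zero[OF a] twist_add[OF a ext_SR[OF a(1)]])
    also have "\<dots> = lsum (map ?T (pre @ suf))"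
    proof -
      have "set (map ?T pre) \<subseteq> carrier SG" "set (map ?T suf) \<subseteq> carrier SG"
        using pS TB Basics_subset by auto
      then show ?thesis by (simp add: ps c(2) lsum_append lsum_SG)
    qed
    finally have eq: "?T (lsum bl') = lsum (map ?T (pre @ suf))" .
    have "?T (lsum bl') \<in> I"
      using mult[OF I' ext_SR[OF a(1)]] mult[OF I' ext_SR[OF a(2)]] Iadd by (simp add: twist_def)
    moreover have "?T (lsum bl') \<noteq> \<one>\<^bsub>SG\<^esub>"
    proof -
      interpret field "F (trg G \<gamma>)" using field_F src_trg_in(2)[OF g(1)] .
      have "\<alpha> (trg G \<gamma>) \<oplus>\<^bsub>F (trg G \<gamma>)\<^esub> act \<O> \<gamma> (\<beta> (src G \<gamma>)) \<in> carrier (F (trg G \<gamma>))"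
        using unit_sectionD(2)[OF a(1)] unit_sectionD(2)[OF a(2)] src_trg_in[OF g(1)] act_closed[OF g(1)]
        by auto
      then have "?T (lsum bl') \<gamma> \<noteq> \<zero>\<^bsub>F (trg G \<gamma>)\<^esub>"
        using nz g SG_closed[OF fS'(2) g(1)] twist_apply[OF a fS'(2) g(1)] by (simp add: integral_iff)
      then show ?thesis using SG_zero[OF g(1)] by auto
    qed
    moreover have "set (map ?T (pre @ suf)) \<subseteq> Basics" using pS TB by auto
    ultimately have "length bl \<le> length (map ?T (pre @ suf))" using min eq by metis
    moreover have "length bl = length bl'" by (simp add: bl'_def)
    ultimately show False by (simp add: ps)
  qed
  have "lsum bl' \<in> SR.centralizer (diagonal_subring G \<O>)"
  proof (rule centralizes_diagonal[OF fS'(1)])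
    fix \<gamma> assume g: "\<gamma> \<in> Ar" "lsum bl' \<gamma> \<noteq> \<zero>\<^bsub>F (trg G \<gamma>)\<^esub>"
    let ?e = "s * star s"
    \<comment> \<open>This is the translate of b. Only this summand is tested by
      \<open>twist_separates\<close>, while \<gamma> ranges over the support of the whole
      sum.\<close>
    obtain M \<eta> where c: "basic ?e M \<eta>" "conv b u = bs ?e M \<eta>"
      by (rule that[OF bs_mult[OF bb(1) bu, folded bb(2) u_def]])
    have cin: "bs ?e M \<eta> \<in> set bl'" using b(1) c(2) by (force simp: bl'_def)
    note v = vanish[OF _ _ cin _ g]
    have sep: "src G \<gamma> \<in> M" "\<theta> ?e (src G \<gamma>) = trg G \<gamma>"
      by (rule twist_separates[OF c(1) g(1)], rule v, assumption+)+
    \<comment> \<open>For an idempotent both the partial map and the action of its germs are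
      trivial, so agreement with them makes \<gamma> an isotropy arrow that acts as the
      identity.\<close>
    have e: "idem ?e" "star ?e = ?e" using idem_star_mult star_idem by auto
    have y: "src G \<gamma> \<in> D ?e" using sep(1) basicD(3)[OF c(1)] e by simp
    have "src G \<gamma> = trg G \<gamma>" using sep(2) theta_idem[OF e(1) y] by simp
    moreover have "act \<O> \<gamma> a = a" if "a \<in> carrier (F (src G \<gamma>))" for a
    proof -
      have "act \<O> (germ D ?e (src G \<gamma>)) a = act \<O> \<gamma> a"
        by (rule twist_separates(3)[OF c(1) g(1) _ that], rule v)
      then show ?thesis
        using ident_eq[OF e(1) y] act_ident_stalk[OF src_trg_in(1)[OF g(1)] that] by simp
    qed
    ultimately show "src G \<gamma> = trg G \<gamma> \<and> (\<forall>a \<in> carrier (F (src G \<gamma>)). act \<O> \<gamma> a = a)" by blast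
  qed
  then have "lsum bl' \<in> diagonal_subring G \<O>"
    using SR.maximal_commutative_centralizer[OF mc] by blast
  then show ?thesis using that I' nz' by blast
qed

section \<open>Idempotents in the radical\<close>

lemma conv_ext_ext:
  assumes "\<alpha> \<in> unit_space_sections G \<O>" "\<beta> \<in> unit_space_sections G \<O>" "\<delta> \<in> unit_space_sections G \<O>"
    and "\<And>x. x \<in> topspace X \<Longrightarrow> \<alpha> x \<otimes>\<^bsub>F x\<^esub> \<beta> x = \<delta> x"
  shows "conv (ext \<alpha>) (ext \<beta>) = ext \<delta>"
proof (rule SG_eqI[OF conv_closed[OF ext_closed ext_closed] ext_closed])
  fix \<gamma> assume g: "\<gamma> \<in> Ar"
  interpret ring "F (trg G \<gamma>)" using ring_trg[OF g] .
  have "conv (ext \<alpha>) (ext \<beta>) \<gamma> = \<alpha> (trg G \<gamma>) \<otimes>\<^bsub>F (trg G \<gamma>)\<^esub> ext \<beta> \<gamma>"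
    using conv_ext_left[OF assms(1) ext_closed[OF assms(2)] g] .
  also have "\<dots> = ext \<delta> \<gamma>"
  proof (cases "\<gamma> = ident G (src G \<gamma>)")
    case True
    define x where "x = src G \<gamma>"
    have x: "x \<in> topspace X" "\<gamma> = ident G x" using src_trg_in[OF g] True by (auto simp: x_def)
    then show ?thesis using assms(4) by (simp add: ext_ident)
  next
    case False
    then show ?thesis using ext_off[OF g False] unit_sectionD(2)[OF assms(1)] src_trg_in(2)[OF g] by simp
  qed
  finally show "conv (ext \<alpha>) (ext \<beta>) \<gamma> = ext \<delta> \<gamma>" .
qed (use assms in auto)

lemma semiprimitive_SR:
  assumes mc: "maximal_commutative SR (diagonal_subring G \<O>)"
  shows "semiprimitive SR"
  unfolding semiprimitive_def
proof (rule antisym)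
  have sub: "subgroup (jacobson_radical SR) (add_monoid SR)"
    and mult: "\<And>a r. a \<in> jacobson_radical SR \<Longrightarrow> r \<in> carrier SR \<Longrightarrow> conv a r \<in> jacobson_radical SR"
    using SR.jacobson_radical_ideal by (auto simp: SR.two_sided_ideal_def)
  show "{\<zero>\<^bsub>SR\<^esub>} \<subseteq> jacobson_radical SR" using subgroup.one_closed[OF sub] by simp
  show "jacobson_radical SR \<subseteq> {\<zero>\<^bsub>SR\<^esub>}"
  proof (rule ccontr)
    assume "\<not> jacobson_radical SR \<subseteq> {\<zero>\<^bsub>SR\<^esub>}"
    then obtain h where "h \<in> jacobson_radical SR" "h \<noteq> \<one>\<^bsub>SG\<^esub>" by auto
    then obtain f where f: "f \<in> jacobson_radical SR" "f \<noteq> \<one>\<^bsub>SG\<^esub>" "f \<in> diagonal_subring G \<O>"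
      using ideal_meets_diagonal[OF mc SR.jacobson_radical_ideal] by blast
    then obtain \<alpha> where \<alpha>: "\<alpha> \<in> unit_space_sections G \<O>" "f = ext \<alpha>" by (auto simp: diagonal_subring_def)
    obtain \<gamma> where g: "\<gamma> \<in> Ar" "f \<gamma> \<noteq> \<zero>\<^bsub>F (trg G \<gamma>)\<^esub>"
      using SG_nonzero f(2) ext_closed \<alpha> by metis
    define x where "x = src G \<gamma>"
    have x: "x \<in> topspace X" "\<gamma> = ident G x"
      using ext_off[OF g(1)] g(2) \<alpha>(2) src_trg_in(1)[OF g(1)] by (auto simp: x_def)
    then have "\<alpha> x \<noteq> \<zero>\<^bsub>F x\<^esub>" using g(2) \<alpha>(2) by (simp add: ext_ident)
    then obtain K \<psi> where K: "kopen K" "x \<in> K" "cont_sec (\<lambda>x. x) K \<psi>"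
      "\<And>y. y \<in> K \<Longrightarrow> \<alpha> y \<otimes>\<^bsub>F y\<^esub> \<psi> y = \<one>\<^bsub>F y\<^esub>"
      using cont_sec_inverse[OF unit_sectionD(1)[OF \<alpha>(1)] _ x(1)] by (metis openin_topspace)
    \<comment> \<open>Over K the section \<open>?w\<close> inverts \<alpha>, so multiplying f by its
      extension leaves \<open>?v\<close>, whose extension is an idempotent of the radical with value
      one at x.\<close>
    let ?v = "usec K (\<lambda>x. \<one>\<^bsub>F x\<^esub>)" and ?w = "usec K \<psi>"
    have v: "?v \<in> unit_space_sections G \<O>" and w: "?w \<in> unit_space_sections G \<O>"
      using usec_one[OF K(1)] usec_unit_section[OF K(3,1)] by auto
    have "subgroup (diagonal_subring G \<O>) (add_monoid SR)"
      using mc by (simp add: maximal_commutative_def commutative_subring_def)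
    then have "ext ?w \<in> carrier SR"
      using subgroup.subset w by (fastforce simp: diagonal_subring_def)
    then have "conv f (ext ?w) \<in> jacobson_radical SR" using mult f(1) by blast
    moreover have "conv f (ext ?w) = ext ?v"
      unfolding \<alpha>(2)
    proof (rule conv_ext_ext[OF \<alpha>(1) w v])
      fix z assume z: "z \<in> topspace X"
      interpret ring "F z" using ring_F[OF z] .
      show "\<alpha> z \<otimes>\<^bsub>F z\<^esub> ?w z = ?v z"
        using z K(4) unit_sectionD(2)[OF \<alpha>(1) z] by (simp add: usec_apply)
    qed
    moreover have "conv (ext ?v) (ext ?v) = ext ?v"
    proof (rule conv_ext_ext[OF v v v])
      fix z assume z: "z \<in> topspace X"
      interpret ring "F z" using ring_F[OF z] .
      show "?v z \<otimes>\<^bsub>F z\<^esub> ?v z = ?v z" using z by (simp add: usec_apply)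
    qed
    ultimately have "ext ?v = \<one>\<^bsub>SG\<^esub>"
      using SR.jacobson_radical_idempotent[of "ext ?v"] by simp
    then have "\<one>\<^bsub>F x\<^esub> = \<zero>\<^bsub>F x\<^esub>"
      using ext_ident[OF x(1), of ?v] SG_zero[of "ident G x"] x(1) K(2) by (simp add: usec_apply)
    then show False using one_F(2)[OF x(1)] by simp
  qed
qed

end

theorem proposition5p10:
  fixes X :: "'x topology"
    and D :: "'s::inverse_semigroup \<Rightarrow> 'x set"
    and \<theta> :: "'s \<Rightarrow> 'x \<Rightarrow> 'x"
    and \<O> :: "(('s \<times> 'x) set, 'x, 'e) ring_sheaf"
  assumes "locally_compact_space X" and "Hausdorff_space X" and "zero_dimensional_space X"
    and "inverse_semigroup_action X D \<theta>"
    and "sheaf_of_fields (germ_groupoid X D \<theta>) \<O>"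
    and "maximal_commutative (section_ring (germ_groupoid X D \<theta>) \<O>)
           (diagonal_subring (germ_groupoid X D \<theta>) \<O>)"
  shows "semiprimitive (section_ring (germ_groupoid X D \<theta>) \<O>)"
proof -
  interpret germ_sheaf_of_fields X D \<theta> \<O>
    using assms(2-5) by (intro germ_sheaf_of_fields.intro germ_sheaf_of_fields_axioms.intro)
  show ?thesis using assms(6) by (rule semiprimitive_SR)
qed

end
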